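(* Let $G$ be any group acting properly by automorphisms on a product of $k$ graphs which are all locally finite quasitrees. Then either a finite index subgroup of $G$ has an action of general type on one of these quasitrees (so that $G$ contains the free group $F_2$), or $G$ has a finite index subgroup $H$ with a normal subgroup $K$ of $H$ which is locally finite and such that $H/K\cong\mathbb{Z}^n$ for some $0\le n\le k$. In particular, if $G$ contains no subgroup which is infinite but locally finite, or even if $G$ contains no locally finite, infinite subgroup having a normaliser of finite index in $G$, then either $F_2\le G$ or $G$ is virtually $\mathbb{Z}^n$ for some $n$.
   Context: A quasitree is a geodesic metric space quasi-isometric to a simplicial tree; here each factor $Q_i$ is a connected locally finite graph which is a quasitree with its path metric (edges of length 1). The product $X=Q_1\times\cdots\times Q_k$ is regarded as a $k$-dimensional complex with the product cell structure, and automorphisms are combinatorial automorphisms of it; some finite index subgroup of $G$ preserves the factors and hence acts by graph automorphisms on each $Q_i$ (the actions on single quasitrees in the statement are of this kind). Acting properly means for every compact $C\subseteq X$ the set $\{g\in G: g(C)\cap C\ne\emptyset\}$ is finite; equivalently here every vertex of $X$ has finite stabiliser. A group is locally finite if every finitely generated subgroup is finite. An action on a hyperbolic space $Q$ is of general type if its limit set in the Gromov boundary $\partial Q$ is infinite and there are two loxodromic elements (elements $g$ with $\lim_{n\to\infty} d(g^n(x),x)/n>0$) with disjoint limit sets (pairs of limit points in $\partial Q$). *)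

theory Defs
  imports "HOL-Analysis.Analysis" "HOL-Algebra.Algebra"
begin

section \<open>Graphs\<close>

text \<open>
  Graphs may have loops and multiple edges. Vertices and edges live in one type of cells, so that an
  automorphism is a permutation of the cells; \<open>ends e\<close> is the set of the one or two endpoints of \<open>e\<close>.
\<close>

record 'a graph =
  verts :: "'a set"
  edges :: "'a set"
  ends :: "'a \<Rightarrow> 'a set"

definition wf_graph :: "'a graph \<Rightarrow> bool" where
  "wf_graph Q \<longleftrightarrow> verts Q \<inter> edges Q = {} \<and>
     (\<forall>e\<in>edges Q. ends Q e \<subseteq> verts Q \<and> card (ends Q e) \<in> {1, 2})"

definition adj :: "'a graph \<Rightarrow> ('a \<times> 'a) set" where
  "adj Q = {(v, w). \<exists>e\<in>edges Q. ends Q e = {v, w}}"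

definition connected_graph :: "'a graph \<Rightarrow> bool" where
  "connected_graph Q \<longleftrightarrow> verts Q \<noteq> {} \<and> (\<forall>v\<in>verts Q. \<forall>w\<in>verts Q. (v, w) \<in> (adj Q)\<^sup>*)"

definition locally_finite_graph :: "'a graph \<Rightarrow> bool" where
  "locally_finite_graph Q \<longleftrightarrow> (\<forall>v\<in>verts Q. finite {e \<in> edges Q. v \<in> ends Q e})"

text \<open>
  The path metric, edges having length 1. It is used on the vertex set, which is at
  Hausdorff distance at most 1/2 from all points of the (geodesic) metric graph.
\<close>

definition gdist :: "'a graph \<Rightarrow> 'a \<Rightarrow> 'a \<Rightarrow> real" where
  "gdist Q v w = real (LEAST n. (v, w) \<in> adj Q ^^ n)"

text \<open>A closed path of length 1 is a loop, one of length 2 a pair of parallel edges.\<close>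

definition graph_cycle :: "'a graph \<Rightarrow> 'a list \<Rightarrow> 'a list \<Rightarrow> bool" where
  "graph_cycle Q vs es \<longleftrightarrow> vs \<noteq> [] \<and> length es = length vs \<and> distinct vs \<and> distinct es \<and>
     set vs \<subseteq> verts Q \<and> set es \<subseteq> edges Q \<and>
     (\<forall>i<length vs. ends Q (es ! i) = {vs ! i, vs ! (Suc i mod length vs)})"

definition tree_graph :: "'a graph \<Rightarrow> bool" where
  "tree_graph T \<longleftrightarrow> wf_graph T \<and> connected_graph T \<and> (\<nexists>vs es. graph_cycle T vs es)"

definition quasi_isometric ::
  "'a set \<Rightarrow> ('a \<Rightarrow> 'a \<Rightarrow> real) \<Rightarrow> 'b set \<Rightarrow> ('b \<Rightarrow> 'b \<Rightarrow> real) \<Rightarrow> bool" where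
  "quasi_isometric M d N e \<longleftrightarrow> (\<exists>f\<in>M \<rightarrow> N. \<exists>A B. A \<ge> 1 \<and> B \<ge> 0 \<and>
     (\<forall>x\<in>M. \<forall>y\<in>M. d x y / A - B \<le> e (f x) (f y) \<and> e (f x) (f y) \<le> A * d x y + B) \<and>
     (\<forall>z\<in>N. \<exists>x\<in>M. e (f x) z \<le> B))"

text \<open>
  Taking the cells of the tree from the type of the cells of \<open>Q\<close> is no restriction: the image of a
  quasi-isometry from \<open>Q\<close> to a tree spans a quasi-dense subtree, which has at most as many cells as
  \<open>Q\<close> if \<open>Q\<close> has infinitely many vertices; and if \<open>Q\<close> has finitely many, one vertex suffices.
\<close>

definition quasitree :: "'a graph \<Rightarrow> bool" where
  "quasitree Q \<longleftrightarrow> wf_graph Q \<and> connected_graph Q \<and>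
     (\<exists>T :: 'a graph. tree_graph T \<and> quasi_isometric (verts Q) (gdist Q) (verts T) (gdist T))"


section \<open>Cell structures and actions by automorphisms\<close>

definition cells :: "'a graph \<Rightarrow> 'a set" where
  "cells Q = verts Q \<union> edges Q"

definition face :: "'a graph \<Rightarrow> 'a \<Rightarrow> 'a \<Rightarrow> bool" where
  "face Q a b \<longleftrightarrow> a = b \<or> (b \<in> edges Q \<and> a \<in> ends Q b)"

definition prod_cells :: "nat \<Rightarrow> (nat \<Rightarrow> 'a graph) \<Rightarrow> (nat \<Rightarrow> 'a) set" where
  "prod_cells k Q = (\<Pi>\<^sub>E i\<in>{..<k}. cells (Q i))"

definition prod_face :: "nat \<Rightarrow> (nat \<Rightarrow> 'a graph) \<Rightarrow> (nat \<Rightarrow> 'a) \<Rightarrow> (nat \<Rightarrow> 'a) \<Rightarrow> bool" where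
  "prod_face k Q a b \<longleftrightarrow> (\<forall>i<k. face (Q i) (a i) (b i))"

text \<open>
  A combinatorial automorphism of a complex with cells \<open>C\<close> and face relation \<open>F\<close> is a permutation of \<open>C\<close>
  that preserves \<open>F\<close> in both directions. (Reversing a loop is invisible here; an action on a
  complex with such reversals still induces one on its cells, with the same vertex stabilisers.)
\<close>

definition acts_by_automorphisms ::
  "('g, 'm) monoid_scheme \<Rightarrow> 'c set \<Rightarrow> ('c \<Rightarrow> 'c \<Rightarrow> bool) \<Rightarrow> ('g \<Rightarrow> 'c \<Rightarrow> 'c) \<Rightarrow> bool" where
  "acts_by_automorphisms G C F \<phi> \<longleftrightarrow> group_action G C \<phi> \<and>
     (\<forall>g\<in>carrier G. \<forall>a\<in>C. \<forall>b\<in>C. F (\<phi> g a) (\<phi> g b) \<longleftrightarrow> F a b)"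

text \<open>
  \<open>D\<close> ranges over the finite subcomplexes: these are compact, and every compact set lies in one of them.
\<close>

definition proper_action ::
  "('g, 'm) monoid_scheme \<Rightarrow> 'c set \<Rightarrow> ('c \<Rightarrow> 'c \<Rightarrow> bool) \<Rightarrow> ('g \<Rightarrow> 'c \<Rightarrow> 'c) \<Rightarrow> bool" where
  "proper_action G C F \<phi> \<longleftrightarrow>
     (\<forall>D\<subseteq>C. finite D \<and> (\<forall>b\<in>D. \<forall>a\<in>C. F a b \<longrightarrow> a \<in> D) \<longrightarrow>
        finite {g \<in> carrier G. \<phi> g ` D \<inter> D \<noteq> {}})"

text \<open>
  \<open>\<phi>\<close> preserves each of the \<open>k\<close> factors, and \<open>\<psi> i\<close> is the action it induces on the \<open>i\<close>-th one.
\<close>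

definition factor_actions :: "('g, 'm) monoid_scheme \<Rightarrow> nat \<Rightarrow> (nat \<Rightarrow> 'a graph) \<Rightarrow>
    ('g \<Rightarrow> (nat \<Rightarrow> 'a) \<Rightarrow> (nat \<Rightarrow> 'a)) \<Rightarrow> (nat \<Rightarrow> 'g \<Rightarrow> 'a \<Rightarrow> 'a) \<Rightarrow> bool" where
  "factor_actions G k Q \<phi> \<psi> \<longleftrightarrow>
     (\<forall>i<k. acts_by_automorphisms G (cells (Q i)) (face (Q i)) (\<psi> i)) \<and>
     (\<forall>g\<in>carrier G. \<forall>c\<in>prod_cells k Q. \<forall>i<k. \<phi> g c i = \<psi> i g (c i))"


section \<open>Gromov boundary and actions of general type\<close>

definition gromov_product :: "('a \<Rightarrow> 'a \<Rightarrow> real) \<Rightarrow> 'a \<Rightarrow> 'a \<Rightarrow> 'a \<Rightarrow> real" where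
  "gromov_product d p x y = (d x p + d y p - d x y) / 2"

definition gromov_related ::
  "'a set \<Rightarrow> ('a \<Rightarrow> 'a \<Rightarrow> real) \<Rightarrow> (nat \<Rightarrow> 'a) \<Rightarrow> (nat \<Rightarrow> 'a) \<Rightarrow> bool" where
  "gromov_related M d s t \<longleftrightarrow> (\<forall>p\<in>M.
     filterlim (\<lambda>(m, n). gromov_product d p (s m) (t n)) at_top (sequentially \<times>\<^sub>F sequentially))"

definition gromov_sequences :: "'a set \<Rightarrow> ('a \<Rightarrow> 'a \<Rightarrow> real) \<Rightarrow> (nat \<Rightarrow> 'a) set" where
  "gromov_sequences M d = {s. range s \<subseteq> M \<and> gromov_related M d s s}"

definition gromov_boundary :: "'a set \<Rightarrow> ('a \<Rightarrow> 'a \<Rightarrow> real) \<Rightarrow> (nat \<Rightarrow> 'a) set set" where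
  "gromov_boundary M d = gromov_sequences M d //
     {(s, t). s \<in> gromov_sequences M d \<and> t \<in> gromov_sequences M d \<and> gromov_related M d s t}"

text \<open>The limit set of a set \<open>S\<close> of group elements: the boundary points to which orbit sequences converge.\<close>

definition limit_set ::
  "'a set \<Rightarrow> ('a \<Rightarrow> 'a \<Rightarrow> real) \<Rightarrow> ('g \<Rightarrow> 'a \<Rightarrow> 'a) \<Rightarrow> 'g set \<Rightarrow> (nat \<Rightarrow> 'a) set set" where
  "limit_set M d \<psi> S = {\<xi> \<in> gromov_boundary M d.
     \<exists>x\<in>M. \<exists>g :: nat \<Rightarrow> 'g. range g \<subseteq> S \<and> (\<lambda>n. \<psi> (g n) x) \<in> \<xi>}"

definition loxodromic :: "('g, 'm) monoid_scheme \<Rightarrow> 'a set \<Rightarrow> ('a \<Rightarrow> 'a \<Rightarrow> real) \<Rightarrow>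
    ('g \<Rightarrow> 'a \<Rightarrow> 'a) \<Rightarrow> 'g \<Rightarrow> bool" where
  "loxodromic G M d \<psi> g \<longleftrightarrow>
     (\<forall>x\<in>M. \<exists>L>0. (\<lambda>n. d (\<psi> (g [^]\<^bsub>G\<^esub> n) x) x / real n) \<longlonglongrightarrow> L)"

definition general_type :: "('g, 'm) monoid_scheme \<Rightarrow> 'a set \<Rightarrow> ('a \<Rightarrow> 'a \<Rightarrow> real) \<Rightarrow>
    ('g \<Rightarrow> 'a \<Rightarrow> 'a) \<Rightarrow> bool" where
  "general_type G M d \<psi> \<longleftrightarrow> infinite (limit_set M d \<psi> (carrier G)) \<and>
     (\<exists>g\<in>carrier G. \<exists>h\<in>carrier G. loxodromic G M d \<psi> g \<and> loxodromic G M d \<psi> h \<and>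
        limit_set M d \<psi> (generate G {g}) \<inter> limit_set M d \<psi> (generate G {h}) = {})"


section \<open>Groups\<close>

definition finite_index :: "'g set \<Rightarrow> ('g, 'm) monoid_scheme \<Rightarrow> bool" where
  "finite_index H G \<longleftrightarrow> subgroup H G \<and> finite (rcosets\<^bsub>G\<^esub> H)"

definition general_type_on_factor :: "('g, 'm) monoid_scheme \<Rightarrow> nat \<Rightarrow> (nat \<Rightarrow> 'a graph) \<Rightarrow>
    ('g \<Rightarrow> (nat \<Rightarrow> 'a) \<Rightarrow> (nat \<Rightarrow> 'a)) \<Rightarrow> bool" where
  "general_type_on_factor G k Q \<phi> \<longleftrightarrow>
     (\<exists>H \<psi>. finite_index H G \<and> factor_actions (G\<lparr>carrier := H\<rparr>) k Q \<phi> \<psi> \<and>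
        (\<exists>i<k. general_type (G\<lparr>carrier := H\<rparr>) (verts (Q i)) (gdist (Q i)) (\<psi> i)))"

definition locally_finite_group :: "('g, 'm) monoid_scheme \<Rightarrow> bool" where
  "locally_finite_group G \<longleftrightarrow> (\<forall>S\<subseteq>carrier G. finite S \<longrightarrow> finite (generate G S))"

abbreviation Zn :: "nat \<Rightarrow> (nat \<Rightarrow> int) monoid" where
  "Zn n \<equiv> product_group {..<n} (\<lambda>_. integer_group)"

definition virtually_Zn :: "('g, 'm) monoid_scheme \<Rightarrow> nat \<Rightarrow> bool" where
  "virtually_Zn G n \<longleftrightarrow> (\<exists>H. finite_index H G \<and> G\<lparr>carrier := H\<rparr> \<cong> Zn n)"

text \<open>
  The free group on \<open>S\<close>: reduced words in the letters \<open>(x, True)\<close>, standing for \<open>x\<close>, and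
  \<open>(x, False)\<close>, standing for the inverse of \<open>x\<close>.
\<close>

definition inv_letter :: "'x \<times> bool \<Rightarrow> 'x \<times> bool" where
  "inv_letter a = (fst a, \<not> snd a)"

definition reduced_word :: "('x \<times> bool) list \<Rightarrow> bool" where
  "reduced_word w \<longleftrightarrow> successively (\<lambda>a b. b \<noteq> inv_letter a) w"

fun reduced_cons :: "'x \<times> bool \<Rightarrow> ('x \<times> bool) list \<Rightarrow> ('x \<times> bool) list" where
  "reduced_cons a [] = [a]"
| "reduced_cons a (b # w) = (if b = inv_letter a then w else a # b # w)"

definition free_group :: "'x set \<Rightarrow> ('x \<times> bool) list monoid" where
  "free_group S = \<lparr>carrier = {w. reduced_word w \<and> fst ` set w \<subseteq> S},
     monoid.mult = foldr reduced_cons, one = []\<rparr>"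

definition contains_F2 :: "('g, 'm) monoid_scheme \<Rightarrow> bool" where
  "contains_F2 G \<longleftrightarrow> (\<exists>H. subgroup H G \<and> G\<lparr>carrier := H\<rparr> \<cong> free_group {0, 1 :: nat})"

lemma inv_letter_simps [simp]: "inv_letter (inv_letter a) = a" "fst (inv_letter a) = fst a"
  by (auto simp: inv_letter_def)

lemma reduced_ConsD: "reduced_word (a # w) \<Longrightarrow> reduced_word w"
  by (cases w) (auto simp: reduced_word_def)

lemma reduced_reduced_cons: "reduced_word w \<Longrightarrow> reduced_word (reduced_cons a w)"
  by (cases w) (auto simp: reduced_word_def successively_Cons)

lemma reduced_foldr: "reduced_word v \<Longrightarrow> reduced_word (foldr reduced_cons u v)"
  by (induction u) (auto intro: reduced_reduced_cons)

lemma reduced_cons_cancel: "reduced_word w \<Longrightarrow> reduced_cons a (reduced_cons (inv_letter a) w) = w"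
  by (cases w rule: remdups_adj.cases) (auto simp: reduced_word_def)

lemma foldr_reduced_cons:
  assumes "reduced_word w"
  shows "foldr reduced_cons (reduced_cons a u) w = reduced_cons a (foldr reduced_cons u w)"
  using assms by (cases u) (auto simp: reduced_cons_cancel reduced_foldr)

lemma foldr_reduced_assoc:
  assumes "reduced_word w"
  shows "foldr reduced_cons (foldr reduced_cons u v) w
       = foldr reduced_cons u (foldr reduced_cons v w)"
  using assms by (induction u) (auto simp: foldr_reduced_cons)

lemma foldr_reduced_Nil: "reduced_word w \<Longrightarrow> foldr reduced_cons w [] = w"
proof (induction w)
  case (Cons a w)
  then show ?case by (cases w) (auto simp: reduced_word_def)
qed simp

lemma letters_reduced_cons: "fst ` set (reduced_cons a w) \<subseteq> insert (fst a) (fst ` set w)"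
  by (cases w) auto

lemma letters_foldr:
  "fst ` set (foldr reduced_cons u v) \<subseteq> fst ` set u \<union> fst ` set v"
proof (induction u)
  case (Cons a u)
  then show ?case using letters_reduced_cons[of a "foldr reduced_cons u v"] by simp blast
qed simp

lemma foldr_inverse:
  "\<exists>u. foldr reduced_cons u w = [] \<and> reduced_word u \<and> fst ` set u \<subseteq> fst ` set w" if "reduced_word w"
  using that
proof (induction w)
  case Nil
  show ?case by (rule exI[of _ "[]"]) (auto simp: reduced_word_def)
next
  case (Cons a w)
  then obtain u where u: "foldr reduced_cons u w = []" "reduced_word u" "fst ` set u \<subseteq> fst ` set w"
    using reduced_ConsD by blast
  have w: "reduced_word w" using Cons.prems reduced_ConsD by blast
  let ?v = "foldr reduced_cons u [inv_letter a]"
  have 1: "reduced_word [inv_letter a]" by (simp add: reduced_word_def)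
  have "foldr reduced_cons ?v (a # w)
      = foldr reduced_cons u (foldr reduced_cons [inv_letter a] (a # w))"
    by (rule foldr_reduced_assoc) (rule Cons.prems)
  also have "\<dots> = []" using u by simp
  finally show ?case
    using reduced_foldr[OF 1, of u] letters_foldr[of u "[inv_letter a]"] u
    by (intro exI[of _ ?v]) auto
qed

lemma group_free_group: "group (free_group S)"
proof (rule groupI)
  fix w assume "w \<in> carrier (free_group S)"
  then show "\<exists>u\<in>carrier (free_group S). u \<otimes>\<^bsub>free_group S\<^esub> w = \<one>\<^bsub>free_group S\<^esub>"
    using foldr_inverse[of w] unfolding free_group_def by fastforce
next
  fix u v assume "u \<in> carrier (free_group S)" "v \<in> carrier (free_group S)"
  then show "u \<otimes>\<^bsub>free_group S\<^esub> v \<in> carrier (free_group S)"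
    using letters_foldr[of u v] by (simp add: free_group_def reduced_foldr) blast
qed (auto simp: free_group_def foldr_reduced_assoc reduced_word_def)

end

(*
A finite index subgroup of G preserves the factors, because two edges at a vertex of the product have
different directions if and only if they span a square. By the bottleneck property each factor is
hyperbolic. If the action on a factor is not of general type, then either it has no loxodromic elements
or a finite index subgroup fixes an end of some loxodromic element. In the second case let A be a set of
vertices with finite coboundary that separates the two ends of this element. Only finitely many translates
of A separate two given vertices, and counting with sign those that separate a vertex from its image
is a homomorphism to the integers which is nonzero on all loxodromic elements. So there are a finite
index subgroup H and k characters of H on whose common kernel K no element is loxodromic on any factor.
A finitely generated subgroup of K has bounded orbits in every factor, again by the bottleneck property,
so it is finite by properness; and H/K embeds into Z^k. If K is finite, then the |K|!-th powers of elements
of H are central, which yields a finite index subgroup isomorphic to a subgroup of Z^k. Finally, an action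
of general type gives a free subgroup by ping-pong: paths with long steps and little backtracking
in a hyperbolic space do not close up.
*)

theory Submission
  imports Defs "HOL-Library.Transitive_Closure_Table"
begin

section \<open>Path metrics of graphs and trees\<close>

text \<open>The quotient has to be exactly Z^n, so an honest homomorphism is needed on the
  stabiliser of an end; the Busemann function of the end gives in general only a real-valued
  quasimorphism. Counting cuts is exactly additive, and local finiteness keeps the counts finite.
  The result is nonzero on every loxodromic element because all translates of A under the stabiliser
  contain a neighbourhood of the fixed end: powers of the element cross arbitrarily many cuts in one
  direction and boundedly many in the other. Parabolic behaviour is the second obstacle: in a
  general hyperbolic space a finitely generated group without loxodromic elements may have unbounded
  orbits. The bottleneck property forbids this, since an orbit, being coarsely connected, cannot
  bypass the midpoint of a geodesic. A finite index subgroup fixes an end of g because, without an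
  action of general type, every group element maps some end of g to an end of g. So finitely many
  cosets of two end stabilisers cover the group, and one of the two has finite index.\<close>

definition ndist :: "'a graph \<Rightarrow> 'a \<Rightarrow> 'a \<Rightarrow> nat" where
  "ndist Q v w = (LEAST n. (v, w) \<in> adj Q ^^ n)"

lemma gdist_ndist: "gdist Q v w = real (ndist Q v w)"
  by (simp add: gdist_def ndist_def)

lemma sym_adj: "sym (adj Q)"
  by (auto simp: adj_def sym_def insert_commute)

lemma sym_relpow: "sym R \<Longrightarrow> sym (R ^^ n)"
proof (induction n)
  case (Suc n)
  have "(y, x) \<in> R ^^ Suc n" if xy: "(x, y) \<in> R ^^ Suc n" for x y
  proof -
    obtain z where "(x, z) \<in> R ^^ n" "(z, y) \<in> R" using xy by auto
    then have "(y, z) \<in> R" "(z, x) \<in> R ^^ n" using Suc by (auto dest: symD)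
    then show ?thesis by (rule relpow_Suc_I2)
  qed
  then show ?case unfolding sym_def by blast
qed (auto simp: sym_def)

locale cgraph =
  fixes Q :: "'a graph"
  assumes wf: "wf_graph Q" and conn: "connected_graph Q"
begin

abbreviation "V \<equiv> verts Q"
abbreviation "nd \<equiv> ndist Q"

lemma adj_V: "(v, w) \<in> adj Q \<Longrightarrow> v \<in> V \<and> w \<in> V"
  using wf unfolding adj_def wf_graph_def by auto

lemma nd_le: "(v, w) \<in> adj Q ^^ n \<Longrightarrow> nd v w \<le> n"
  unfolding ndist_def by (rule Least_le)

lemma nd_relpow: "v \<in> V \<Longrightarrow> w \<in> V \<Longrightarrow> (v, w) \<in> adj Q ^^ nd v w"
  unfolding ndist_def using conn
  by (metis (mono_tags, lifting) LeastI connected_graph_def rtrancl_imp_relpow)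

lemma nd_refl [simp]: "nd v v = 0"
  using nd_le[of v v 0] by simp

lemma nd_eq_0: "v \<in> V \<Longrightarrow> w \<in> V \<Longrightarrow> nd v w = 0 \<longleftrightarrow> v = w"
  using nd_relpow[of v w] by auto

lemma nd_sym: "nd v w = nd w v"
  unfolding ndist_def by (metis sym_relpow[OF sym_adj] symD)

lemma nd_triangle: "v \<in> V \<Longrightarrow> w \<in> V \<Longrightarrow> u \<in> V \<Longrightarrow> nd v u \<le> nd v w + nd w u"
  by (rule nd_le) (auto simp: relpow_add intro: nd_relpow)

lemma nd_adj: "(v, w) \<in> adj Q \<Longrightarrow> nd v w \<le> 1"
  by (rule nd_le) auto

lemma nd_step:
  assumes "v \<in> V" "w \<in> V" "nd v w = Suc n"
  obtains u where "u \<in> V" "nd v u = n" "(u, w) \<in> adj Q"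
proof -
  have "(v, w) \<in> adj Q ^^ Suc n" using nd_relpow[OF assms(1,2)] assms(3) by simp
  then obtain u where u: "(v, u) \<in> adj Q ^^ n" "(u, w) \<in> adj Q" by auto
  then have "u \<in> V" "nd v u \<le> n" by (auto dest: adj_V nd_le)
  moreover have "nd v u \<ge> n"
    using nd_triangle[of v u w] nd_adj[OF u(2)] assms \<open>u \<in> V\<close> by simp
  ultimately show ?thesis using that u by simp
qed

lemma nd_geodesic:
  assumes "v \<in> V" "w \<in> V"
  obtains \<gamma> where "\<gamma> 0 = v" "\<gamma> (nd v w) = w" "\<And>i. i \<le> nd v w \<Longrightarrow> \<gamma> i \<in> V"
    "\<And>i. i < nd v w \<Longrightarrow> (\<gamma> i, \<gamma> (Suc i)) \<in> adj Q"
proof -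
  obtain \<gamma> where g: "\<gamma> 0 = v" "\<gamma> (nd v w) = w" "\<And>i. i < nd v w \<Longrightarrow> (\<gamma> i, \<gamma> (Suc i)) \<in> adj Q"
    using nd_relpow[OF assms] unfolding relpow_fun_conv by auto
  have "\<gamma> i \<in> V" if "i \<le> nd v w" for i
    using that g(2) g(3)[of i] assms(2) adj_V[of "\<gamma> i"] by (cases "i = nd v w") auto
  then show ?thesis using that g by blast
qed

lemma nd_between:
  assumes "v \<in> V" "w \<in> V" "n \<le> nd v w"
  obtains u where "u \<in> V" "nd v u = n" "nd v w = n + nd u w"
proof -
  have "\<exists>u\<in>V. nd v u = n \<and> nd v w = n + nd u w" if "nd v w = n + k" for k
    using that assms(2)
  proof (induction k arbitrary: w)
    case 0 then show ?case by auto
  next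
    case (Suc k)
    obtain w' where w': "w' \<in> V" "nd v w' = n + k" "(w', w) \<in> adj Q"
      using nd_step[of v w "n + k"] Suc assms by auto
    obtain u where u: "u \<in> V" "nd v u = n" "nd v w' = n + nd u w'" using Suc.IH[of w'] w' by auto
    have "nd u w \<le> nd u w' + 1" using nd_triangle[of u w' w] nd_adj[OF w'(3)] w' u Suc by simp
    moreover have "nd v w \<le> n + nd u w" using nd_triangle[of v u w] u Suc assms by simp
    ultimately show ?case using u w' Suc by auto
  qed
  from this[of "nd v w - n"] show ?thesis using that assms(3) by auto
qed

lemma finite_nd_ball:
  assumes "locally_finite_graph Q" "v \<in> V"
  shows "finite {w \<in> V. nd v w \<le> n}"
proof (induction n)
  case 0
  have "{w \<in> V. nd v w \<le> 0} \<subseteq> {v}" using assms by (auto simp: nd_eq_0)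
  then show ?case by (rule finite_subset) simp
next
  case (Suc n)
  let ?B = "{w \<in> V. nd v w \<le> n}"
  have "{w \<in> V. nd v w \<le> Suc n} \<subseteq> ?B \<union> (\<Union>u\<in>?B. \<Union>(ends Q ` {e \<in> edges Q. u \<in> ends Q e}))"
  proof
    fix w assume w: "w \<in> {w \<in> V. nd v w \<le> Suc n}"
    show "w \<in> ?B \<union> (\<Union>u\<in>?B. \<Union>(ends Q ` {e \<in> edges Q. u \<in> ends Q e}))"
    proof (cases "nd v w = Suc n")
      case True
      obtain u where "u \<in> V" "nd v u = n" "(u, w) \<in> adj Q" using nd_step[OF assms(2) _ True] w by auto
      then show ?thesis unfolding adj_def by fastforce
    qed (use w in auto)
  qed
  moreover have "finite (\<Union>(ends Q ` {e \<in> edges Q. u \<in> ends Q e}))" if "u \<in> ?B" for u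
  proof -
    have "finite (ends Q e)" if "e \<in> edges Q" for e
      using wf that unfolding wf_graph_def by (metis card.infinite insert_iff singletonD zero_neq_numeral zero_neq_one)
    then show ?thesis using that assms(1) unfolding locally_finite_graph_def by auto
  qed
  ultimately show ?case using Suc by (auto intro: finite_subset)
qed

end

text \<open>With at least three vertices the chosen edges are automatically distinct: two positions
  sharing an edge have the same two endpoints, so each is the cyclic successor of the other, which
  happens only for length 2.\<close>

lemma graph_cycleI:
  assumes "distinct vs" "3 \<le> length vs" "set vs \<subseteq> verts Q"
    and "\<And>i. i < length vs \<Longrightarrow> (vs ! i, vs ! (Suc i mod length vs)) \<in> adj Q"
  shows "\<exists>es. graph_cycle Q vs es"
proof -
  let ?n = "length vs"
  let ?s = "\<lambda>i. Suc i mod ?n"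
  have "\<forall>i\<in>{..<?n}. \<exists>e. e \<in> edges Q \<and> ends Q e = {vs ! i, vs ! ?s i}"
    using assms(4) by (auto simp: adj_def)
  then obtain e where e: "\<And>i. i < ?n \<Longrightarrow> e i \<in> edges Q \<and> ends Q (e i) = {vs ! i, vs ! ?s i}"
    using bchoice[of "{..<?n}" "\<lambda>i e. e \<in> edges Q \<and> ends Q e = {vs ! i, vs ! ?s i}"] by (metis lessThan_iff)
  have "i = j" if ij: "i < ?n" "j < ?n" "e i = e j" for i j
  proof (rule ccontr)
    assume "i \<noteq> j"
    have s: "?s i < ?n" "?s j < ?n" using assms(2) by (auto intro: mod_less_divisor)
    have "{vs ! i, vs ! ?s i} = {vs ! j, vs ! ?s j}" using e[OF ij(1)] e[OF ij(2)] ij(3) by simp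
    then have "vs ! i = vs ! ?s j \<and> vs ! ?s i = vs ! j"
      using \<open>i \<noteq> j\<close> ij assms(1) by (auto simp: doubleton_eq_iff nth_eq_iff_index_eq)
    then have "i = ?s j" "j = ?s i"
      using ij s assms(1) by (auto simp: nth_eq_iff_index_eq)
    moreover have "?s i = (if Suc i = ?n then 0 else Suc i)" "?s j = (if Suc j = ?n then 0 else Suc j)"
      using ij by (simp_all add: mod_Suc)
    ultimately have ij': "i = (if Suc j = ?n then 0 else Suc j)" "j = (if Suc i = ?n then 0 else Suc i)"
      by metis+
    show False
    proof (cases "Suc i = ?n")
      case True
      then have "j = 0" using ij'(2) by simp
      then show False using ij'(1) True assms(2) by simp
    next
      case False
      then have "j = Suc i" using ij'(2) by simp
      then show False using ij'(1) assms(2) by (cases "Suc j = ?n") simp_all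
    qed
  qed
  then have "distinct (map e [0..<?n])" by (auto simp: distinct_map inj_on_def)
  then have "graph_cycle Q vs (map e [0..<?n])"
    unfolding graph_cycle_def using assms e by auto
  then show ?thesis by blast
qed

lemma last_rtrancl_path: "rtrancl_path r x xs y \<Longrightarrow> last (x # xs) = y"
  by (induction rule: rtrancl_path.induct) auto

section \<open>Levels and ancestors in a rooted tree\<close>

locale tree = cgraph +
  assumes tree: "tree_graph Q"
begin

lemma no_cycle: "\<not> graph_cycle Q vs es"
  using tree by (auto simp: tree_graph_def)

text \<open>The walk to the centre of the ball and out again stays in the ball; deleting repetitions
  makes it simple. Vertices outside the ball can then close it to a cycle without
  self-intersections.\<close>

lemma tree_path:
  assumes p: "p \<in> V" and u: "u \<in> V" "u' \<in> V" and d: "nd p u \<le> n" "nd p u' \<le> n"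
  obtains xs where "xs \<noteq> []" "hd xs = u" "last xs = u'" "distinct xs" "set xs \<subseteq> {v\<in>V. nd p v \<le> n}"
    "\<And>i. Suc i < length xs \<Longrightarrow> (xs ! i, xs ! Suc i) \<in> adj Q"
proof -
  let ?r = "\<lambda>a b. (a, b) \<in> adj Q \<and> nd p a \<le> n \<and> nd p b \<le> n"
  have reach: "?r\<^sup>*\<^sup>* p w" if "w \<in> V" "nd p w \<le> n" for w
  proof -
    have "\<forall>w\<in>V. nd p w = k \<longrightarrow> ?r\<^sup>*\<^sup>* p w" if "k \<le> n" for k
      using that
    proof (induction k)
      case 0 then show ?case using p by (auto simp: nd_eq_0)
    next
      case (Suc k)
      show ?case
      proof (intro ballI impI)
        fix w assume w: "w \<in> V" "nd p w = Suc k"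
        obtain v where "v \<in> V" "nd p v = k" "(v, w) \<in> adj Q" using nd_step[OF p w] by auto
        then show "?r\<^sup>*\<^sup>* p w" using Suc w by (auto intro: rtranclp.rtrancl_into_rtrancl)
      qed
    qed
    then show ?thesis using that by auto
  qed
  have "symp ?r" by (auto intro!: sympI dest: symD[OF sym_adj])
  then have "?r\<^sup>*\<^sup>* u p" using reach[OF u(1) d(1)] by (rule sympD[OF symp_rtranclp])
  then have "?r\<^sup>*\<^sup>* u u'" using reach[OF u(2) d(2)] by auto
  then obtain ys where "rtrancl_path ?r u ys u'" by (auto simp: rtranclp_eq_rtrancl_path)
  then obtain xs where xs: "rtrancl_path ?r u xs u'" "distinct (u # xs)"
    by (rule rtrancl_path_distinct)
  have st: "?r ((u # xs) ! i) ((u # xs) ! Suc i)" if "Suc i < length (u # xs)" for i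
    using rtrancl_path_nth[OF xs(1), of i] that by simp
  have "set (u # xs) \<subseteq> {v\<in>V. nd p v \<le> n}"
  proof
    fix v assume "v \<in> set (u # xs)"
    then obtain i where i: "i < length (u # xs)" "v = (u # xs) ! i" by (metis in_set_conv_nth)
    show "v \<in> {v\<in>V. nd p v \<le> n}"
    proof (cases i)
      case 0 then show ?thesis using i u d by simp
    next
      case (Suc j) then show ?thesis using st[of j] i adj_V by auto
    qed
  qed
  moreover have "last (u # xs) = u'" using xs(1)
    by (rule last_rtrancl_path)
  ultimately show ?thesis using that[of "u # xs"] xs st by auto
qed

text \<open>Two parents would be joined by a simple path inside the ball of radius \<open>n\<close>.
  It avoids \<open>v\<close>, which lies one level further out, so \<open>v\<close> closes it to a
  cycle.\<close>

lemma unique_parent: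
  assumes p: "p \<in> V" and a: "(u, v) \<in> adj Q" "(u', v) \<in> adj Q"
    and d: "nd p u = n" "nd p u' = n" "nd p v = Suc n"
  shows "u = u'"
proof (rule ccontr)
  assume ne: "u \<noteq> u'"
  obtain xs where xs: "xs \<noteq> []" "hd xs = u" "last xs = u'" "distinct xs" "set xs \<subseteq> {v\<in>V. nd p v \<le> n}"
    "\<And>i. Suc i < length xs \<Longrightarrow> (xs ! i, xs ! Suc i) \<in> adj Q"
    using tree_path[OF p, of u u' n] a d adj_V by auto
  have l: "length xs \<ge> 2" using xs ne by (cases xs; cases "tl xs") auto
  have "\<exists>es. graph_cycle Q (v # xs) es"
  proof (rule graph_cycleI)
    show "distinct (v # xs)" using xs d by auto
    show "3 \<le> length (v # xs)" using l by simp
    show "set (v # xs) \<subseteq> V" using xs a adj_V by auto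
    fix i assume i: "i < length (v # xs)"
    show "((v # xs) ! i, (v # xs) ! (Suc i mod length (v # xs))) \<in> adj Q"
    proof (cases i)
      case 0
      then show ?thesis using xs(1,2) a(1) sym_adj[of Q] by (simp add: hd_conv_nth sym_def)
    next
      case (Suc j)
      show ?thesis
      proof (cases "Suc i = length (v # xs)")
        case True
        then show ?thesis using Suc xs(1,3) a(2) by (simp add: last_conv_nth)
      next
        case False
        then show ?thesis using i Suc xs(6)[of j] by (simp add: mod_less)
      qed
    qed
  qed
  then show False using no_cycle by blast
qed

text \<open>A loop is a cycle of length 1. Any other edge inside a sphere closes up, together with a
  simple path between parents of its endpoints, to a cycle of length at least 3; the path is a
  single vertex when the parents coincide.\<close>

lemma adj_level:
  assumes p: "p \<in> V" and a: "(v, w) \<in> adj Q"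
  shows "nd p v \<noteq> nd p w"
proof
  assume eq: "nd p v = nd p w"
  have V: "v \<in> V" "w \<in> V" using a adj_V by auto
  show False
  proof (cases "v = w")
    case True
    then obtain e where "e \<in> edges Q" "ends Q e = {v}" using a by (auto simp: adj_def)
    then have "graph_cycle Q [v] [e]" using V by (simp add: graph_cycle_def)
    then show False using no_cycle by blast
  next
    case False
    then have "nd p v \<noteq> 0" using eq V p nd_eq_0 by metis
    then obtain n where n: "nd p v = Suc n" "nd p w = Suc n" using eq not0_implies_Suc by auto
    obtain u where u: "u \<in> V" "nd p u = n" "(u, v) \<in> adj Q" using nd_step[OF p V(1) n(1)] by auto
    obtain u' where u': "u' \<in> V" "nd p u' = n" "(u', w) \<in> adj Q" using nd_step[OF p V(2) n(2)] by auto
    obtain xs where xs: "xs \<noteq> []" "hd xs = u" "last xs = u'" "distinct xs" "set xs \<subseteq> {v\<in>V. nd p v \<le> n}"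
      "\<And>i. Suc i < length xs \<Longrightarrow> (xs ! i, xs ! Suc i) \<in> adj Q"
      using tree_path[OF p, of u u' n] u u' by auto
    have "\<exists>es. graph_cycle Q (w # v # xs) es"
    proof (rule graph_cycleI)
      show "distinct (w # v # xs)" using xs n False by auto
      show "3 \<le> length (w # v # xs)" using xs(1) by (cases xs) auto
      show "set (w # v # xs) \<subseteq> V" using xs V by auto
      fix i assume i: "i < length (w # v # xs)"
      consider "i = 0" | "i = 1" | j where "i = Suc (Suc j)" "Suc j < length xs"
        | j where "i = Suc (Suc j)" "Suc j = length xs"
        using i by (cases i; cases "i - 1") (auto, metis less_SucE Suc_lessI)
      then show "((w # v # xs) ! i, (w # v # xs) ! (Suc i mod length (w # v # xs))) \<in> adj Q"
      proof cases
        case 1 then show ?thesis using a sym_adj[of Q] by (auto simp: sym_def)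
      next
        case 2 then show ?thesis using xs(1,2) u(3) sym_adj[of Q] by (auto simp: hd_conv_nth sym_def)
      next
        case 3 then show ?thesis using xs(6) by simp
      next
        case 4
        then have "xs ! j = u'" using xs(1,3) by (metis diff_Suc_1 last_conv_nth)
        moreover have "(w # v # xs) ! i = xs ! j" using 4(1) by simp
        moreover have "Suc i mod length (w # v # xs) = 0" using 4 by simp
        ultimately show ?thesis using u'(3) by simp
      qed
    qed
    then show False using no_cycle by blast
  qed
qed

text \<open>With a root \<open>p\<close> fixed, \<open>nd p v = nd p u + nd u v\<close> says that \<open>u\<close> is an ancestor of \<open>v\<close>.\<close>

lemma unique_ancestor:
  assumes p: "p \<in> V" and V: "u \<in> V" "u' \<in> V" "v \<in> V"
    and d: "nd p v = nd p u + nd u v" "nd p v = nd p u' + nd u' v" "nd p u = nd p u'"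
  shows "u = u'"
proof -
  have "\<forall>v\<in>V. nd p v = nd p u + nd u v \<and> nd p v = nd p u' + nd u' v \<and> nd u v = k \<longrightarrow> u = u'" for k
  proof (induction k)
    case 0 then show ?case using d(3) V by (auto simp: nd_eq_0)
  next
    case (Suc k)
    show ?case
    proof (intro ballI impI)
      fix v assume v: "v \<in> V" and
        h: "nd p v = nd p u + nd u v \<and> nd p v = nd p u' + nd u' v \<and> nd u v = Suc k"
      then have h': "nd u' v = Suc k" using d(3) by simp
      obtain a where a: "a \<in> V" "nd u a = k" "(a, v) \<in> adj Q" using nd_step[OF V(1) v] h by auto
      obtain b where b: "b \<in> V" "nd u' b = k" "(b, v) \<in> adj Q" using nd_step[OF V(2) v h'] by auto
      have "nd p a \<le> nd p u + k" "nd p v \<le> nd p a + 1"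
        using nd_triangle[OF p V(1) a(1)] nd_triangle[OF p a(1) v] nd_adj[OF a(3)] a by auto
      then have pa: "nd p a = nd p u + k" using h by simp
      have "nd p b \<le> nd p u' + k" "nd p v \<le> nd p b + 1"
        using nd_triangle[OF p V(2) b(1)] nd_triangle[OF p b(1) v] nd_adj[OF b(3)] b by auto
      then have pb: "nd p b = nd p u' + k" using h h' by simp
      have "a = b" by (rule unique_parent[OF p a(3) b(3) pa]) (use pb d(3) h in auto)
      have "nd p a = nd p u + nd u a" "nd p a = nd p u' + nd u' a" "nd u a = k"
        using pa pb a(2) b(2) \<open>a = b\<close> by auto
      then show "u = u'" using Suc a(1) by blast
    qed
  qed
  then show ?thesis using V d by blast
qed

text \<open>Induction along the walk. By \<open>adj_level\<close> each step changes the level by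
  exactly one: a step away from the root keeps the ancestor \<open>u\<close>, and so does a step
  towards it unless the walk stands at \<open>u\<close>, where the new vertex takes its place. For a
  walk of minimal length the last bound makes the level of \<open>u\<close> the Gromov product at
  \<open>p\<close>.\<close>

lemma common_ancestor:
  assumes p: "p \<in> V" and x: "x \<in> V" and xy: "(x, y) \<in> adj Q ^^ m"
  shows "\<exists>u\<in>V. nd p x = nd p u + nd u x \<and> nd p y = nd p u + nd u y \<and> nd u x + nd u y \<le> m"
  using xy
proof (induction m arbitrary: y)
  case 0 then show ?case using x by (intro bexI[of _ x]) auto
next
  case (Suc m)
  then obtain y' where y': "(x, y') \<in> adj Q ^^ m" "(y', y) \<in> adj Q" by auto
  then have V: "y' \<in> V" "y \<in> V" using adj_V by auto
  obtain u where u: "u \<in> V" "nd p x = nd p u + nd u x" "nd p y' = nd p u + nd u y'" "nd u x + nd u y' \<le> m"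
    using Suc.IH[OF y'(1)] by auto
  have a1: "nd y' y \<le> 1" "nd y y' \<le> 1" using nd_adj[OF y'(2)] nd_sym by auto
  have "nd p y \<le> nd p y' + 1" "nd p y' \<le> nd p y + 1" "nd p y \<noteq> nd p y'"
    using nd_triangle[OF p V] nd_triangle[OF p V(2,1)] a1 adj_level[OF p y'(2)] by auto
  then consider "nd p y = Suc (nd p y')" | "nd p y' = Suc (nd p y)" by linarith
  then show ?case
  proof cases
    case 1
    have "nd u y \<le> nd u y' + 1" "nd p y \<le> nd p u + nd u y"
      using nd_triangle[OF u(1) V] nd_triangle[OF p u(1) V(2)] a1 by auto
    then show ?thesis using u 1 by (intro bexI[of _ u]) auto
  next
    case 2
    show ?thesis
    proof (cases "u = y'")
      case True
      have "nd y x \<le> 1 + nd u x" "nd p x \<le> nd p y + nd y x"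
        using nd_triangle[OF V(2,1) x] nd_triangle[OF p V(2) x] True a1 by auto
      moreover have "nd p u = Suc (nd p y)" "nd u y' = 0" using True 2 by auto
      ultimately have "nd p x = nd p y + nd y x" "nd y x \<le> Suc m" using u(2,4) by linarith+
      then show ?thesis using V by (intro bexI[of _ y]) auto
    next
      case False
      then obtain k where k: "nd u y' = Suc k" using nd_eq_0 u V by (metis not0_implies_Suc)
      obtain a where a: "a \<in> V" "nd u a = k" "(a, y') \<in> adj Q" using nd_step[OF u(1) V(1) k] by auto
      have "nd p a \<le> nd p u + k" "nd p y' \<le> nd p a + 1"
        using nd_triangle[OF p u(1) a(1)] nd_triangle[OF p a(1) V(1)] nd_adj[OF a(3)] a by auto
      then have "nd p a = nd p y" using u k 2 by simp
      then have "a = y" using unique_parent[OF p a(3) _ _ refl] y'(2) 2 sym_adj[of Q] by (auto simp: sym_def)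
      then show ?thesis using u a k 2 by (intro bexI[of _ u]) auto
    qed
  qed
qed

text \<open>The ancestor \<open>w\<close> of \<open>v\<close> at the level of \<open>u\<close> is,
  like \<open>u\<close>, an ancestor of \<open>y\<close>; hence \<open>w = u\<close>, and
  \<open>u\<close> lies above both \<open>x\<close> and \<open>z\<close>.\<close>

lemma zero_hyperbolic_aux:
  assumes p: "p \<in> V" and V: "x \<in> V" "y \<in> V" "z \<in> V" "u \<in> V" "v \<in> V"
    and u: "nd p x = nd p u + nd u x" "nd p y = nd p u + nd u y"
    and v: "nd p y = nd p v + nd v y" "nd p z = nd p v + nd v z" and le: "nd p u \<le> nd p v"
  shows "nd x z + 2 * nd p u \<le> nd p x + nd p z"
proof -
  obtain w where w: "w \<in> V" "nd p w = nd p u" "nd p v = nd p u + nd w v"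
    using nd_between[OF p V(5) le] by auto
  have "nd w y \<le> nd w v + nd v y" "nd p y \<le> nd p w + nd w y"
    using nd_triangle[OF w(1) V(5,2)] nd_triangle[OF p w(1) V(2)] by auto
  then have "nd p y = nd p w + nd w y" using v(1) w by linarith
  then have "w = u" using unique_ancestor[OF p w(1) V(4) V(2)] u(2) w(2) by blast
  then have "nd u z \<le> nd u v + nd v z" "nd p v = nd p u + nd u v"
    using nd_triangle[OF V(4,5,3)] w by auto
  moreover have "nd x z \<le> nd u x + nd u z" using nd_triangle[OF V(1,4,3)] nd_sym by metis
  ultimately show ?thesis using u v by linarith
qed

text \<open>The Gromov product of two vertices is the level of their common ancestor. Of the
  ancestors \<open>u\<close> and \<open>v\<close> of \<open>y\<close>, the one nearer to the root is
  an ancestor of both \<open>x\<close> and \<open>z\<close>.\<close>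

lemma zero_hyperbolic:
  assumes V: "p \<in> V" "x \<in> V" "y \<in> V" "z \<in> V"
  shows "min (gromov_product (gdist Q) p x y) (gromov_product (gdist Q) p y z) \<le> gromov_product (gdist Q) p x z"
proof -
  obtain u where u: "u \<in> V" "nd p x = nd p u + nd u x" "nd p y = nd p u + nd u y" "nd u x + nd u y \<le> nd x y"
    using common_ancestor[OF V(1,2) nd_relpow[OF V(2,3)]] by auto
  obtain v where v: "v \<in> V" "nd p y = nd p v + nd v y" "nd p z = nd p v + nd v z" "nd v y + nd v z \<le> nd y z"
    using common_ancestor[OF V(1,3) nd_relpow[OF V(3,4)]] by auto
  have "nd x z + 2 * min (nd p u) (nd p v) \<le> nd p x + nd p z"
  proof (cases "nd p u \<le> nd p v")
    case True
    then show ?thesis using zero_hyperbolic_aux[OF V(1,2,3,4) u(1) v(1) u(2,3) v(2,3)] by simp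
  next
    case False
    then show ?thesis using zero_hyperbolic_aux[OF V(1,4,3,2) v(1) u(1) v(3,2) u(3,2)] nd_sym[of z x] by simp
  qed
  then show ?thesis using u v unfolding gromov_product_def gdist_ndist nd_sym[of _ p]
    by (auto simp: min_def split: if_splits)
qed

end

section \<open>The bottleneck property\<close>

locale metric_on =
  fixes M :: "'a set" and d :: "'a \<Rightarrow> 'a \<Rightarrow> real"
  assumes nonneg: "x \<in> M \<Longrightarrow> y \<in> M \<Longrightarrow> 0 \<le> d x y"
    and dist_self: "x \<in> M \<Longrightarrow> d x x = 0"
    and dist_sym: "x \<in> M \<Longrightarrow> y \<in> M \<Longrightarrow> d x y = d y x"
    and tri: "x \<in> M \<Longrightarrow> y \<in> M \<Longrightarrow> z \<in> M \<Longrightarrow> d x z \<le> d x y + d y z"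

locale hyperbolic = metric_on +
  fixes \<delta> :: real
  assumes four_point: "p \<in> M \<Longrightarrow> x \<in> M \<Longrightarrow> y \<in> M \<Longrightarrow> z \<in> M \<Longrightarrow>
    min (gromov_product d p x y) (gromov_product d p y z) \<le> gromov_product d p x z + \<delta>"

text \<open>Tailored to vertex sets: distances are integers and geodesics are finite sequences with
  unit steps, so continuity arguments turn into inductions along such sequences.\<close>

locale geodesic_on = metric_on +
  assumes geodesic: "x \<in> M \<Longrightarrow> y \<in> M \<Longrightarrow> \<exists>\<gamma> n. d x y = real n \<and> \<gamma> 0 = x \<and> \<gamma> n = y \<and>
    (\<forall>i\<le>n. \<gamma> i \<in> M) \<and> (\<forall>i<n. d (\<gamma> i) (\<gamma> (Suc i)) \<le> 1)"
begin

text \<open>Coarse paths inside \<open>C\<close>. Since the closure is reflexive on all points,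
  \<open>x \<in> C\<close> has to be assumed separately wherever the start must lie in
  \<open>C\<close>.\<close>

definition chain :: "real \<Rightarrow> 'a set \<Rightarrow> ('a \<times> 'a) set" where
  "chain s C = {(u, v). u \<in> C \<and> v \<in> C \<and> d u v \<le> s}\<^sup>*"

definition interval :: "'a \<Rightarrow> 'a \<Rightarrow> 'a set" where
  "interval x y = {m \<in> M. d x m + d m y = d x y}"

lemma chain_mono: "s \<le> t \<Longrightarrow> C \<subseteq> D \<Longrightarrow> (x, y) \<in> chain s C \<Longrightarrow> (x, y) \<in> chain t D"
proof -
  assume h: "s \<le> t" "C \<subseteq> D" "(x, y) \<in> chain s C"
  have "{(u, v). u \<in> C \<and> v \<in> C \<and> d u v \<le> s} \<subseteq> {(u, v). u \<in> D \<and> v \<in> D \<and> d u v \<le> t}"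
    using h by auto
  from rtrancl_mono[OF this] show ?thesis using h(3) unfolding chain_def by (rule subsetD)
qed

lemma chain_trans: "(x, y) \<in> chain s C \<Longrightarrow> (y, z) \<in> chain s C \<Longrightarrow> (x, z) \<in> chain s C"
  unfolding chain_def by (rule rtrancl_trans)

lemma chain_step: "u \<in> C \<Longrightarrow> v \<in> C \<Longrightarrow> d u v \<le> s \<Longrightarrow> (u, v) \<in> chain s C"
  unfolding chain_def by auto

lemma chain_refl: "(x, x) \<in> chain s C"
  unfolding chain_def by auto

lemma geodesic_path:
  assumes "x \<in> M" "y \<in> M"
  obtains \<gamma> n where "d x y = real n" "\<gamma> 0 = x" "\<gamma> n = y" "\<And>i. i \<le> n \<Longrightarrow> \<gamma> i \<in> M"
    "\<And>i. i < n \<Longrightarrow> d (\<gamma> i) (\<gamma> (Suc i)) \<le> 1"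
    "\<And>i. i \<le> n \<Longrightarrow> d x (\<gamma> i) = real i" "\<And>i. i \<le> n \<Longrightarrow> d (\<gamma> i) y = real (n - i)"
proof -
  obtain \<gamma> n where g: "d x y = real n" "\<gamma> 0 = x" "\<gamma> n = y" "\<And>i. i \<le> n \<Longrightarrow> \<gamma> i \<in> M"
    "\<And>i. i < n \<Longrightarrow> d (\<gamma> i) (\<gamma> (Suc i)) \<le> 1"
    using geodesic[OF assms] by auto
  have step: "d (\<gamma> i) (\<gamma> (i + k)) \<le> real k" if "i + k \<le> n" for i k
    using that
  proof (induction k)
    case 0 then show ?case using g(4) dist_self by simp
  next
    case (Suc k)
    then show ?case using tri[of "\<gamma> i" "\<gamma> (i + k)" "\<gamma> (i + Suc k)"] g(4)[of i] g(4)[of "i + k"]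
        g(4)[of "i + Suc k"] g(5)[of "i + k"] by simp
  qed
  have "d x (\<gamma> i) = real i \<and> d (\<gamma> i) y = real (n - i)" if "i \<le> n" for i
    using step[of 0 i] step[of i "n - i"] that tri[of x "\<gamma> i" y] assms g by (auto simp: of_nat_diff)
  then show ?thesis using that g by blast
qed

lemma interval_chain:
  assumes "x \<in> M" "y \<in> M"
  shows "(x, y) \<in> chain 1 (interval x y)"
proof -
  obtain \<gamma> n where g: "d x y = real n" "\<gamma> 0 = x" "\<gamma> n = y" "\<And>i. i \<le> n \<Longrightarrow> \<gamma> i \<in> M"
    "\<And>i. i < n \<Longrightarrow> d (\<gamma> i) (\<gamma> (Suc i)) \<le> 1"
    "\<And>i. i \<le> n \<Longrightarrow> d x (\<gamma> i) = real i" "\<And>i. i \<le> n \<Longrightarrow> d (\<gamma> i) y = real (n - i)"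
    by (rule geodesic_path[OF assms]) (rule that)
  have I: "\<gamma> i \<in> interval x y" if "i \<le> n" for i
    using that g by (simp add: interval_def of_nat_diff)
  have "(x, \<gamma> i) \<in> chain 1 (interval x y)" if "i \<le> n" for i
    using that
  proof (induction i)
    case 0 then show ?case using g chain_refl by simp
  next
    case (Suc i)
    then show ?case using chain_trans[OF _ chain_step[of "\<gamma> i" "interval x y" "\<gamma> (Suc i)" 1]] I g(5)[of i] by simp
  qed
  from this[of n] show ?thesis using g by simp
qed

lemma between:
  assumes "x \<in> M" "y \<in> M" "real k \<le> d x y"
  obtains m where "m \<in> interval x y" "d x m = real k"
proof -
  obtain \<gamma> n where g: "d x y = real n" "\<And>i. i \<le> n \<Longrightarrow> \<gamma> i \<in> M"
    "\<And>i. i \<le> n \<Longrightarrow> d x (\<gamma> i) = real i" "\<And>i. i \<le> n \<Longrightarrow> d (\<gamma> i) y = real (n - i)"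
    using geodesic_path[OF assms(1,2)] by metis
  then show ?thesis using that[of "\<gamma> k"] assms(3) by (auto simp: interval_def of_nat_diff)
qed

lemma intervalD: "m \<in> interval x y \<Longrightarrow> m \<in> M \<and> d x m + d m y = d x y"
  by (simp add: interval_def)

end

text \<open>The bottleneck property of Manning, for coarse paths with steps of size \<open>s\<close>.\<close>

locale bottleneck = geodesic_on +
  assumes bottleneck: "\<exists>\<Delta>. \<forall>x\<in>M. \<forall>y\<in>M. \<forall>m\<in>interval x y. \<forall>C\<subseteq>M. x \<in> C \<and> (x, y) \<in> chain s C \<longrightarrow>
    (\<exists>u\<in>C. d u m \<le> \<Delta>)"

text \<open>If the images stayed farther from \<open>t\<close>, consecutive ones would have product
  above 1 at \<open>t\<close>, because one step moves the image by at most \<open>A * s + B\<close>.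
  The four-point inequality with constant 0 would carry a product above 1 with \<open>f x\<close>
  along the chain up to \<open>f y\<close>.\<close>

lemma tree_chain_near:
  assumes X: "geodesic_on M d" and T: "hyperbolic N e 0" and f: "f \<in> M \<rightarrow> N" and t: "t \<in> N"
    and lip: "\<And>x y. x \<in> M \<Longrightarrow> y \<in> M \<Longrightarrow> e (f x) (f y) \<le> A * d x y + B"
    and A: "0 \<le> A" and B: "0 \<le> B" and s: "0 \<le> s" and C: "C \<subseteq> M" "x \<in> C" "(x, y) \<in> geodesic_on.chain d s C"
    and gp: "gromov_product e t (f x) (f y) \<le> 1"
  shows "\<exists>u\<in>C. e (f u) t \<le> A * s + B + 1"
proof (rule ccontr)
  interpret X: geodesic_on M d by fact
  interpret T: hyperbolic N e 0 by fact
  assume "\<not> (\<exists>u\<in>C. e (f u) t \<le> A * s + B + 1)"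
  then have far: "e (f u) t > A * s + B + 1" if "u \<in> C" for u using that by force
  have "y \<in> C \<and> gromov_product e t (f x) (f y) > 1"
    using C(3) unfolding X.chain_def
  proof (induction rule: rtrancl_induct)
    case base
    have fx: "f x \<in> N" using C f by auto
    have "0 \<le> A * s" using A s by simp
    then have "e (f x) t > 1" using far[OF C(2)] B by linarith
    moreover have "gromov_product e t (f x) (f x) = e (f x) t"
      using T.dist_self[OF fx] by (simp add: gromov_product_def)
    ultimately show ?case using C by simp
  next
    case (step z w)
    then have zw: "z \<in> C" "w \<in> C" "d z w \<le> s" by auto
    then have N: "f x \<in> N" "f z \<in> N" "f w \<in> N" using C f by auto
    have "A * d z w \<le> A * s" using zw A by (auto intro: mult_left_mono)
    then have "e (f z) (f w) \<le> A * s + B" using lip[of z w] zw C by force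
    moreover have "0 \<le> A * s" using A s by simp
    moreover have "A * s + B + 1 < e (f z) t" "A * s + B + 1 < e (f w) t" using far zw by auto
    ultimately have "2 < e (f z) t + e (f w) t - e (f z) (f w)" using B by linarith
    then have "gromov_product e t (f z) (f w) > 1" unfolding gromov_product_def by simp
    then show ?case using T.four_point[OF t N] step zw by auto
  qed
  then show False using gp by simp
qed

text \<open>In a tree the branch point of the triangle \<open>a\<close>, \<open>b\<close>,
  \<open>m\<close> lies on the geodesic from \<open>a\<close> to \<open>b\<close> at distance
  \<open>gromov_product e a b m\<close> from \<open>a\<close>.\<close>

lemma tree_centre:
  assumes T: "hyperbolic N e 0" "geodesic_on N e" and N: "a \<in> N" "b \<in> N" "m \<in> N"
  obtains t where "t \<in> N" "gromov_product e t a b \<le> 1" "gromov_product e t a m \<le> 1" "gromov_product e t m b \<le> 1"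
proof -
  interpret T: hyperbolic N e 0 by fact
  interpret G: geodesic_on N e by fact
  define g where "g = gromov_product e a b m"
  \<comment> \<open>Only integral distances are available; rounding down is the source of the bound
    1 in place of 0.\<close>
  define n where "n = nat \<lfloor>g\<rfloor>"
  have g0: "0 \<le> g" "g \<le> e a b"
    using T.tri[of b a m] T.tri[of a b m] T.dist_sym[of a b] T.dist_sym[of a m] N
    unfolding g_def gromov_product_def by auto
  then have n: "real n \<le> g" "g < real n + 1" unfolding n_def by linarith+
  obtain t where t: "t \<in> G.interval a b" "e a t = real n" using G.between[of a b n] N g0 n by auto
  then have tN: "t \<in> N" and ab: "real n + e t b = e a b" using G.intervalD[OF t(1)] by auto
  have "min (gromov_product e t a m) (gromov_product e t m b) \<le> 0"
    using T.four_point[of t a m b] N tN ab t(2) T.dist_sym[of a t] T.dist_sym[of b t]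
    unfolding gromov_product_def by auto
  then show ?thesis using that[OF tN] n ab t(2) T.dist_sym[OF tN N(1)] T.dist_sym[OF tN N(2)]
      T.dist_sym[OF tN N(3)] T.dist_sym[OF N(2,1)]  T.dist_sym[OF N(3,1)] T.dist_sym[OF N(2,3)]
    unfolding g_def gromov_product_def by (auto simp: min_def field_simps split: if_splits)
qed

text \<open>Let \<open>t\<close> be the centre of the images of \<open>x\<close>, \<open>m\<close>,
  \<open>y\<close>. A coarse path from \<open>x\<close> to \<open>y\<close> and both halves of a
  geodesic through \<open>m\<close> all have images passing near \<open>t\<close>. The points
  \<open>u\<close> and \<open>v\<close> of the two halves are then close to each other with
  \<open>m\<close> between them, so \<open>m\<close> is close to \<open>u\<close> and hence to the
  point \<open>w\<close> of the path.\<close>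

lemma bottleneck_of_quasi_isometry:
  assumes X: "geodesic_on M d" and T: "hyperbolic N e 0" "geodesic_on N e"
    and qi: "quasi_isometric M d N e"
  shows "bottleneck M d"
proof -
  interpret X: geodesic_on M d by fact
  interpret T: hyperbolic N e 0 by fact
  obtain f A B where f: "f \<in> M \<rightarrow> N" and A: "A \<ge> 1" and B: "B \<ge> 0"
    and lo: "\<And>x y. x \<in> M \<Longrightarrow> y \<in> M \<Longrightarrow> d x y / A - B \<le> e (f x) (f y)"
    and up: "\<And>x y. x \<in> M \<Longrightarrow> y \<in> M \<Longrightarrow> e (f x) (f y) \<le> A * d x y + B"
    using qi unfolding quasi_isometric_def by metis
  show ?thesis
  proof (unfold_locales, goal_cases)
    case (1 s)
    \<comment> \<open>Geodesics have steps of size 1, so this step size serves \<open>C\<close> and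
      the geodesics alike.\<close>
    define r where "r = max s 1"
    define \<sigma> where "\<sigma> = A * r + B + 1"
    \<comment> \<open>Two points whose images are within \<open>\<sigma>\<close> of \<open>t\<close>
      are this close, by the lower quasi-isometry bound.\<close>
    define \<Delta> where "\<Delta> = A * (2 * \<sigma> + B)"
    have close: "d u v \<le> \<Delta>" if "u \<in> M" "v \<in> M" "t \<in> N" "e (f u) t \<le> \<sigma>" "e (f v) t \<le> \<sigma>" for u v t
    proof -
      have "f u \<in> N" "f v \<in> N" using f that by auto
      then have "e (f u) (f v) \<le> 2 * \<sigma>" using T.tri[of "f u" t "f v"] T.dist_sym[of "f v" t] that by simp
      then have "d u v / A \<le> 2 * \<sigma> + B" using lo[OF that(1,2)] by simp
      then show ?thesis unfolding \<Delta>_def using A by (simp add: field_simps)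
    qed
    have "\<exists>w\<in>C. d w m \<le> 2 * \<Delta>" if "x \<in> M" "y \<in> M" and m: "m \<in> X.interval x y" and C: "C \<subseteq> M" "x \<in> C"
      "(x, y) \<in> X.chain s C" for x y m C
    proof -
      have mM: "m \<in> M" using X.intervalD[OF m] by simp
      then have fN: "f x \<in> N" "f y \<in> N" "f m \<in> N" using f that by auto
      obtain t where t: "t \<in> N" "gromov_product e t (f x) (f y) \<le> 1" "gromov_product e t (f x) (f m) \<le> 1"
         "gromov_product e t (f m) (f y) \<le> 1"
        using tree_centre[OF T fN] by blast
      have ch: "(x, y) \<in> X.chain r C" "(x, m) \<in> X.chain r (X.interval x m)" "(m, y) \<in> X.chain r (X.interval m y)"
        using X.chain_mono[of s r C C] X.chain_mono[of 1 r "X.interval x m" "X.interval x m"]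
          X.chain_mono[of 1 r "X.interval m y" "X.interval m y"] that mM X.interval_chain[of x m]
          X.interval_chain[of m y] unfolding r_def by auto
      have I: "X.interval x m \<subseteq> M" "X.interval m y \<subseteq> M" "x \<in> X.interval x m" "m \<in> X.interval m y"
        using that mM X.dist_self by (auto simp: X.interval_def)
      have A0: "0 \<le> A" "0 \<le> r" using A by (auto simp: r_def)
      obtain w where w: "w \<in> C" "e (f w) t \<le> \<sigma>"
        using tree_chain_near[OF X T(1) f t(1) up A0(1) B A0(2) C(1,2) ch(1) t(2)] unfolding \<sigma>_def by auto
      obtain u where u: "u \<in> X.interval x m" "e (f u) t \<le> \<sigma>"
        using tree_chain_near[OF X T(1) f t(1) up A0(1) B A0(2) I(1,3) ch(2) t(3)] unfolding \<sigma>_def by auto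
      obtain v where v: "v \<in> X.interval m y" "e (f v) t \<le> \<sigma>"
        using tree_chain_near[OF X T(1) f t(1) up A0(1) B A0(2) I(2,4) ch(3) t(4)] unfolding \<sigma>_def by auto
      have M: "u \<in> M" "v \<in> M" "w \<in> M" using u v w I C by auto
      have "d u v \<le> \<Delta>" "d w u \<le> \<Delta>" using close[of u v t] close[of w u t] M u v w t by auto
      moreover have "d x u + d u m = d x m" "d m v + d v y = d m y" "d x m + d m y = d x y"
        using X.intervalD[OF u(1)] X.intervalD[OF v(1)] X.intervalD[OF m] by auto
      moreover have "d x y \<le> d x u + d u y" "d u y \<le> d u v + d v y" "d w m \<le> d w u + d u m" "0 \<le> d m v"
        using X.tri[OF that(1) M(1) that(2)] X.tri[OF M(1,2) that(2)] X.tri[OF M(3,1) mM] X.nonneg[OF mM M(2)] by auto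
      ultimately show ?thesis using w by (intro bexI[of _ w]) auto
    qed
    then show ?case by blast
  qed
qed

context bottleneck
begin

text \<open>Applied to the detour from \<open>x\<close> over \<open>p\<close> to \<open>z\<close>,
  the bottleneck property puts every point of a geodesic from \<open>x\<close> to \<open>z\<close>
  near one of the other two sides. Where the side changes, a point is near both, and the triangle
  inequalities then put it at about the Gromov product from \<open>p\<close>.\<close>

lemma near_geodesic:
  obtains \<Delta> where "0 \<le> \<Delta>" "\<And>x z p. x \<in> M \<Longrightarrow> z \<in> M \<Longrightarrow> p \<in> M \<Longrightarrow>
      \<exists>m\<in>interval x z. d p m \<le> gromov_product d p x z + \<Delta>"
    "\<And>x y m C. x \<in> M \<Longrightarrow> y \<in> M \<Longrightarrow> m \<in> interval x y \<Longrightarrow> C \<subseteq> M \<Longrightarrow> x \<in> C \<Longrightarrow> (x, y) \<in> chain 1 C \<Longrightarrow>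
      \<exists>u\<in>C. d u m \<le> \<Delta>"
proof -
  obtain D where D: "\<And>x y m C. x \<in> M \<Longrightarrow> y \<in> M \<Longrightarrow> m \<in> interval x y \<Longrightarrow> C \<subseteq> M \<Longrightarrow> x \<in> C \<Longrightarrow>
       (x, y) \<in> chain 1 C \<Longrightarrow> \<exists>u\<in>C. d u m \<le> D"
    using bottleneck[of 1] by metis
  have "\<exists>m\<in>interval x z. d p m \<le> gromov_product d p x z + (2 * D + 1)" if M: "x \<in> M" "z \<in> M" "p \<in> M" for x z p
  proof -
    obtain \<gamma> n where g: "d x z = real n" "\<gamma> 0 = x" "\<gamma> n = z" "\<And>i. i \<le> n \<Longrightarrow> \<gamma> i \<in> M"
      "\<And>i. i < n \<Longrightarrow> d (\<gamma> i) (\<gamma> (Suc i)) \<le> 1"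
      "\<And>i. i \<le> n \<Longrightarrow> d x (\<gamma> i) = real i" "\<And>i. i \<le> n \<Longrightarrow> d (\<gamma> i) z = real (n - i)"
      by (rule geodesic_path[OF M(1,2)]) (rule that)
    have I: "\<gamma> i \<in> interval x z" if "i \<le> n" for i
      using that g by (simp add: interval_def of_nat_diff)
    define near1 where "near1 i \<longleftrightarrow> (\<exists>q\<in>interval x p. d q (\<gamma> i) \<le> D)" for i
    define near2 where "near2 i \<longleftrightarrow> (\<exists>q\<in>interval p z. d q (\<gamma> i) \<le> D)" for i
    have near: "near1 i \<or> near2 i" if "i \<le> n" for i
    proof -
      let ?C = "interval x p \<union> interval p z"
      have C: "(x, z) \<in> chain 1 ?C"
        using chain_mono[OF order_refl _ interval_chain[OF M(1,3)], of ?C]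
          chain_mono[OF order_refl _ interval_chain[OF M(3,2)], of ?C] chain_trans by blast
      have "?C \<subseteq> M" "x \<in> ?C" using M by (auto simp: interval_def dist_self)
      from D[OF M(1,2) I[OF that] this C] show ?thesis unfolding near1_def near2_def by auto
    qed
    have D0: "0 \<le> D" using D[of x x x "{x}"] M chain_refl by (auto simp: interval_def dist_self)
    have n1: "near1 0" unfolding near1_def
      by (rule bexI[of _ x]) (use M g D0 in \<open>auto simp: interval_def dist_self\<close>)
    have n2: "near2 n" unfolding near2_def
      by (rule bexI[of _ z]) (use M g D0 in \<open>auto simp: interval_def dist_self\<close>)
    \<comment> \<open>Discrete continuity: the geodesic starts near the first side and ends near the
      second.\<close>
    have "\<exists>i\<le>n. \<exists>j\<le>n. near1 i \<and> near2 j \<and> d (\<gamma> i) (\<gamma> j) \<le> 1"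
    proof (cases "near1 n")
      case True then show ?thesis using n2 g dist_self by (intro exI[of _ n]) auto
    next
      case False
      define j where "j = (LEAST j. \<not> near1 j)"
      have j: "\<not> near1 j" "\<And>i. i < j \<Longrightarrow> near1 i" "j \<le> n"
        unfolding j_def using LeastI[of "\<lambda>j. \<not> near1 j" n] Least_le[of "\<lambda>j. \<not> near1 j" n]
          not_less_Least[of _ "\<lambda>j. \<not> near1 j"] False by blast+
      then obtain i where i: "j = Suc i" using n1 by (cases j) auto
      then have "near2 j" "near1 i" using near[of j] j by auto
      then show ?thesis using g(5)[of i] i j by (intro exI[of _ i] conjI exI[of _ j]) auto
    qed
    then obtain i j q q' where ij: "i \<le> n" "j \<le> n" "d (\<gamma> i) (\<gamma> j) \<le> 1" and
       q: "q \<in> interval x p" "d q (\<gamma> i) \<le> D" and q': "q' \<in> interval p z" "d q' (\<gamma> j) \<le> D"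
      unfolding near1_def near2_def by blast
    let ?m = "\<gamma> i"
    have mM: "?m \<in> M" "\<gamma> j \<in> M" "q \<in> M" "q' \<in> M" using g ij q q' by (auto simp: interval_def)
    have "d x q + d q p = d x p" "d p q' + d q' z = d p z" "d x ?m + d ?m z = d x z"
      using intervalD[OF q(1)] intervalD[OF q'(1)] intervalD[OF I[OF ij(1)]] by auto
    moreover have "d x ?m \<le> d x q + d q ?m" "d ?m p \<le> d q ?m + d q p" "d ?m z \<le> d ?m q' + d q' z"
      "d ?m p \<le> d ?m q' + d p q'" "d ?m q' \<le> 1 + d q' (\<gamma> j)"
      using tri[OF M(1) mM(3,1)] tri[OF mM(1,3) M(3)] tri[OF mM(1,4) M(2)] tri[OF mM(1,4) M(3)]
        tri[OF mM(1,2,4)] dist_sym mM M ij by auto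
    moreover have "d p ?m = d ?m p" "d x p = d p x" using dist_sym mM M by auto
    ultimately have "d p ?m \<le> gromov_product d p x z + (2 * D + 1)"
      using q(2) q'(2) dist_sym[OF M(2,3)] unfolding gromov_product_def by (simp add: field_simps)
    then show ?thesis using I[OF ij(1)] by blast
  qed
  note N = this
  show ?thesis
  proof (rule that[of "max 0 (2 * D + 1) + \<bar>D\<bar>"])
    show "\<exists>m\<in>interval x z. d p m \<le> gromov_product d p x z + (max 0 (2 * D + 1) + \<bar>D\<bar>)"
      if "x \<in> M" "z \<in> M" "p \<in> M" for x z p
      using N[OF that] by force
    show "\<exists>u\<in>C. d u m \<le> max 0 (2 * D + 1) + \<bar>D\<bar>" if "x \<in> M" "y \<in> M" "m \<in> interval x y" "C \<subseteq> M" "x \<in> C"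
      "(x, y) \<in> chain 1 C" for x y m C
      using D[OF that] by force
  qed simp
qed

lemma gromov_product_le_interval:
  assumes "x \<in> M" "y \<in> M" "p \<in> M" "q \<in> interval x y"
  shows "gromov_product d p x y \<le> d p q"
proof -
  have "q \<in> M" "d x q + d q y = d x y" using intervalD assms by auto
  then show ?thesis using tri[of x q p] tri[of y q p] assms dist_sym[of q p] dist_sym[of q y]
    unfolding gromov_product_def by simp
qed

text \<open>A point \<open>m\<close> between \<open>x\<close> and \<open>z\<close> realises their
  product up to \<open>\<Delta>\<close>. The detour over \<open>y\<close> passes within another
  \<open>\<Delta>\<close> of \<open>m\<close>, and the points of its two halves are at least as far
  from \<open>p\<close> as the products of those halves.\<close>

lemma hyperbolic: "\<exists>\<delta>. hyperbolic M d \<delta>"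
proof -
  obtain \<Delta> where D: "0 \<le> \<Delta>" "\<And>x z p. x \<in> M \<Longrightarrow> z \<in> M \<Longrightarrow> p \<in> M \<Longrightarrow>
      \<exists>m\<in>interval x z. d p m \<le> gromov_product d p x z + \<Delta>"
    "\<And>x y m C. x \<in> M \<Longrightarrow> y \<in> M \<Longrightarrow> m \<in> interval x y \<Longrightarrow> C \<subseteq> M \<Longrightarrow> x \<in> C \<Longrightarrow> (x, y) \<in> chain 1 C \<Longrightarrow>
      \<exists>u\<in>C. d u m \<le> \<Delta>"
    using near_geodesic by blast
  have "hyperbolic M d (2 * \<Delta>)"
  proof (unfold_locales)
    fix p x y z assume M: "p \<in> M" "x \<in> M" "y \<in> M" "z \<in> M"
    obtain m where m: "m \<in> interval x z" "d p m \<le> gromov_product d p x z + \<Delta>" using D(2)[OF M(2,4,1)] by blast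
    let ?C = "interval x y \<union> interval y z"
    have C: "(x, z) \<in> chain 1 ?C"
      using chain_mono[OF order_refl _ interval_chain[OF M(2,3)], of ?C]
        chain_mono[OF order_refl _ interval_chain[OF M(3,4)], of ?C] chain_trans by blast
    have "?C \<subseteq> M" "x \<in> ?C" using M by (auto simp: interval_def dist_self)
    from D(3)[OF M(2,4) m(1) this C] obtain u where u: "u \<in> ?C" "d u m \<le> \<Delta>" by blast
    have "d p u \<le> d p m + d u m"
      using tri[of p m u] dist_sym[of m u] u m M by (auto simp: interval_def)
    then have "d p u \<le> gromov_product d p x z + 2 * \<Delta>" using u m by simp
    moreover have "gromov_product d p x y \<le> d p u \<or> gromov_product d p y z \<le> d p u"
      using u(1) gromov_product_le_interval M by blast
    ultimately show "min (gromov_product d p x y) (gromov_product d p y z) \<le> gromov_product d p x z + 2 * \<Delta>" by linarith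
  qed
  then show ?thesis by blast
qed

end

lemma (in cgraph) geodesic_on: "geodesic_on V (gdist Q)"
proof (unfold_locales, goal_cases)
  case (5 x y)
  obtain \<gamma> where g: "\<gamma> 0 = x" "\<gamma> (nd x y) = y" "\<And>i. i \<le> nd x y \<Longrightarrow> \<gamma> i \<in> V"
    "\<And>i. i < nd x y \<Longrightarrow> (\<gamma> i, \<gamma> (Suc i)) \<in> adj Q" using nd_geodesic[OF 5] by blast
  then have "real (nd (\<gamma> i) (\<gamma> (Suc i))) \<le> 1" if "i < nd x y" for i using nd_adj[OF g(4)[OF that]] by simp
  then show ?case using g by (intro exI[of _ \<gamma>] exI[of _ "nd x y"]) (auto simp: gdist_ndist)
qed (auto simp: gdist_ndist nd_sym simp flip: of_nat_add intro!: nd_triangle)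

lemma tree_graph_hyperbolic:
  assumes "tree_graph T"
  shows "hyperbolic (verts T) (gdist T) 0" "geodesic_on (verts T) (gdist T)"
proof -
  interpret tree T using assms by unfold_locales (auto simp: tree_graph_def)
  show G: "geodesic_on (verts T) (gdist T)" by (rule geodesic_on)
  then interpret G: geodesic_on "verts T" "gdist T" .
  show "hyperbolic (verts T) (gdist T) 0" by unfold_locales (use zero_hyperbolic in auto)
qed

lemma quasitree_bottleneck:
  assumes "quasitree Q"
  shows "bottleneck (verts Q) (gdist Q)"
proof -
  interpret cgraph Q using assms by unfold_locales (auto simp: quasitree_def)
  obtain T :: "'a graph" where "tree_graph T" "quasi_isometric (verts Q) (gdist Q) (verts T) (gdist T)"
    using assms by (auto simp: quasitree_def)
  then show ?thesis using bottleneck_of_quasi_isometry[OF geodesic_on tree_graph_hyperbolic] by blast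
qed

section \<open>Isometries of hyperbolic spaces\<close>

text \<open>The infimum of the quotients is their limit: dividing \<open>n\<close> with remainder by
  a nearly optimal \<open>N\<close> bounds \<open>a n\<close> by \<open>n * (a N / N)\<close> plus a
  constant. The lower bound \<open>c\<close> passes to the infimum; it is what will make translation
  lengths positive.\<close>

lemma fekete:
  fixes a :: "nat \<Rightarrow> real"
  assumes pos: "\<And>n. 0 \<le> a n" and sub: "\<And>m n. a (m + n) \<le> a m + a n" and lo: "\<And>n. c * real n \<le> a n"
  shows "\<exists>L\<ge>c. (\<lambda>n. a n / real n) \<longlonglongrightarrow> L"
proof -
  define S where "S = (\<lambda>n. a n / real n) ` {1..}"
  define L where "L = Inf S"
  have bdd: "bdd_below S" unfolding S_def bdd_below_def using pos by (intro exI[of _ 0]) auto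
  have Lle: "L \<le> a n / real n" if "n \<ge> 1" for n
    unfolding L_def by (rule cInf_lower[OF _ bdd]) (use that in \<open>auto simp: S_def\<close>)
  have cL: "c \<le> L" unfolding L_def
  proof (rule cInf_greatest)
    show "S \<noteq> {}" by (auto simp: S_def)
    fix x assume "x \<in> S"
    then obtain n where "n \<ge> 1" "x = a n / real n" by (auto simp: S_def)
    then show "c \<le> x" using lo[of n] by (simp add: pos_le_divide_eq)
  qed
  have mult: "a (q * N) \<le> real q * a N" if "q \<ge> 1" for q N
    using that
  proof (induction q)
    case (Suc q)
    show ?case
    proof (cases "q = 0")
      case False
      then show ?thesis using Suc sub[of N "q * N"] by (simp add: algebra_simps)
    qed simp
  qed simp
  have "(\<lambda>n. a n / real n) \<longlonglongrightarrow> L"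
  proof (rule LIMSEQ_I)
    fix e :: real assume e: "0 < e"
    have "Inf S < L + e / 2" using e by (simp add: L_def)
    then obtain N where N: "N \<ge> 1" "a N / real N < L + e / 2"
      using cInf_lessD[of S "L + e / 2"] by (auto simp: S_def)
    \<comment> \<open>\<open>a 0\<close> covers the quotient 0, and \<open>real N * a 1\<close>
      bounds the contribution of any remainder.\<close>
    define C where "C = a 0 + real N * a 1 + a N"
    have C0: "0 \<le> C" unfolding C_def using pos by (intro add_nonneg_nonneg mult_nonneg_nonneg) auto
    have bound: "a n \<le> real n * (a N / real N) + C" for n
    proof -
      define q r where "q = n div N" and "r = n mod N"
      have n: "n = q * N + r" and r: "r < N" using N by (auto simp: q_def r_def)
      have "a (q * N) \<le> real q * a N + a 0" using mult[of q N] pos[of 0] by (cases "q = 0") auto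
      moreover have "a r \<le> real N * a 1" if "r \<ge> 1"
      proof -
        have "a r \<le> real r * a 1" using mult[of r 1] that by simp
        also have "\<dots> \<le> real N * a 1" using r pos[of 1] by (intro mult_right_mono) auto
        finally show ?thesis .
      qed
      moreover have "real q * a N \<le> real n * (a N / real N)"
      proof -
        have "real q * real N \<le> real n" unfolding n of_nat_mult[symmetric] of_nat_le_iff by simp
        then have "real q * real N * (a N / real N) \<le> real n * (a N / real N)"
          using pos[of N] by (intro mult_right_mono) auto
        then show ?thesis using N by simp
      qed
      moreover have "a n \<le> a (q * N) + a r" unfolding n by (rule sub)
      moreover have "a n = a (q * N)" if "\<not> r \<ge> 1"
      proof -
        have "r = 0" using that by simp
        then show ?thesis by (simp add: n)
      qed
      moreover have "0 \<le> a N" "0 \<le> real N * a 1" "0 \<le> a 0" using pos[of N] pos[of 1] pos[of 0] by auto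
      ultimately show ?thesis unfolding C_def by (cases "r \<ge> 1") linarith+
    qed
    obtain K where K: "real K > 2 * C / e" using reals_Archimedean2 by blast
    have "norm (a n / real n - L) < e" if n: "n \<ge> max 1 K" for n
    proof -
      have n1: "real n > 0" using n by simp
      have "2 * C / e < real n" using K n by simp
      then have "2 * C < real n * e" using e by (simp add: pos_divide_less_eq)
      then have "C / real n < e / 2" using n1 by (simp add: pos_divide_less_eq mult.commute)
      moreover have "a n / real n \<le> a N / real N + C / real n"
        using bound[of n] n1 by (simp add: field_simps)
      moreover have "L \<le> a n / real n" using Lle[of n] n by simp
      ultimately have "\<bar>a n / real n - L\<bar> < e" using N(2) by linarith
      then show ?thesis by simp
    qed
    then show "\<exists>no. \<forall>n\<ge>no. norm (a n / real n - L) < e" by blast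
  qed
  then show ?thesis using cL by blast
qed

section \<open>Elementary inequalities for the Gromov product\<close>

context metric_on
begin

abbreviation "gp \<equiv> gromov_product d"

lemma gp_sym: "x \<in> M \<Longrightarrow> y \<in> M \<Longrightarrow> gp p x y = gp p y x"
  using dist_sym[of x y] by (simp add: gromov_product_def)

lemma gp_swap: "p \<in> M \<Longrightarrow> x \<in> M \<Longrightarrow> y \<in> M \<Longrightarrow> gp p x y = d p x - gp x p y"
  using dist_sym[of p x] dist_sym[of p y] dist_sym[of x y] by (simp add: gromov_product_def field_simps)

lemma gp_nonneg: "p \<in> M \<Longrightarrow> x \<in> M \<Longrightarrow> y \<in> M \<Longrightarrow> 0 \<le> gp p x y"
  using tri[of x p y] dist_sym[of y p] by (simp add: gromov_product_def)

lemma gp_le: "p \<in> M \<Longrightarrow> x \<in> M \<Longrightarrow> y \<in> M \<Longrightarrow> gp p x y \<le> d p x"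
  using gp_swap[of p x y] gp_nonneg[of x p y] by simp

lemma gp_le': "p \<in> M \<Longrightarrow> x \<in> M \<Longrightarrow> y \<in> M \<Longrightarrow> gp p x y \<le> d p y"
  using gp_le[of p y x] gp_sym[of x y p] by simp

lemma gp_change: "p \<in> M \<Longrightarrow> x \<in> M \<Longrightarrow> x' \<in> M \<Longrightarrow> y \<in> M \<Longrightarrow> gp p x y \<le> gp p x' y + d x x'"
  using tri[of x x' p] tri[of x' x y] dist_sym[of x x'] by (simp add: gromov_product_def field_simps)

lemma gp_change': "p \<in> M \<Longrightarrow> x \<in> M \<Longrightarrow> y' \<in> M \<Longrightarrow> y \<in> M \<Longrightarrow> gp p x y \<le> gp p x y' + d y y'"
  using gp_change[of p y y' x] gp_sym[of x y p] gp_sym[of x y' p] by simp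

lemma gp_base: "p \<in> M \<Longrightarrow> q \<in> M \<Longrightarrow> x \<in> M \<Longrightarrow> y \<in> M \<Longrightarrow> gp p x y \<le> gp q x y + d p q"
  using tri[of x q p] tri[of y q p] dist_sym[of p q] by (simp add: gromov_product_def field_simps)

end

section \<open>The local-to-global principle and convergence to infinity\<close>

context hyperbolic
begin

lemma delta_nonneg: "M \<noteq> {} \<Longrightarrow> 0 \<le> \<delta>"
proof -
  assume "M \<noteq> {}"
  then obtain x where "x \<in> M" by auto
  then show ?thesis using four_point[of x x x x] by simp
qed

text \<open>Since the steps are more than twice as long as the turning products, \<open>z 0\<close>
  and \<open>z i\<close> lie in nearly the same direction from \<open>z (Suc i)\<close>; the
  four-point inequality then transfers the bound on the turn from \<open>z i\<close> to
  \<open>z 0\<close>. Both conclusions are proved together because each step needs the product bound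
  of the previous one. The lemma serves loxodromic elements, their axes, and free subgroups.\<close>

lemma local_to_global:
  assumes M: "\<And>i. i \<le> r \<Longrightarrow> z i \<in> M" and P: "0 \<le> P" and c: "0 < c"
    and turn: "\<And>i. Suc i < r \<Longrightarrow> gp (z (Suc i)) (z i) (z (Suc (Suc i))) \<le> P"
    and steps: "\<And>i. i < r \<Longrightarrow> 2 * P + 2 * \<delta> + c \<le> d (z i) (z (Suc i))"
    and i: "i < r"
  shows "gp (z i) (z 0) (z (Suc i)) \<le> P + \<delta> \<and> d (z 0) (z i) + c \<le> d (z 0) (z (Suc i))"
  using i
proof (induction i)
  case 0
  have "z 0 \<in> M" "z 1 \<in> M" using M 0 by auto
  then have "gp (z 0) (z 0) (z 1) = 0" "d (z 0) (z 0) = 0" "0 \<le> \<delta>"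
    using dist_self delta_nonneg dist_sym[of "z 1"] by (auto simp: gromov_product_def)
  then show ?case using P steps[OF 0] by simp
next
  case (Suc i)
  have M': "z 0 \<in> M" "z i \<in> M" "z (Suc i) \<in> M" "z (Suc (Suc i)) \<in> M" using M Suc by auto
  have \<delta>: "0 \<le> \<delta>" using M' delta_nonneg by auto
  have "gp (z (Suc i)) (z i) (z 0) = d (z (Suc i)) (z i) - gp (z i) (z (Suc i)) (z 0)"
    by (rule gp_swap[OF M'(3,2,1)])
  moreover have "gp (z i) (z (Suc i)) (z 0) \<le> P + \<delta>" using Suc gp_sym[OF M'(3,1)] by simp
  ultimately have "gp (z (Suc i)) (z i) (z 0) > P + \<delta>"
    using steps[of i] Suc(2) c dist_sym[OF M'(2,3)] by simp
  moreover have "min (gp (z (Suc i)) (z i) (z 0)) (gp (z (Suc i)) (z 0) (z (Suc (Suc i)))) \<le> P + \<delta>"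
    using four_point[OF M'(3,2,1,4)] turn[of i] Suc(2) by simp
  ultimately have A: "gp (z (Suc i)) (z 0) (z (Suc (Suc i))) \<le> P + \<delta>" by simp
  then have "d (z 0) (z (Suc i)) + d (z (Suc i)) (z (Suc (Suc i))) - d (z 0) (z (Suc (Suc i))) \<le> 2 * P + 2 * \<delta>"
    using dist_sym[OF M'(3,4)] unfolding gromov_product_def by simp
  then show ?case using A steps[of "Suc i"] Suc(2) by simp
qed

text \<open>Convergence to a common boundary point, measured from the one base point
  \<open>p\<close>; by \<open>gromov_related_iff\<close> one base point suffices.\<close>

definition rel :: "'a \<Rightarrow> (nat \<Rightarrow> 'a) \<Rightarrow> (nat \<Rightarrow> 'a) \<Rightarrow> bool" where
  "rel p s t \<longleftrightarrow> (\<forall>R. \<exists>N. \<forall>m\<ge>N. \<forall>n\<ge>N. R \<le> gp p (s m) (t n))"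

lemma rel_sym: "range s \<subseteq> M \<Longrightarrow> range t \<subseteq> M \<Longrightarrow> rel p s t \<Longrightarrow> rel p t s"
  unfolding rel_def using gp_sym[of "s _" "t _" p] by (metis rangeI subsetD)

lemma rel_trans:
  assumes M: "p \<in> M" "range s \<subseteq> M" "range t \<subseteq> M" "range u \<subseteq> M" and r: "rel p s t" "rel p t u"
  shows "rel p s u"
  unfolding rel_def
proof
  fix R
  obtain N where N: "\<forall>m\<ge>N. \<forall>n\<ge>N. R + \<delta> \<le> gp p (s m) (t n)" using r(1) unfolding rel_def by blast
  obtain N' where N': "\<forall>m\<ge>N'. \<forall>n\<ge>N'. R + \<delta> \<le> gp p (t m) (u n)" using r(2) unfolding rel_def by blast
  have "R \<le> gp p (s m) (u n)" if "m \<ge> max N N'" "n \<ge> max N N'" for m n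
  proof -
    have "s m \<in> M" "t (max N N') \<in> M" "u n \<in> M" using M by auto
    from four_point[OF M(1) this] show ?thesis
      using N[rule_format, of m "max N N'"] N'[rule_format, of "max N N'" n] that by simp
  qed
  then show "\<exists>N. \<forall>m\<ge>N. \<forall>n\<ge>N. R \<le> gp p (s m) (u n)" by blast
qed

lemma rel_base:
  assumes M: "p \<in> M" "q \<in> M" "range s \<subseteq> M" "range t \<subseteq> M" and r: "rel p s t"
  shows "rel q s t"
  unfolding rel_def
proof
  fix R
  obtain N where N: "\<forall>m\<ge>N. \<forall>n\<ge>N. R + d p q \<le> gp p (s m) (t n)" using r unfolding rel_def by blast
  have "R \<le> gp q (s m) (t n)" if "m \<ge> N" "n \<ge> N" for m n
  proof -
    have "s m \<in> M" "t n \<in> M" using M by auto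
    then show ?thesis using gp_base[OF M(1,2), of "s m" "t n"] N[rule_format, of m n] that by simp
  qed
  then show "\<exists>N. \<forall>m\<ge>N. \<forall>n\<ge>N. R \<le> gp q (s m) (t n)" by blast
qed

lemma gromov_related_iff:
  assumes "p \<in> M" "range s \<subseteq> M" "range t \<subseteq> M"
  shows "gromov_related M d s t \<longleftrightarrow> rel p s t"
proof -
  have "filterlim (\<lambda>(m, n). gp q (s m) (t n)) at_top (sequentially \<times>\<^sub>F sequentially) \<longleftrightarrow> rel q s t" for q
    unfolding filterlim_at_top rel_def by (simp add: eventually_prod_sequentially) blast
  then show ?thesis unfolding gromov_related_def using rel_base assms by metis
qed

lemma rel_close:
  assumes M: "p \<in> M" "range s \<subseteq> M" "range t \<subseteq> M" "range u \<subseteq> M" and r: "rel p s t"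
    and c: "\<And>n. d (t n) (u n) \<le> C"
  shows "rel p s u"
  unfolding rel_def
proof
  fix R
  obtain N where N: "\<forall>m\<ge>N. \<forall>n\<ge>N. R + C \<le> gp p (s m) (t n)" using r unfolding rel_def by blast
  have "R \<le> gp p (s m) (u n)" if "m \<ge> N" "n \<ge> N" for m n
  proof -
    have "s m \<in> M" "t n \<in> M" "u n \<in> M" using M by auto
    then show ?thesis using gp_change'[of p "s m" "u n" "t n"] M N[rule_format, of m n] that c[of n] by simp
  qed
  then show "\<exists>N. \<forall>m\<ge>N. \<forall>n\<ge>N. R \<le> gp p (s m) (u n)" by blast
qed

text \<open>A coarse ray: from \<open>p\<close>, every later point lies behind \<open>s m\<close> up
  to the error \<open>D\<close>. Bounded sequences qualify; divergence is obtained in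
  \<open>rel_of_unbounded\<close> from an unbounded product.\<close>

definition ray :: "'a \<Rightarrow> (nat \<Rightarrow> 'a) \<Rightarrow> bool" where
  "ray p s \<longleftrightarrow> range s \<subseteq> M \<and> (\<exists>D. \<forall>m n. m \<le> n \<longrightarrow> d p (s m) - D \<le> gp p (s m) (s n))"

text \<open>One large product forces large products between all later points, so the products of two
  coarse rays are either bounded or tend to infinity. This dichotomy turns a failure of independence
  into a common end.\<close>

lemma rel_of_unbounded:
  assumes p: "p \<in> M" and r: "ray p s" "ray p t" and unb: "\<And>C. \<exists>m n. C < gp p (s m) (t n)"
  shows "rel p s t"
  unfolding rel_def
proof
  fix R
  obtain D where D: "range s \<subseteq> M" "\<And>m n. m \<le> n \<Longrightarrow> d p (s m) - D \<le> gp p (s m) (s n)"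
    using r(1) unfolding ray_def by auto
  obtain D' where D': "range t \<subseteq> M" "\<And>m n. m \<le> n \<Longrightarrow> d p (t m) - D' \<le> gp p (t m) (t n)"
    using r(2) unfolding ray_def by auto
  \<comment> \<open>Two uses of the four-point inequality cost \<open>2 * \<delta>\<close>;
    replacing \<open>s m\<close> and \<open>t n\<close> by later points costs \<open>D\<close> and
    \<open>D'\<close>.\<close>
  obtain m n where mn: "R + 2 * \<delta> + \<bar>D\<bar> + \<bar>D'\<bar> < gp p (s m) (t n)" using unb by blast
  have "R \<le> gp p (s i) (t j)" if "i \<ge> max m n" "j \<ge> max m n" for i j
  proof -
    have M: "s i \<in> M" "s m \<in> M" "t n \<in> M" "t j \<in> M" using D(1) D'(1) by auto
    have \<delta>: "0 \<le> \<delta>" using delta_nonneg p by auto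
    have "d p (s m) - D \<le> gp p (s i) (s m)" using D(2)[of m i] that gp_sym[OF M(1,2)] by simp
    moreover have "d p (t n) - D' \<le> gp p (t n) (t j)" using D'(2)[of n j] that by simp
    moreover have "gp p (s m) (t n) \<le> d p (s m)" "gp p (s m) (t n) \<le> d p (t n)"
      using gp_le[OF p M(2,3)] gp_le'[OF p M(2,3)] by auto
    ultimately show ?thesis using four_point[OF p M(1,2,3)] four_point[OF p M(1,3,4)] mn \<delta> by linarith
  qed
  then show "\<exists>N. \<forall>m\<ge>N. \<forall>n\<ge>N. R \<le> gp p (s m) (t n)" by blast
qed

end

lemma (in group) conj_pow: "g \<in> carrier G \<Longrightarrow> h \<in> carrier G \<Longrightarrow> (h \<otimes> g \<otimes> inv h) [^] (n::nat) = h \<otimes> g [^] n \<otimes> inv h"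
proof (induction n)
  case (Suc n)
  have "inv h \<otimes> (h \<otimes> (g \<otimes> inv h)) = g \<otimes> inv h" using Suc by (simp add: m_assoc[symmetric])
  then show ?case using Suc by (simp add: m_assoc)
qed simp

section \<open>Orbits of a single isometry\<close>

locale isometric_action = group G + metric_on M d
  for G :: "('g, 'm) monoid_scheme" (structure) and M :: "'a set" and d +
  fixes \<psi> :: "'g \<Rightarrow> 'a \<Rightarrow> 'a" and x\<^sub>0 :: 'a
  assumes base [simp]: "x\<^sub>0 \<in> M"
    and act_closed [simp]: "g \<in> carrier G \<Longrightarrow> x \<in> M \<Longrightarrow> \<psi> g x \<in> M"
    and act_one [simp]: "x \<in> M \<Longrightarrow> \<psi> \<one> x = x"
    and act_mult: "g \<in> carrier G \<Longrightarrow> h \<in> carrier G \<Longrightarrow> x \<in> M \<Longrightarrow> \<psi> (g \<otimes> h) x = \<psi> g (\<psi> h x)"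
    and isom: "g \<in> carrier G \<Longrightarrow> x \<in> M \<Longrightarrow> y \<in> M \<Longrightarrow> d (\<psi> g x) (\<psi> g y) = d x y"
begin

definition pt :: "'g \<Rightarrow> int \<Rightarrow> 'a" where "pt g k = \<psi> (g [^] k) x\<^sub>0"

lemma pt_in [simp]: "g \<in> carrier G \<Longrightarrow> pt g k \<in> M"
  by (simp add: pt_def)

lemma pt_0 [simp]: "pt g 0 = x\<^sub>0"
  by (simp add: pt_def)

lemma pt_1: "g \<in> carrier G \<Longrightarrow> pt g 1 = \<psi> g x\<^sub>0"
  by (simp add: pt_def int_pow_1)

lemma pt_m1: "g \<in> carrier G \<Longrightarrow> pt g (-1) = \<psi> (inv g) x\<^sub>0"
  by (simp add: pt_def int_pow_neg int_pow_1)

lemma pt_shift: "g \<in> carrier G \<Longrightarrow> \<psi> (g [^] j) (pt g k) = pt g (j + k)"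
  by (simp add: pt_def int_pow_mult act_mult)

lemma pt_inv: "g \<in> carrier G \<Longrightarrow> pt (inv g) k = pt g (- k)"
  by (simp add: pt_def int_pow_inv int_pow_neg)

lemma isom_gp: "g \<in> carrier G \<Longrightarrow> p \<in> M \<Longrightarrow> x \<in> M \<Longrightarrow> y \<in> M \<Longrightarrow> gp (\<psi> g p) (\<psi> g x) (\<psi> g y) = gp p x y"
  by (simp add: gromov_product_def isom)

lemma gp_pt: "g \<in> carrier G \<Longrightarrow> gp (pt g k) (pt g i) (pt g j) = gp x\<^sub>0 (pt g (i - k)) (pt g (j - k))"
  using isom_gp[of "g [^] k" x\<^sub>0 "pt g (i - k)" "pt g (j - k)"] pt_shift[of g k 0]
    pt_shift[of g k "i - k"] pt_shift[of g k "j - k"] by simp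

lemma d_pt: "g \<in> carrier G \<Longrightarrow> d (pt g i) (pt g j) = d x\<^sub>0 (pt g (j - i))"
  using isom[of "g [^] i" x\<^sub>0 "pt g (j - i)"] pt_shift[of g i 0] pt_shift[of g i "j - i"] by simp

lemma d_pt_neg: "g \<in> carrier G \<Longrightarrow> d x\<^sub>0 (pt g (- n)) = d x\<^sub>0 (pt g n)"
  using d_pt[of g "- n" 0] dist_sym[of x\<^sub>0 "pt g (- n)"] by simp

lemma d_pt_subadd: "g \<in> carrier G \<Longrightarrow> d x\<^sub>0 (pt g (m + n)) \<le> d x\<^sub>0 (pt g m) + d x\<^sub>0 (pt g n)"
  using tri[of x\<^sub>0 "pt g m" "pt g (m + n)"] d_pt[of g m "m + n"] by simp

lemma d_pt_le: "g \<in> carrier G \<Longrightarrow> d x\<^sub>0 (pt g (int n)) \<le> real n * d x\<^sub>0 (pt g 1)"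
proof (induction n)
  case 0 then show ?case by (simp add: dist_self)
next
  case (Suc n)
  have "int (Suc n) = 1 + int n" by simp
  then have "d x\<^sub>0 (pt g (int (Suc n))) \<le> d x\<^sub>0 (pt g 1) + d x\<^sub>0 (pt g (int n))"
    using d_pt_subadd[OF Suc.prems, of 1 "int n"] by simp
  then show ?case using Suc by (simp add: algebra_simps)
qed

abbreviation "lox \<equiv> loxodromic G M d \<psi>"

text \<open>Replacing \<open>x\<close> by the base point changes each displacement by at most
  \<open>2 * d x x\<^sub>0\<close>, which disappears after division by \<open>n\<close>.\<close>

lemma lox_iff: "g \<in> carrier G \<Longrightarrow> lox g \<longleftrightarrow> (\<exists>L>0. (\<lambda>n. d x\<^sub>0 (pt g (int n)) / real n) \<longlonglongrightarrow> L)"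
proof -
  assume g: "g \<in> carrier G"
  have eq: "d (\<psi> (g [^] n) x\<^sub>0) x\<^sub>0 = d x\<^sub>0 (pt g (int n))" for n :: nat
    using g dist_sym by (simp add: pt_def int_pow_int)
  show ?thesis
  proof
    assume "lox g" then show "\<exists>L>0. (\<lambda>n. d x\<^sub>0 (pt g (int n)) / real n) \<longlonglongrightarrow> L"
      using base unfolding loxodromic_def eq[symmetric] by blast
  next
    assume "\<exists>L>0. (\<lambda>n. d x\<^sub>0 (pt g (int n)) / real n) \<longlonglongrightarrow> L"
    then obtain L where L: "L > 0" "(\<lambda>n. d x\<^sub>0 (pt g (int n)) / real n) \<longlonglongrightarrow> L" by blast
    show "lox g" unfolding loxodromic_def
    proof (intro ballI exI[of _ L] conjI L(1))
      fix x assume x: "x \<in> M"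
      have "(\<lambda>n. d (\<psi> (g [^] n) x) x / real n - d x\<^sub>0 (pt g (int n)) / real n) \<longlonglongrightarrow> 0"
      proof (rule Lim_null_comparison)
        show "\<forall>\<^sub>F n in sequentially. norm (d (\<psi> (g [^] n) x) x / real n - d x\<^sub>0 (pt g (int n)) / real n) \<le> 2 * d x x\<^sub>0 / real n"
        proof (rule always_eventually, rule allI)
          fix n :: nat
          have P: "pt g (int n) = \<psi> (g [^] n) x\<^sub>0" by (simp add: pt_def int_pow_int)
          let ?h = "g [^] n"
          have h: "?h \<in> carrier G" using g by simp
          have "d (\<psi> ?h x) (\<psi> ?h x\<^sub>0) = d x x\<^sub>0" using isom[OF h x base] .
          then have "\<bar>d (\<psi> ?h x) x - d x\<^sub>0 (\<psi> ?h x\<^sub>0)\<bar> \<le> 2 * d x x\<^sub>0"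
            using tri[of "\<psi> ?h x" "\<psi> ?h x\<^sub>0" x] tri[of "\<psi> ?h x\<^sub>0" x\<^sub>0 x] tri[of x\<^sub>0 x "\<psi> ?h x\<^sub>0"]
              tri[of x "\<psi> ?h x" "\<psi> ?h x\<^sub>0"] dist_sym[of x "\<psi> ?h x"] dist_sym[of x x\<^sub>0] dist_sym[of x\<^sub>0 "\<psi> ?h x\<^sub>0"] h x
            by simp
          then have "\<bar>d (\<psi> ?h x) x - d x\<^sub>0 (\<psi> ?h x\<^sub>0)\<bar> / real n \<le> 2 * d x x\<^sub>0 / real n" by (rule divide_right_mono) simp
          then show "norm (d (\<psi> (g [^] n) x) x / real n - d x\<^sub>0 (pt g (int n)) / real n) \<le> 2 * d x x\<^sub>0 / real n"
            unfolding P by (simp add: diff_divide_distrib[symmetric])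
        qed
        show "(\<lambda>n. 2 * d x x\<^sub>0 / real n) \<longlonglongrightarrow> 0" by (rule lim_const_over_n)
      qed
      from tendsto_add[OF this L(2)] show "(\<lambda>n. d (\<psi> (g [^] n) x) x / real n) \<longlonglongrightarrow> L" by simp
    qed
  qed
qed

lemma lox_of_linear:
  assumes g: "g \<in> carrier G" and c: "0 < c" "\<And>n. c * real n \<le> d x\<^sub>0 (pt g (int n))"
  shows "lox g"
proof -
  have "\<exists>L\<ge>c. (\<lambda>n. d x\<^sub>0 (pt g (int n)) / real n) \<longlonglongrightarrow> L"
    by (rule fekete) (use g c nonneg d_pt_subadd in auto)
  then show ?thesis using lox_iff[OF g] c(1) by force
qed

lemma lox_filterlim:
  assumes g: "g \<in> carrier G" and l: "lox g"
  shows "filterlim (\<lambda>n. d x\<^sub>0 (pt g (int n))) at_top sequentially"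
proof -
  obtain L where L: "L > 0" "(\<lambda>n. d x\<^sub>0 (pt g (int n)) / real n) \<longlonglongrightarrow> L" using l lox_iff[OF g] by blast
  from filterlim_tendsto_pos_mult_at_top[OF L(2,1) filterlim_real_sequentially]
  show ?thesis
    by (rule filterlim_mono_eventually) (auto intro: eventually_sequentiallyI[of 1] simp: dist_self)
qed

lemma lox_conj:
  assumes g: "g \<in> carrier G" "h \<in> carrier G" and l: "lox g"
  shows "lox (h \<otimes> g \<otimes> inv h)"
  unfolding loxodromic_def
proof
  fix x assume x: "x \<in> M"
  have "d (\<psi> ((h \<otimes> g \<otimes> inv h) [^] n) x) x = d (\<psi> (g [^] n) (\<psi> (inv h) x)) (\<psi> (inv h) x)" for n :: nat
  proof -
    have "\<psi> h (\<psi> (inv h) x) = x" using g x by (simp add: act_mult[symmetric])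
    then show ?thesis unfolding conj_pow[OF g] using g x
      isom[of h "\<psi> (g [^] n) (\<psi> (inv h) x)" "\<psi> (inv h) x"] by (simp add: act_mult)
  qed
  then show "\<exists>L>0. (\<lambda>n. d (\<psi> ((h \<otimes> g \<otimes> inv h) [^] n) x) x / real n) \<longlonglongrightarrow> L"
    using l g x unfolding loxodromic_def by simp
qed

lemma lox_inv:
  assumes g: "g \<in> carrier G" and l: "lox g"
  shows "lox (inv g)"
  using l lox_iff[OF g] lox_iff[of "inv g"] g by (simp add: pt_inv d_pt_neg)

text \<open>By invariance the same bound holds at every orbit point between two others, so the orbit
  of the base point is a coarse geodesic line when \<open>g\<close> is loxodromic.\<close>

definition axis :: "'g \<Rightarrow> real \<Rightarrow> bool" where
  "axis g D \<longleftrightarrow> (\<forall>m n::nat. gp x\<^sub>0 (pt g (- int m)) (pt g (int n)) \<le> D)"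

lemma axis_inv: "g \<in> carrier G \<Longrightarrow> axis g D \<Longrightarrow> axis (inv g) D"
  unfolding axis_def using gp_sym by (simp add: pt_inv)

text \<open>The half-orbit towards the attracting end; \<open>E (inv g)\<close> goes to the
  repelling end.\<close>

definition E :: "'g \<Rightarrow> nat \<Rightarrow> 'a" where "E g n = pt g (int n)"

lemma E_in: "g \<in> carrier G \<Longrightarrow> E g n \<in> M"
  by (simp add: E_def)

lemma E_range: "g \<in> carrier G \<Longrightarrow> range (E g) \<subseteq> M"
  using E_in by auto

end

section \<open>Loxodromic isometries and their ends\<close>

locale hyperbolic_action = isometric_action G M d \<psi> x\<^sub>0 + hyperbolic M d \<delta>
  for G :: "('g, 'm) monoid_scheme" (structure) and M :: "'a set" and d \<psi> x\<^sub>0 \<delta>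
begin

lemma delta: "0 \<le> \<delta>"
  using delta_nonneg base by blast

text \<open>All turns of the orbit are translates of the one at the base point, so
  \<open>local_to_global\<close> makes the displacement of the powers grow linearly.\<close>

lemma lox_criterion:
  assumes g: "g \<in> carrier G" and P: "gp x\<^sub>0 (pt g (-1)) (pt g 1) \<le> P"
    and c: "0 < c" "2 * P + 2 * \<delta> + c \<le> d x\<^sub>0 (pt g 1)"
  shows "lox g"
proof (rule lox_of_linear[OF g c(1)])
  fix n
  have P0: "0 \<le> P" using P gp_nonneg[of x\<^sub>0 "pt g (-1)" "pt g 1"] g by simp
  show "c * real n \<le> d x\<^sub>0 (pt g (int n))"
  proof (induction n)
    case 0 then show ?case by (simp add: dist_self)
  next
    case (Suc n)
    have "d (pt g (int 0)) (pt g (int n)) + c \<le> d (pt g (int 0)) (pt g (int (Suc n)))"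
      using local_to_global[of "Suc n" "\<lambda>i. pt g (int i)" P c n] g P P0 c by (simp add: gp_pt d_pt)
    then show ?case using Suc by (simp add: algebra_simps)
  qed
qed

text \<open>The displacement of the \<open>2n\<close>-th power exceeds that of the
  \<open>n\<close>-th by about \<open>n * L\<close>. Hence some \<open>N\<close>-th power has a step
  that is long compared with its turn, and \<open>local_to_global\<close> applies to its orbit
  \<open>y\<close>; the whole orbit of \<open>g\<close> stays within bounded distance of
  \<open>y\<close>.\<close>

lemma lox_axis:
  assumes g: "g \<in> carrier G" and l: "lox g"
  shows "\<exists>D. axis g D"
proof -
  let ?d = "\<lambda>n. d x\<^sub>0 (pt g (int n))"
  obtain L where L: "L > 0" "(\<lambda>n. ?d n / real n) \<longlonglongrightarrow> L" using l lox_iff[OF g] by blast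
  have "filterlim (\<lambda>n::nat. 2 * n) sequentially sequentially"
    by (rule filterlim_subseq) (auto simp: strict_mono_def)
  from filterlim_compose[OF L(2) this] have L2: "(\<lambda>n. ?d (2 * n) / real (2 * n)) \<longlonglongrightarrow> L" by simp
  have "(\<lambda>n. 2 * (?d (2 * n) / real (2 * n)) - ?d n / real n) \<longlonglongrightarrow> 2 * L - L"
    by (intro tendsto_intros L L2)
  then have "(\<lambda>n. 2 * (?d (2 * n) / real (2 * n)) - ?d n / real n) \<longlonglongrightarrow> L" by simp
  from filterlim_tendsto_pos_mult_at_top[OF this L(1) filterlim_real_sequentially]
  have "filterlim (\<lambda>n. ?d (2 * n) - ?d n) at_top sequentially"
    by (rule filterlim_mono_eventually) (auto intro!: eventually_sequentiallyI[of 1] simp: field_simps)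
  then have "\<forall>\<^sub>F n in sequentially. 3 * \<delta> + 1 \<le> ?d (2 * n) - ?d n" by (simp add: filterlim_at_top)
  \<comment> \<open>Equivalent to \<open>2 * P + (3 * \<delta> + 1) \<le> l\<close> below:
    \<open>local_to_global\<close> consumes \<open>2 * \<delta> + 1\<close>, and the comparison of
    the two half-orbits in \<open>B\<close> one more \<open>\<delta>\<close>.\<close>
  then obtain N where N: "N \<ge> 1" "3 * \<delta> + 1 \<le> ?d (2 * N) - ?d N"
    unfolding eventually_sequentially by (metis linear order_refl)
  define y where "y k = pt g (int N * k)" for k
  have yM [simp]: "y k \<in> M" for k unfolding y_def using g by simp
  have y0: "y 0 = x\<^sub>0" by (simp add: y_def)
  have gpy: "gp (y k) (y i) (y j) = gp x\<^sub>0 (y (i - k)) (y (j - k))" for i j k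
    unfolding y_def using gp_pt[OF g] by (simp add: right_diff_distrib)
  have dy: "d (y i) (y j) = d x\<^sub>0 (y (j - i))" for i j
    unfolding y_def using d_pt[OF g] by (simp add: right_diff_distrib)
  define P where "P = gp x\<^sub>0 (y (-1)) (y 1)"
  define l where "l = d x\<^sub>0 (y 1)"
  have "d (y (-1)) (y 1) = ?d (2 * N)" "d (y (-1)) x\<^sub>0 = ?d N" "d (y 1) x\<^sub>0 = ?d N"
    using dy[of "-1" 1] dy[of "-1" 0] dist_sym[OF yM[of 1] base] unfolding y0 by (simp_all add: y_def mult.commute)
  moreover have "l = ?d N" by (simp add: l_def y_def)
  ultimately have lP: "2 * P + (3 * \<delta> + 1) \<le> l" using N unfolding P_def gromov_product_def by (simp add: diff_divide_distrib)
  have P0: "0 \<le> P" unfolding P_def by (rule gp_nonneg) auto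
  have A: "gp x\<^sub>0 (y (- int n)) (y 1) \<le> P + \<delta>" for n
  proof -
    have "gp (y (int n)) (y (int 0)) (y (int (Suc n))) \<le> P + \<delta>"
      using local_to_global[of "Suc n" "\<lambda>i. y (int i)" P 1 n] P0 lP delta
      by (simp add: gpy dy P_def l_def)
    then show ?thesis by (simp add: gpy)
  qed
  \<comment> \<open>From the base point, \<open>y 1\<close> and \<open>y (int n)\<close> lie in
    nearly the same direction, by the estimate along the reversed orbit; so \<open>A\<close> carries
    over from \<open>y 1\<close> to \<open>y (int n)\<close>.\<close>
  have B: "gp x\<^sub>0 (y (- int m)) (y (int n)) \<le> P + 2 * \<delta>" for m n
  proof (cases "n = 0")
    case True
    have "gp x\<^sub>0 (y (- int m)) (y (int n)) = 0" using True y0 dist_self[of x\<^sub>0] by (simp add: gromov_product_def)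
    then show ?thesis using P0 delta by simp
  next
    case False
    have "gp x\<^sub>0 (y 1) (y (int n)) = d x\<^sub>0 (y 1) - gp (y 1) x\<^sub>0 (y (int n))" by (rule gp_swap) auto
    moreover have "gp (y 1) (y 0) (y (int n)) = gp x\<^sub>0 (y (-1)) (y (int (n - 1)))"
      unfolding gpy using False by (simp add: of_nat_diff)
    moreover have "gp x\<^sub>0 (y (-1)) (y (int k)) \<le> P + \<delta>" for k
    proof -
      have "gp (y (- int k)) (y (- int 0)) (y (- int (Suc k))) \<le> P + \<delta>"
        using local_to_global[of "Suc k" "\<lambda>i. y (- int i)" P 1 k] P0 lP delta gp_sym[of "y 1" "y (-1)" x\<^sub>0]
          dy[of "-1" 0] dist_sym[of "y (-1)" x\<^sub>0]
        by (simp add: gpy dy P_def l_def y0)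
      then show ?thesis using gp_sym[of "y (-1)" "y (int k)" x\<^sub>0] by (simp add: gpy)
    qed
    moreover have "gp x\<^sub>0 (y 1) (y (int n)) = gp x\<^sub>0 (y (int n)) (y 1)" by (rule gp_sym) auto
    ultimately have "gp x\<^sub>0 (y (int n)) (y 1) = l - gp x\<^sub>0 (y (- 1)) (y (int (n - 1)))"
      and "gp x\<^sub>0 (y (- 1)) (y (int (n - 1))) \<le> P + \<delta>" unfolding y0 l_def by auto
    then have "l - P - \<delta> \<le> gp x\<^sub>0 (y (int n)) (y 1)" by linarith
    then show ?thesis using four_point[of x\<^sub>0 "y (- int m)" "y (int n)" "y 1"] A[of m] lP P0 delta by simp
  qed
  \<comment> \<open>Bounds the distance from an orbit point to the next point of \<open>y\<close>
    towards the base point.\<close>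
  define K where "K = real N * d x\<^sub>0 (pt g 1)"
  have close: "d (pt g (int m)) (y (int (m div N))) \<le> K \<and> d (pt g (- int m)) (y (- int (m div N))) \<le> K" for m
  proof -
    have "int m = int N * int (m div N) + int (m mod N)" by (metis of_nat_add of_nat_mult mult_div_mod_eq)
    then have e: "int N * int (m div N) - int m = - int (m mod N)" "int N * - int (m div N) - - int m = int (m mod N)" by simp_all
    have "d (pt g (int m)) (y (int (m div N))) = d x\<^sub>0 (pt g (int (m mod N)))"
      "d (pt g (- int m)) (y (- int (m div N))) = d x\<^sub>0 (pt g (int (m mod N)))"
      unfolding y_def d_pt[OF g] e d_pt_neg[OF g] by simp_all
    moreover have "d x\<^sub>0 (pt g (int (m mod N))) \<le> K"
    proof -
    have "d x\<^sub>0 (pt g (int (m mod N))) \<le> real (m mod N) * d x\<^sub>0 (pt g 1)" by (rule d_pt_le[OF g])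
    also have "\<dots> \<le> K" unfolding K_def using N nonneg[of x\<^sub>0 "pt g 1"] g by (intro mult_right_mono) auto
    finally show ?thesis .
    qed
    ultimately show ?thesis by simp
  qed
  have "axis g (P + 2 * \<delta> + 2 * K)" unfolding axis_def
  proof (intro allI)
    fix m n :: nat
    have "gp x\<^sub>0 (pt g (- int m)) (pt g (int n)) \<le> gp x\<^sub>0 (y (- int (m div N))) (pt g (int n)) + K"
      using gp_change[of x\<^sub>0 "pt g (- int m)" "y (- int (m div N))" "pt g (int n)"] close[of m] g by simp
    moreover have "gp x\<^sub>0 (y (- int (m div N))) (pt g (int n)) \<le> gp x\<^sub>0 (y (- int (m div N))) (y (int (n div N))) + K"
      using gp_change'[of x\<^sub>0 "y (- int (m div N))" "y (int (n div N))" "pt g (int n)"] close[of n] g by simp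
    ultimately show "gp x\<^sub>0 (pt g (- int m)) (pt g (int n)) \<le> P + 2 * \<delta> + 2 * K"
      using B[of "m div N" "n div N"] by simp
  qed
  then show ?thesis by blast
qed

lemma ray_E:
  assumes g: "g \<in> carrier G" and D: "axis g D"
  shows "ray x\<^sub>0 (E g)"
  unfolding ray_def
proof (intro conjI exI[of _ D] allI impI E_range g)
  fix m n :: nat assume mn: "m \<le> n"
  have "gp x\<^sub>0 (pt g (int m)) (pt g (int n)) = d x\<^sub>0 (pt g (int m)) - gp (pt g (int m)) x\<^sub>0 (pt g (int n))"
    by (rule gp_swap) (use g in auto)
  moreover have "gp (pt g (int m)) (pt g 0) (pt g (int n)) = gp x\<^sub>0 (pt g (- int m)) (pt g (int (n - m)))"
    unfolding gp_pt[OF g] using mn by (simp add: of_nat_diff)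
  ultimately show "d x\<^sub>0 (E g m) - D \<le> gp x\<^sub>0 (E g m) (E g n)"
    using D unfolding axis_def E_def by simp
qed

lemma rel_translate:
  assumes h: "h \<in> carrier G" and M: "range s \<subseteq> M" "range t \<subseteq> M" and r: "rel x\<^sub>0 s t"
  shows "rel x\<^sub>0 (\<lambda>n. \<psi> h (s n)) (\<lambda>n. \<psi> h (t n))"
proof -
  have st: "s m \<in> M" "t n \<in> M" for m n using M by auto
  have "rel (\<psi> h x\<^sub>0) (\<lambda>n. \<psi> h (s n)) (\<lambda>n. \<psi> h (t n))"
    using r h st unfolding rel_def by (simp add: isom_gp)
  then show ?thesis by (rule rel_base[rotated 4]) (use h st in auto)
qed

lemma rel_translate_iff:
  assumes h: "h \<in> carrier G" and M: "range s \<subseteq> M" "range t \<subseteq> M"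
  shows "rel x\<^sub>0 (\<lambda>n. \<psi> h (s n)) (\<lambda>n. \<psi> h (t n)) \<longleftrightarrow> rel x\<^sub>0 s t"
proof
  assume r: "rel x\<^sub>0 (\<lambda>n. \<psi> h (s n)) (\<lambda>n. \<psi> h (t n))"
  have st: "s m \<in> M" "t n \<in> M" for m n using M by auto
  have "\<psi> (inv h) (\<psi> h x) = x" if "x \<in> M" for x using that h by (simp add: act_mult[symmetric])
  then show "rel x\<^sub>0 s t" using rel_translate[OF _ _ _ r, of "inv h"] h st by (simp add: image_subset_iff)
qed (use rel_translate assms in blast)

lemma rel_E_refl:
  assumes g: "g \<in> carrier G" and l: "lox g"
  shows "rel x\<^sub>0 (E g) (E g)"
proof -
  obtain D where D: "axis g D" using lox_axis[OF g l] by blast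
  show ?thesis
  proof (rule rel_of_unbounded)
    fix C
    obtain n where "C + 1 \<le> d x\<^sub>0 (pt g (int n))"
      using lox_filterlim[OF g l] unfolding filterlim_at_top eventually_sequentially by blast
    moreover have "gp x\<^sub>0 (E g n) (E g n) = d x\<^sub>0 (E g n)"
      using dist_self[of "E g n"] dist_sym[of "E g n" x\<^sub>0] E_in[OF g] by (simp add: gromov_product_def)
    ultimately show "\<exists>m n. C < gp x\<^sub>0 (E g m) (E g n)" unfolding E_def by (intro exI[of _ n]) simp
  qed (use ray_E[OF g D] in auto)
qed

text \<open>Quantitative form of having no common end; this is the form in which ping-pong uses
  it.\<close>

definition indep :: "'g \<Rightarrow> 'g \<Rightarrow> bool" where
  "indep g h \<longleftrightarrow> (\<exists>C. \<forall>i j::int. gp x\<^sub>0 (pt g i) (pt h j) \<le> C)"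

lemma bounded_of_not_rel:
  assumes g: "g \<in> carrier G" "lox g" and t: "ray x\<^sub>0 t"
    and nr: "\<not> rel x\<^sub>0 (E g) t" "\<not> rel x\<^sub>0 (E (inv g)) t"
  shows "\<exists>C. \<forall>i::int. \<forall>n. gp x\<^sub>0 (pt g i) (t n) \<le> C"
proof -
  obtain D where D: "axis g D" using lox_axis[OF g] by blast
  have r: "ray x\<^sub>0 (E g)" "ray x\<^sub>0 (E (inv g))" using ray_E[OF g(1) D] ray_E[OF _ axis_inv[OF g(1) D]] g by auto
  obtain C where C: "\<And>m n. gp x\<^sub>0 (E g m) (t n) \<le> C"
    using rel_of_unbounded[OF base r(1) t] nr(1) by (meson not_le)
  obtain C' where C': "\<And>m n. gp x\<^sub>0 (E (inv g) m) (t n) \<le> C'"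
    using rel_of_unbounded[OF base r(2) t] nr(2) by (meson not_le)
  have "gp x\<^sub>0 (pt g i) (t n) \<le> max C C'" for i n
  proof (cases "i \<ge> 0")
    case True
    then show ?thesis using C[of "nat i" n] by (simp add: E_def)
  next
    case False
    then show ?thesis using C'[of "nat (- i)" n] g by (simp add: E_def pt_inv)
  qed
  then show ?thesis by blast
qed

lemma not_indep_rel:
  assumes g: "g \<in> carrier G" "lox g" and h: "h \<in> carrier G" "lox h" and ni: "\<not> indep g h"
  shows "\<exists>a\<in>{g, inv g}. \<exists>b\<in>{h, inv h}. rel x\<^sub>0 (E a) (E b)"
proof (rule ccontr)
  assume "\<not> ?thesis"
  then have n: "\<not> rel x\<^sub>0 (E g) (E h)" "\<not> rel x\<^sub>0 (E (inv g)) (E h)" "\<not> rel x\<^sub>0 (E g) (E (inv h))"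
    "\<not> rel x\<^sub>0 (E (inv g)) (E (inv h))" by auto
  obtain D where D: "axis h D" using lox_axis[OF h] by blast
  have r: "ray x\<^sub>0 (E h)" "ray x\<^sub>0 (E (inv h))" using ray_E[OF h(1) D] ray_E[OF _ axis_inv[OF h(1) D]] h by auto
  obtain C where C: "\<And>i n. gp x\<^sub>0 (pt g i) (E h n) \<le> C" using bounded_of_not_rel[OF g r(1) n(1,2)] by blast
  obtain C' where C': "\<And>i n. gp x\<^sub>0 (pt g i) (E (inv h) n) \<le> C'" using bounded_of_not_rel[OF g r(2) n(3,4)] by blast
  have "gp x\<^sub>0 (pt g i) (pt h j) \<le> max C C'" for i j
  proof (cases "j \<ge> 0")
    case True
    then show ?thesis using C[of i "nat j"] by (simp add: E_def)
  next
    case False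
    then show ?thesis using C'[of i "nat (- j)"] h by (simp add: E_def pt_inv)
  qed
  then show False using ni unfolding indep_def by blast
qed

text \<open>A large power of \<open>g\<close> moves all points away from its repelling end close to
  its attracting end, where \<open>t\<close> does not go. The products of \<open>t\<close> with its
  image therefore stay bounded, whereas iterating \<open>r\<close> would make them tend to
  infinity.\<close>

lemma not_rel_power_translate:
  assumes g: "g \<in> carrier G" "lox g" and t: "range t \<subseteq> M" and C: "\<And>i n. gp x\<^sub>0 (pt g i) (t n) \<le> C"
    and k: "k \<ge> 1" and r: "rel x\<^sub>0 t (\<lambda>n. \<psi> (g [^] (k::nat)) (t n))"
  shows False
proof -
  have tM: "t n \<in> M" for n using t by auto
  have rj: "rel x\<^sub>0 t (\<lambda>n. \<psi> (g [^] (k * j)) (t n))" if "j \<ge> 1" for j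
    using that
  proof (induction j rule: dec_induct)
    case base then show ?case using r by simp
  next
    case (step j)
    have "rel x\<^sub>0 (\<lambda>n. \<psi> (g [^] k) (t n)) (\<lambda>n. \<psi> (g [^] k) (\<psi> (g [^] (k * j)) (t n)))"
      using rel_translate[OF _ t _ step(3), of "g [^] k"] g tM by (simp add: image_subset_iff)
    then have "rel x\<^sub>0 (\<lambda>n. \<psi> (g [^] k) (t n)) (\<lambda>n. \<psi> (g [^] (k * Suc j)) (t n))"
      using g tM by (simp add: act_mult[symmetric] nat_pow_mult)
    from rel_trans[OF base t _ _ r this] show ?case using g tM by (simp add: image_subset_iff)
  qed
  \<comment> \<open>From this displacement on, the image of \<open>t n\<close> has product above
    \<open>C + \<delta>\<close> with \<open>pt g (int K)\<close>, whereas \<open>t m\<close> has at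
    most \<open>C\<close>.\<close>
  obtain N where N: "\<And>n. n \<ge> N \<Longrightarrow> 2 * C + \<delta> + 1 \<le> d x\<^sub>0 (pt g (int n))"
    using lox_filterlim[OF g] unfolding filterlim_at_top eventually_sequentially by blast
  define K where "K = k * Suc N"
  have "N \<le> K" using mult_le_mono[OF k order_refl, of "Suc N"] unfolding K_def by simp
  then have dK: "2 * C + \<delta> + 1 \<le> d x\<^sub>0 (pt g (int K))" using N by simp
  have bd: "gp x\<^sub>0 (t m) (\<psi> (g [^] K) (t n)) \<le> C + \<delta>" for m n
  proof -
    let ?f = "g [^] K"
    have f: "?f \<in> carrier G" "?f = g [^] int K" using g by (auto simp: int_pow_int)
    have "gp x\<^sub>0 (pt g (int K)) (\<psi> ?f (t n)) = d x\<^sub>0 (pt g (int K)) - gp (pt g (int K)) x\<^sub>0 (\<psi> ?f (t n))"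
      by (rule gp_swap) (use f g tM in auto)
    moreover have "gp (pt g (int K)) x\<^sub>0 (\<psi> ?f (t n)) = gp x\<^sub>0 (pt g (- int K)) (t n)"
      using isom_gp[of ?f x\<^sub>0 "pt g (- int K)" "t n"] f g tM pt_shift[of g "int K" 0] pt_shift[of g "int K" "- int K"] by simp
    moreover have "gp x\<^sub>0 (t m) (pt g (int K)) \<le> C" using C[of "int K" m] gp_sym[of "t m" "pt g (int K)"] g tM by simp
    ultimately show ?thesis using four_point[of x\<^sub>0 "t m" "\<psi> ?f (t n)" "pt g (int K)"] C[of "- int K" n] dK
        gp_sym[of "\<psi> ?f (t n)" "pt g (int K)" x\<^sub>0] f g tM by simp
  qed
  have "rel x\<^sub>0 t (\<lambda>n. \<psi> (g [^] K) (t n))" unfolding K_def by (rule rj) simp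
  then obtain n where "C + \<delta> + 1 \<le> gp x\<^sub>0 (t n) (\<psi> (g [^] K) (t n))" unfolding rel_def by blast
  then show False using bd[of n n] by simp
qed

text \<open>By \<open>lox_criterion\<close>, a non-loxodromic element that moves the base point far
  moves it in nearly the same direction as its inverse does. So the product
  \<open>h \<otimes> k\<close> moves the base point in the direction of \<open>h\<close>, its
  inverse in that of \<open>k\<close>, and these directions differ: the criterion applies to the
  product.\<close>

lemma lox_mult:
  assumes h: "h \<in> carrier G" "k \<in> carrier G" and nl: "\<not> lox h" "\<not> lox k"
    and C: "gp x\<^sub>0 (\<psi> h x\<^sub>0) (\<psi> k x\<^sub>0) \<le> C" and big: "2 * C + 5 * \<delta> + 2 \<le> d x\<^sub>0 (\<psi> h x\<^sub>0)" "2 * C + 5 * \<delta> + 2 \<le> d x\<^sub>0 (\<psi> k x\<^sub>0)"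
  shows "lox (h \<otimes> k)"
proof -
  define a a' b b' u v where "a = \<psi> h x\<^sub>0" and "a' = \<psi> (inv h) x\<^sub>0" and "b = \<psi> k x\<^sub>0" and "b' = \<psi> (inv k) x\<^sub>0"
    and "u = \<psi> (h \<otimes> k) x\<^sub>0" and "v = \<psi> (inv (h \<otimes> k)) x\<^sub>0"
  have M [simp]: "a \<in> M" "a' \<in> M" "b \<in> M" "b' \<in> M" "u \<in> M" "v \<in> M"
    using h by (simp_all add: a_def a'_def b_def b'_def u_def v_def)
  have big': "2 * C + 5 * \<delta> + 2 \<le> d x\<^sub>0 a" "2 * C + 5 * \<delta> + 2 \<le> d x\<^sub>0 b" using big by (auto simp: a_def b_def)
  have crit: "d x\<^sub>0 (\<psi> f x\<^sub>0) \<le> 2 * gp x\<^sub>0 (\<psi> (inv f) x\<^sub>0) (\<psi> f x\<^sub>0) + 2 * \<delta> + 1" if "f \<in> carrier G" "\<not> lox f" for f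
    using lox_criterion[OF that(1) order_refl, of 1] that by (force simp: pt_1 pt_m1)
  have "gp x\<^sub>0 a' a > C + \<delta>" "gp x\<^sub>0 b' b > C + \<delta>"
    using crit[OF h(1) nl(1)] crit[OF h(2) nl(2)] big' delta by (auto simp: a_def a'_def b_def b'_def)
  moreover have ab: "gp x\<^sub>0 a b \<le> C" using C by (simp add: a_def b_def)
  ultimately have 1: "gp x\<^sub>0 a' b \<le> C + \<delta>" "gp x\<^sub>0 a b' \<le> C + \<delta>"
    using four_point[of x\<^sub>0 a a' b] four_point[of x\<^sub>0 a b' b] gp_sym[of a a' x\<^sub>0] by auto
  have canc: "inv h \<otimes> (h \<otimes> k) = k" "k \<otimes> (inv k \<otimes> inv h) = inv h"
    using h by (simp_all add: m_assoc[symmetric])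
  have act: "\<psi> (inv h) u = b" "\<psi> k v = a'" "\<psi> (inv h) a = x\<^sub>0" "\<psi> k b' = x\<^sub>0" "\<psi> (h \<otimes> k) v = x\<^sub>0"
    using h by (simp_all add: a_def a'_def b_def b'_def u_def v_def act_mult[symmetric] inv_mult_group m_assoc canc)
  have d: "d x\<^sub>0 u = d a' b" "d u a = d x\<^sub>0 b" "d v b' = d x\<^sub>0 a" "d x\<^sub>0 v = d x\<^sub>0 u" "d x\<^sub>0 a' = d x\<^sub>0 a"
  proof -
    show "d x\<^sub>0 u = d a' b" using isom[of "inv h" x\<^sub>0 u] h act by (simp add: a'_def)
    show "d u a = d x\<^sub>0 b" using isom[of "inv h" u a] h act dist_sym[of b x\<^sub>0] by simp
    show da: "d x\<^sub>0 a' = d x\<^sub>0 a" using isom[of "inv h" x\<^sub>0 a] h act dist_sym[of a' x\<^sub>0] by (simp add: a'_def)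
    show "d v b' = d x\<^sub>0 a" using isom[of k v b'] h act dist_sym[of a' x\<^sub>0] da by simp
    show "d x\<^sub>0 v = d x\<^sub>0 u" using isom[of "h \<otimes> k" x\<^sub>0 v] h act dist_sym[of u x\<^sub>0] by (simp add: u_def)
  qed
  have sy: "d a x\<^sub>0 = d x\<^sub>0 a" "d b x\<^sub>0 = d x\<^sub>0 b" "d u x\<^sub>0 = d x\<^sub>0 u" "d v x\<^sub>0 = d x\<^sub>0 v" "d a' x\<^sub>0 = d x\<^sub>0 a'" "d b' x\<^sub>0 = d x\<^sub>0 b'"
    by (simp_all add: dist_sym)
  have db: "d x\<^sub>0 b' = d x\<^sub>0 b" using isom[of k x\<^sub>0 b'] h act sy by (simp add: b_def)
  have du: "d x\<^sub>0 a + d x\<^sub>0 b - 2 * C - 2 * \<delta> \<le> d x\<^sub>0 u"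
    using 1(1) unfolding gromov_product_def sy d by simp
  \<comment> \<open>The direction of \<open>u\<close> is that of \<open>a\<close>, the direction of
    \<open>v\<close> that of \<open>b'\<close>, along almost the whole length.\<close>
  have au: "d x\<^sub>0 a - C - \<delta> \<le> gp x\<^sub>0 u a" "d x\<^sub>0 b - C - \<delta> \<le> gp x\<^sub>0 v b'"
    using du unfolding gromov_product_def sy d db by simp_all
  have "gp x\<^sub>0 u v \<le> C + 3 * \<delta>"
  proof (rule ccontr)
    assume "\<not> gp x\<^sub>0 u v \<le> C + 3 * \<delta>"
    then have "C + 2 * \<delta> < gp x\<^sub>0 a v" using four_point[of x\<^sub>0 a u v] au(1) big' gp_sym[of a u x\<^sub>0] delta by simp
    then have "C + \<delta> < gp x\<^sub>0 a b'" using four_point[of x\<^sub>0 a v b'] au(2) big' delta by simp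
    then show False using 1(2) by simp
  qed
  then show ?thesis using lox_criterion[of "h \<otimes> k" "C + 3 * \<delta>" 1] h du big' delta gp_sym[of u v x\<^sub>0]
    by (simp add: pt_1 pt_m1 u_def[symmetric] v_def[symmetric] del: inv_mult_group)
qed

end

section \<open>Actions of general type\<close>

context group
begin

text \<open>Any function whose fibres lie in single right cosets bounds the index by the number of
  its values.\<close>

lemma finite_indexI:
  assumes H: "subgroup H G" and f: "finite (f ` carrier G)"
    and eq: "\<And>x y. x \<in> carrier G \<Longrightarrow> y \<in> carrier G \<Longrightarrow> f x = f y \<Longrightarrow> x \<otimes> inv y \<in> H"
  shows "finite_index H G"
proof -
  define r where "r v = (SOME x. x \<in> carrier G \<and> f x = v)" for v
  have "rcosets H \<subseteq> (\<lambda>v. H #> r v) ` (f ` carrier G)"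
  proof
    fix C assume "C \<in> rcosets H"
    then obtain x where x: "x \<in> carrier G" "C = H #> x" by (auto simp: RCOSETS_def)
    have r: "r (f x) \<in> carrier G \<and> f (r (f x)) = f x" unfolding r_def by (rule someI[of _ x]) (use x in auto)
    then have "x \<otimes> inv (r (f x)) \<in> H" using eq x by auto
    then have "x \<in> H #> r (f x)" using subgroup.rcos_module[OF H is_group] r x by auto
    then have "C = H #> r (f x)" using repr_independence[OF _ _ H] r x by auto
    then show "C \<in> (\<lambda>v. H #> r v) ` (f ` carrier G)" using x by auto
  qed
  then show ?thesis unfolding finite_index_def using H f finite_subset by blast
qed

text \<open>Inversion exchanges left cosets, in which the covering is stated, and right cosets,
  which \<open>finite_index\<close> counts.\<close>

lemma finite_index_left_cover:
  assumes H: "subgroup H G" and F: "finite F" "F \<subseteq> carrier G"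
    and cover: "\<And>x. x \<in> carrier G \<Longrightarrow> \<exists>f\<in>F. inv f \<otimes> x \<in> H"
  shows "finite_index H G"
proof -
  define f where "f x = (SOME f. f \<in> F \<and> inv f \<otimes> inv x \<in> H)" for x
  have f: "f x \<in> F \<and> inv (f x) \<otimes> inv x \<in> H" if "x \<in> carrier G" for x
    unfolding f_def by (rule someI_ex) (use cover[of "inv x"] that in auto)
  show ?thesis
  proof (rule finite_indexI[OF H, of f])
    show "finite (f ` carrier G)" using f F by (auto intro: finite_subset[of _ F])
    fix x y assume xy: "x \<in> carrier G" "y \<in> carrier G" "f x = f y"
    let ?f = "f y"
    have c: "?f \<in> carrier G" using f[OF xy(2)] F by auto
    have "inv (inv ?f \<otimes> inv x) \<otimes> (inv ?f \<otimes> inv y) \<in> H"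
      using f[OF xy(1)] f[OF xy(2)] xy(3) H by (auto intro: subgroup.m_closed subgroup.m_inv_closed)
    moreover have "inv (inv ?f \<otimes> inv x) \<otimes> (inv ?f \<otimes> inv y) = x \<otimes> inv y"
    proof -
      have "?f \<otimes> (inv ?f \<otimes> inv y) = inv y" using xy c by (simp add: m_assoc[symmetric])
      then show ?thesis using xy c by (simp add: inv_mult_group m_assoc)
    qed
    ultimately show "x \<otimes> inv y \<in> H" by simp
  qed
qed

text \<open>The case of two subgroups of B. H. Neumann's lemma on coverings by cosets.\<close>

lemma finite_index_of_two_covers:
  assumes A: "subgroup A G" and B: "subgroup B G" and F: "finite F" "F \<subseteq> carrier G"
    and cover: "\<And>x. x \<in> carrier G \<Longrightarrow> \<exists>f\<in>F. inv f \<otimes> x \<in> A \<or> inv f \<otimes> x \<in> B"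
  shows "finite_index A G \<or> finite_index B G"
proof (rule disjCI)
  assume nB: "\<not> finite_index B G"
  have "\<exists>f\<in>F. inv f \<otimes> x \<in> A" if x: "x \<in> carrier G" for x
  proof (rule ccontr)
    assume n: "\<not> (\<exists>f\<in>F. inv f \<otimes> x \<in> A)"
    \<comment> \<open>The coset of \<open>A\<close> through \<open>x\<close> misses the listed
      cosets of \<open>A\<close>, so it is covered by those of \<open>B\<close>.\<close>
    have AB: "\<exists>f\<in>F. inv f \<otimes> (x \<otimes> a) \<in> B" if a: "a \<in> A" for a
    proof -
      have ac: "a \<in> carrier G" using a A by (auto dest: subgroup.mem_carrier)
      then obtain f where f: "f \<in> F" "inv f \<otimes> (x \<otimes> a) \<in> A \<or> inv f \<otimes> (x \<otimes> a) \<in> B" using cover[of "x \<otimes> a"] x by auto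
      have fc: "f \<in> carrier G" using f F by auto
      have "inv f \<otimes> (x \<otimes> a) \<in> A \<Longrightarrow> inv f \<otimes> (x \<otimes> a) \<otimes> inv a \<in> A"
        using A a by (auto intro: subgroup.m_closed subgroup.m_inv_closed)
      then have "inv f \<otimes> (x \<otimes> a) \<in> A \<Longrightarrow> inv f \<otimes> x \<in> A" using ac x fc by (simp add: m_assoc)
      then show ?thesis using f n by blast
    qed
    \<comment> \<open>Translating that covering by \<open>f \<otimes> inv x\<close> replaces the
      listed coset of \<open>A\<close> through \<open>f\<close> by finitely many cosets of
      \<open>B\<close>.\<close>
    let ?F = "F \<union> (\<lambda>(f, f'). f \<otimes> inv x \<otimes> f') ` (F \<times> F)"
    have "finite_index B G"
    proof (rule finite_index_left_cover[OF B, of ?F])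
      show "finite ?F" using F by auto
      show "?F \<subseteq> carrier G" using F x by auto
      fix y assume y: "y \<in> carrier G"
      then obtain f where f: "f \<in> F" "inv f \<otimes> y \<in> A \<or> inv f \<otimes> y \<in> B" using cover by blast
      show "\<exists>f\<in>?F. inv f \<otimes> y \<in> B"
      proof (cases "inv f \<otimes> y \<in> B")
        case False
        then obtain f' where f': "f' \<in> F" "inv f' \<otimes> (x \<otimes> (inv f \<otimes> y)) \<in> B" using AB f by blast
        moreover have "inv (f \<otimes> inv x \<otimes> f') \<otimes> y = inv f' \<otimes> (x \<otimes> (inv f \<otimes> y))"
          using f f' F x y by (simp add: inv_mult_group m_assoc subsetD[OF F(2)])
        ultimately have "inv (f \<otimes> inv x \<otimes> f') \<otimes> y \<in> B" by simp
        moreover have "f \<otimes> inv x \<otimes> f' \<in> ?F"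
          by (rule UnI2, rule image_eqI[of _ _ "(f, f')"]) (use f(1) f'(1) in auto)
        ultimately show ?thesis by blast
      qed (use f in auto)
    qed
    then show False using nB by simp
  qed
  then show "finite_index A G" using finite_index_left_cover[OF A F] by blast
qed

section \<open>Evaluation of words in group elements\<close>

fun letter_value :: "(nat \<Rightarrow> 'a) \<Rightarrow> nat \<times> bool \<Rightarrow> 'a" where
  "letter_value f (i, b) = (if b then f i else inv (f i))"

definition word_value :: "(nat \<Rightarrow> 'a) \<Rightarrow> (nat \<times> bool) list \<Rightarrow> 'a" where
  "word_value f w = foldr (\<lambda>a x. letter_value f a \<otimes> x) w \<one>"

lemma word_value_simps [simp]: "word_value f [] = \<one>" "word_value f (a # w) = letter_value f a \<otimes> word_value f w"
  by (simp_all add: word_value_def)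

context
  fixes f :: "nat \<Rightarrow> 'a"
  assumes f: "\<And>i. f i \<in> carrier G"
begin

lemma letter_value_closed [simp]: "letter_value f a \<in> carrier G"
  using f by (cases a) auto

lemma word_value_closed [simp]: "word_value f w \<in> carrier G"
  by (induction w) auto

lemma letter_value_inv: "letter_value f (inv_letter a) = inv (letter_value f a)"
  using f by (cases a) (auto simp: inv_letter_def)

lemma word_value_append: "word_value f (u @ v) = word_value f u \<otimes> word_value f v"
  by (induction u) (auto simp: m_assoc)

lemma word_value_reduced_cons: "word_value f (reduced_cons a w) = letter_value f a \<otimes> word_value f w"
proof (cases w)
  case (Cons b w')
  have "letter_value f a \<otimes> (inv (letter_value f a) \<otimes> word_value f w') = word_value f w'"
    by (simp add: m_assoc[symmetric])
  then show ?thesis using Cons by (simp add: letter_value_inv)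
qed simp

lemma word_value_mult: "word_value f (foldr reduced_cons u v) = word_value f u \<otimes> word_value f v"
  by (induction u) (auto simp: word_value_reduced_cons m_assoc)

lemma contains_F2I:
  assumes free: "\<And>w. reduced_word w \<Longrightarrow> fst ` set w \<subseteq> {0, 1} \<Longrightarrow> w \<noteq> [] \<Longrightarrow> word_value f w \<noteq> \<one>"
  shows "contains_F2 G"
proof -
  let ?F = "free_group {0, 1 :: nat}"
  have hom: "word_value f \<in> hom ?F G"
    by (rule homI) (simp_all add: free_group_def word_value_mult)
  then interpret gh: group_hom ?F G "word_value f"
    by (intro group_hom.intro group_hom_axioms.intro group_free_group is_group)
  have inj: "inj_on (word_value f) (carrier ?F)"
    unfolding gh.inj_on_one_iff
  proof (intro allI impI)
    fix w assume w: "w \<in> carrier ?F" "word_value f w = \<one>"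
    then have "w = []" using free[of w] by (auto simp: free_group_def)
    then show "w = \<one>\<^bsub>?F\<^esub>" by (simp add: free_group_def)
  qed
  let ?H = "word_value f ` carrier ?F"
  have sub: "subgroup ?H G" by (rule gh.img_is_subgroup)
  have "word_value f \<in> iso ?F (G\<lparr>carrier := ?H\<rparr>)"
    using inj hom unfolding iso_def bij_betw_def hom_def by simp
  then have "?F \<cong> G\<lparr>carrier := ?H\<rparr>" by (auto simp: is_iso_def)
  then have "G\<lparr>carrier := ?H\<rparr> \<cong> ?F" using group.iso_sym[OF group_free_group] by blast
  then show ?thesis unfolding contains_F2_def using sub by blast
qed

end

end

section \<open>Limit sets and free subgroups\<close>

context hyperbolic_action
begin

lemma gromov_sequences_iff: "s \<in> gromov_sequences M d \<longleftrightarrow> range s \<subseteq> M \<and> rel x\<^sub>0 s s"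
  unfolding gromov_sequences_def using gromov_related_iff[OF base] by blast

definition ends_rel :: "((nat \<Rightarrow> 'a) \<times> (nat \<Rightarrow> 'a)) set" where
  "ends_rel = {(s, t). s \<in> gromov_sequences M d \<and> t \<in> gromov_sequences M d \<and> gromov_related M d s t}"

text \<open>Symmetry and transitivity make each of two related sequences related to itself, so both
  are Gromov sequences.\<close>

lemma ends_rel_iff: "(s, t) \<in> ends_rel \<longleftrightarrow> range s \<subseteq> M \<and> range t \<subseteq> M \<and> rel x\<^sub>0 s t"
proof
  assume "(s, t) \<in> ends_rel"
  then show "range s \<subseteq> M \<and> range t \<subseteq> M \<and> rel x\<^sub>0 s t"
    unfolding ends_rel_def using gromov_sequences_iff gromov_related_iff[OF base, of s t] by simp
next
  assume "range s \<subseteq> M \<and> range t \<subseteq> M \<and> rel x\<^sub>0 s t"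
  then have r: "range s \<subseteq> M" "range t \<subseteq> M" "rel x\<^sub>0 s t" by blast+
  note ts = rel_sym[OF r]
  have "rel x\<^sub>0 s s" by (rule rel_trans[OF base r(1) r(2) r(1) r(3) ts])
  moreover have "rel x\<^sub>0 t t" by (rule rel_trans[OF base r(2) r(1) r(2) ts r(3)])
  ultimately show "(s, t) \<in> ends_rel"
    unfolding ends_rel_def using r gromov_sequences_iff gromov_related_iff[OF base r(1,2)] by simp
qed

lemma gromov_boundary_eq: "gromov_boundary M d = gromov_sequences M d // ends_rel"
  by (simp add: gromov_boundary_def ends_rel_def)

lemma boundary_rel:
  assumes "\<xi> \<in> gromov_boundary M d" "s \<in> \<xi>" "t \<in> \<xi>"
  shows "range s \<subseteq> M" "range t \<subseteq> M" "rel x\<^sub>0 s t"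
proof -
  obtain u where "\<xi> = ends_rel `` {u}" using assms unfolding gromov_boundary_eq by (auto elim: quotientE)
  then have "(u, s) \<in> ends_rel" "(u, t) \<in> ends_rel" using assms by auto
  then show "range s \<subseteq> M" "range t \<subseteq> M" "rel x\<^sub>0 s t"
    unfolding ends_rel_iff using rel_trans[OF base, of s u t] rel_sym[of u s x\<^sub>0] by auto
qed

lemma boundary_class:
  assumes "range s \<subseteq> M" "rel x\<^sub>0 s s"
  shows "ends_rel `` {s} \<in> gromov_boundary M d" "s \<in> ends_rel `` {s}"
  using assms unfolding gromov_boundary_eq by (auto intro: quotientI simp: gromov_sequences_iff ends_rel_iff)

lemma E_in_limit_set:
  assumes g: "g \<in> carrier G" and S: "\<And>n::nat. g [^] int n \<in> S" and \<xi>: "\<xi> \<in> gromov_boundary M d" "E g \<in> \<xi>"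
  shows "\<xi> \<in> limit_set M d \<psi> S"
  unfolding limit_set_def
proof (intro CollectI conjI \<xi> bexI[of _ x\<^sub>0] exI[of _ "\<lambda>n. g [^] int n"])
  show "range (\<lambda>n. g [^] int n) \<subseteq> S" using S by auto
  show "(\<lambda>n. \<psi> (g [^] int n) x\<^sub>0) \<in> \<xi>" using \<xi>(2) by (simp add: E_def[abs_def] pt_def)
qed simp

text \<open>A common boundary point would make the products between orbit points of the two cyclic
  groups unbounded; changing the starting points \<open>x\<close> and \<open>y\<close> to the base
  point costs only a constant.\<close>

lemma limit_set_disjoint:
  assumes g: "g \<in> carrier G" and h: "h \<in> carrier G" and i: "indep g h"
  shows "limit_set M d \<psi> (generate G {g}) \<inter> limit_set M d \<psi> (generate G {h}) = {}"
proof (rule ccontr)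
  assume "\<not> ?thesis"
  then obtain \<xi> x y a b where \<xi>: "\<xi> \<in> gromov_boundary M d" and xy: "x \<in> M" "y \<in> M"
    and a: "range a \<subseteq> generate G {g}" "(\<lambda>n::nat. \<psi> (a n) x) \<in> \<xi>"
    and b: "range b \<subseteq> generate G {h}" "(\<lambda>n::nat. \<psi> (b n) y) \<in> \<xi>"
    unfolding limit_set_def by blast
  obtain C where C: "\<And>i j. gp x\<^sub>0 (pt g i) (pt h j) \<le> C" using i unfolding indep_def by blast
  have "rel x\<^sub>0 (\<lambda>n. \<psi> (a n) x) (\<lambda>n. \<psi> (b n) y)" by (rule boundary_rel[OF \<xi> a(2) b(2)])
  then obtain n where n: "C + d x x\<^sub>0 + d y x\<^sub>0 + 1 \<le> gp x\<^sub>0 (\<psi> (a n) x) (\<psi> (b n) y)" unfolding rel_def by blast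
  obtain i :: int where ai: "a n = g [^] i" using a(1) generate_pow[OF g] by auto
  obtain j :: int where bj: "b n = h [^] j" using b(1) generate_pow[OF h] by auto
  have "gp x\<^sub>0 (\<psi> (a n) x) (\<psi> (b n) y) \<le> gp x\<^sub>0 (pt g i) (\<psi> (b n) y) + d x x\<^sub>0"
    using gp_change[of x\<^sub>0 "\<psi> (a n) x" "pt g i" "\<psi> (b n) y"] isom[of "a n" x x\<^sub>0] xy g h by (simp add: ai bj pt_def)
  also have "gp x\<^sub>0 (pt g i) (\<psi> (b n) y) \<le> gp x\<^sub>0 (pt g i) (pt h j) + d y x\<^sub>0"
    using gp_change'[of x\<^sub>0 "pt g i" "pt h j" "\<psi> (b n) y"] isom[of "b n" y x\<^sub>0] xy g h by (simp add: ai bj pt_def)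
  finally show False using n C[of i j] by simp
qed

text \<open>The translates of the attracting end of \<open>h\<close> by the powers of
  \<open>g\<close> are infinitely many limit points: if two of them agreed, a positive power of
  \<open>g\<close> would fix an end away from its own ends, contrary to
  \<open>not_rel_power_translate\<close>.\<close>

lemma general_typeI:
  assumes g: "g \<in> carrier G" "lox g" and h: "h \<in> carrier G" "lox h" and i: "indep g h"
  shows "general_type G M d \<psi>"
proof -
  obtain C where C: "\<And>i j. gp x\<^sub>0 (pt g i) (pt h j) \<le> C" using i unfolding indep_def by blast
  define s where "s k n = \<psi> (g [^] (k::nat)) (E h n)" for k n
  have sM: "range (s k) \<subseteq> M" for k using g h E_in by (auto simp: s_def)
  have srel: "rel x\<^sub>0 (s k) (s k)" for k
    unfolding s_def using rel_translate[of "g [^] k" "E h" "E h"] E_range rel_E_refl g h by simp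
  have nr: "\<not> rel x\<^sub>0 (s k) (s l)" if "k < l" for k l
  proof
    assume r: "rel x\<^sub>0 (s k) (s l)"
    have "\<psi> (g [^] l) (E h n) = \<psi> (g [^] k) (\<psi> (g [^] (l - k)) (E h n))" for n
      using act_mult[of "g [^] k" "g [^] (l - k)" "E h n"] nat_pow_mult[OF g(1), of k "l - k"] g h E_in that by simp
    then have "rel x\<^sub>0 (E h) (\<lambda>n. \<psi> (g [^] (l - k)) (E h n))"
      using r rel_translate_iff[of "g [^] k" "E h" "\<lambda>n. \<psi> (g [^] (l - k)) (E h n)"] g h E_in unfolding s_def
      by (simp add: image_subset_iff)
    moreover have "gp x\<^sub>0 (pt g i) (E h n) \<le> C" for i n using C by (simp add: E_def)
    moreover have "1 \<le> l - k" using that by simp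
    ultimately show False using not_rel_power_translate[OF g E_range[OF h(1)], of C "l - k"] by blast
  qed
  have "inj (\<lambda>k. ends_rel `` {s k})"
  proof (rule injI)
    fix k l assume "ends_rel `` {s k} = ends_rel `` {s l}"
    then have "s l \<in> ends_rel `` {s k}" "s k \<in> ends_rel `` {s l}" using boundary_class(2)[OF sM srel] by auto
    then have "rel x\<^sub>0 (s k) (s l)" "rel x\<^sub>0 (s l) (s k)" by (auto simp: ends_rel_iff)
    then show "k = l" using nr by (metis linorder_neqE_nat)
  qed
  then have "infinite (range (\<lambda>k. ends_rel `` {s k}))" by (rule range_inj_infinite)
  moreover have "range (\<lambda>k. ends_rel `` {s k}) \<subseteq> limit_set M d \<psi> (carrier G)"
  proof
    fix \<xi> assume "\<xi> \<in> range (\<lambda>k. ends_rel `` {s k})"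
    then obtain k where k: "\<xi> = ends_rel `` {s k}" by auto
    have "s k = (\<lambda>n. \<psi> (g [^] k \<otimes> h [^] int n) x\<^sub>0)"
      unfolding s_def E_def[abs_def] pt_def using g h by (simp add: act_mult)
    then have "(\<lambda>n. \<psi> (g [^] k \<otimes> h [^] int n) x\<^sub>0) \<in> \<xi>" using k boundary_class(2)[OF sM srel] by metis
    moreover have "\<xi> \<in> gromov_boundary M d" unfolding k by (rule boundary_class(1)[OF sM srel])
    moreover have "range (\<lambda>n::nat. g [^] k \<otimes> h [^] int n) \<subseteq> carrier G" using g h by auto
    ultimately show "\<xi> \<in> limit_set M d \<psi> (carrier G)" unfolding limit_set_def using base by blast
  qed
  ultimately have "infinite (limit_set M d \<psi> (carrier G))" using finite_subset by blast
  then show ?thesis unfolding general_type_def using g h limit_set_disjoint[OF g(1) h(1) i] by blast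
qed

text \<open>Without independence some half-orbits of \<open>g\<close> and \<open>h\<close> converge
  to the same boundary point, which then lies in both limit sets.\<close>

lemma general_typeD:
  assumes "general_type G M d \<psi>"
  obtains g h where "g \<in> carrier G" "lox g" "h \<in> carrier G" "lox h" "indep g h"
proof -
  obtain g h where g: "g \<in> carrier G" "lox g" and h: "h \<in> carrier G" "lox h"
    and dis: "limit_set M d \<psi> (generate G {g}) \<inter> limit_set M d \<psi> (generate G {h}) = {}"
    using assms unfolding general_type_def by blast
  have "indep g h"
  proof (rule ccontr)
    assume "\<not> indep g h"
    then obtain a b where a: "a \<in> {g, inv g}" and b: "b \<in> {h, inv h}" and r: "rel x\<^sub>0 (E a) (E b)"
      using not_indep_rel[OF g h] by blast
    have pow: "c [^] int n \<in> generate G {f}" if "c \<in> {f, inv f}" "f \<in> carrier G" for c f n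
    proof -
      have "inv f [^] int n = f [^] (- int n)" using that(2) by (simp add: int_pow_inv int_pow_neg)
      then show ?thesis using that generate_pow[OF that(2)] by auto
    qed
    have c: "a \<in> carrier G" "b \<in> carrier G" "lox a" "lox b" using a b g h lox_inv by auto
    let ?\<xi> = "ends_rel `` {E a}"
    have \<xi>: "?\<xi> \<in> gromov_boundary M d" "E a \<in> ?\<xi>" using boundary_class[OF E_range rel_E_refl] c by auto
    have "E b \<in> ?\<xi>" using r E_range c by (auto simp: ends_rel_iff)
    then have "?\<xi> \<in> limit_set M d \<psi> (generate G {g}) \<inter> limit_set M d \<psi> (generate G {h})"
      using E_in_limit_set[OF c(1) _ \<xi>] E_in_limit_set[OF c(2) _ \<xi>(1)] pow[OF a g(1)] pow[OF b h(1)] by blast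
    then show False using dis by blast
  qed
  then show ?thesis using that g h by blast
qed

text \<open>High powers of \<open>g\<close> and \<open>h\<close> serve as generators. The orbit
  points of the prefixes of a reduced word form a path with long steps, and each turn is isometric
  to the product of the inverse of a letter with the next letter. These products are bounded
  independently of the power, so \<open>local_to_global\<close> applies.\<close>

lemma contains_F2_of_indep:
  assumes g: "g \<in> carrier G" "lox g" and h: "h \<in> carrier G" "lox h" and i: "indep g h"
  shows "contains_F2 G"
proof -
  obtain C where C: "\<And>i j. gp x\<^sub>0 (pt g i) (pt h j) \<le> C" using i unfolding indep_def by blast
  obtain D where D: "axis g D" using lox_axis[OF g] by blast
  obtain D' where D': "axis h D'" using lox_axis[OF h] by blast
  define P where "P = max C (max D D')"
  have "0 \<le> P" using gp_nonneg[of x\<^sub>0 "pt g 0" "pt h 0"] C[of 0 0] unfolding P_def by simp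
  obtain N where N: "\<And>n. n \<ge> N \<Longrightarrow> 2 * P + 2 * \<delta> + 1 \<le> d x\<^sub>0 (pt g (int n))"
    using lox_filterlim[OF g] unfolding filterlim_at_top eventually_sequentially by blast
  obtain N' where N': "\<And>n. n \<ge> N' \<Longrightarrow> 2 * P + 2 * \<delta> + 1 \<le> d x\<^sub>0 (pt h (int n))"
    using lox_filterlim[OF h] unfolding filterlim_at_top eventually_sequentially by blast
  define K where "K = max N N'"
  define f where "f i = (if i = 0 then g else h) [^] int K" for i :: nat
  have f: "f i \<in> carrier G" for i using g h by (simp add: f_def)
  define p where "p a = \<psi> (letter_value f a) x\<^sub>0" for a
  have p: "p (i, b) = pt (if i = 0 then g else h) (if b then int K else - int K)" for i b
    using g h by (simp add: p_def f_def pt_def int_pow_neg)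
  have pM [simp]: "p a \<in> M" for a unfolding p_def using f letter_value_closed[OF f] by simp
  have dp: "2 * P + 2 * \<delta> + 1 \<le> d x\<^sub>0 (p a)" for a
    using N[of K] N'[of K] g h by (cases a) (auto simp: p K_def d_pt_neg)
  \<comment> \<open>Equal generators follow each other only with equal signs, where
    \<open>axis\<close> gives the bound; different generators are handled by
    \<open>indep\<close>.\<close>
  have turn: "gp x\<^sub>0 (p (inv_letter a)) (p b) \<le> P" if ne: "b \<noteq> inv_letter a" "fst a \<in> {0, 1}" "fst b \<in> {0, 1}" for a b
  proof -
    obtain i s j t where ab: "a = (i, s)" "b = (j, t)" by (cases a; cases b)
    have D1: "gp x\<^sub>0 (pt g (- int K)) (pt g (int K)) \<le> P" "gp x\<^sub>0 (pt g (int K)) (pt g (- int K)) \<le> P"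
      "gp x\<^sub>0 (pt h (- int K)) (pt h (int K)) \<le> P" "gp x\<^sub>0 (pt h (int K)) (pt h (- int K)) \<le> P"
      using D D' gp_sym[of "pt g (int K)" "pt g (- int K)"] gp_sym[of "pt h (int K)" "pt h (- int K)"] g h
      unfolding axis_def P_def by (simp_all add: le_max_iff_disj)
    have D2: "gp x\<^sub>0 (pt g k) (pt h l) \<le> P" "gp x\<^sub>0 (pt h l) (pt g k) \<le> P" for k l
      using C[of k l] gp_sym[of "pt h l" "pt g k"] g h unfolding P_def by (simp_all add: le_max_iff_disj)
    show ?thesis
    proof (cases "i = j")
      case True
      then have "s = t" using ne ab by (auto simp: inv_letter_def)
      then show ?thesis using True D1 unfolding ab by (auto simp: p inv_letter_def)
    next
      case False
      then show ?thesis using D2 ne unfolding ab by (auto simp: p inv_letter_def)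
    qed
  qed
  show ?thesis
  proof (rule contains_F2I[OF f])
    fix w :: "(nat \<times> bool) list" assume w: "reduced_word w" "fst ` set w \<subseteq> {0, 1}" "w \<noteq> []"
    define z where "z i = \<psi> (word_value f (take i w)) x\<^sub>0" for i
    have wv: "word_value f u \<in> carrier G" for u by (rule word_value_closed[OF f])
    have lv: "letter_value f a \<in> carrier G" for a by (rule letter_value_closed[OF f])
    have step: "word_value f (take (Suc i) w) = word_value f (take i w) \<otimes> letter_value f (w ! i)" if "i < length w" for i
      using that lv by (simp add: take_Suc_conv_app_nth word_value_append[OF f])
    have z1: "z (Suc i) = \<psi> (word_value f (take i w)) (p (w ! i))" if "i < length w" for i
      using step[OF that] wv lv by (simp add: z_def p_def act_mult)
    have z2: "z i = \<psi> (word_value f (take (Suc i) w)) (p (inv_letter (w ! i)))" if "i < length w" for i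
      unfolding z_def p_def letter_value_inv[OF f] using step[OF that] wv lv
      by (simp add: act_mult[symmetric] m_assoc)
    \<comment> \<open>The last step of the path suffices: it puts the end at distance at least 1
      from the start.\<close>
    have "gp (z (length w - 1)) (z 0) (z (Suc (length w - 1))) \<le> P + \<delta> \<and>
      d (z 0) (z (length w - 1)) + 1 \<le> d (z 0) (z (Suc (length w - 1)))"
    proof (rule local_to_global[of "length w"])
      show "z i \<in> M" for i using wv by (simp add: z_def)
      show "0 \<le> P" by fact
      fix i assume i: "Suc i < length w"
      have "gp (z (Suc i)) (z i) (z (Suc (Suc i))) = gp x\<^sub>0 (p (inv_letter (w ! i))) (p (w ! Suc i))"
        unfolding z1[OF i] z2[OF Suc_lessD[OF i]] unfolding z_def by (rule isom_gp) (use wv in auto)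
      also have "\<dots> \<le> P"
      proof (rule turn)
        show "w ! Suc i \<noteq> inv_letter (w ! i)" using w(1) i unfolding reduced_word_def successively_conv_nth by blast
        have "w ! i \<in> set w" "w ! Suc i \<in> set w" using i by auto
        then show "fst (w ! i) \<in> {0, 1}" "fst (w ! Suc i) \<in> {0, 1}" using w(2) by blast+
      qed
      finally show "gp (z (Suc i)) (z i) (z (Suc (Suc i))) \<le> P" .
    next
      fix i assume i: "i < length w"
      have "d (z i) (z (Suc i)) = d x\<^sub>0 (p (w ! i))" unfolding z1[OF i] unfolding z_def by (rule isom) (use wv in auto)
      then show "2 * P + 2 * \<delta> + 1 \<le> d (z i) (z (Suc i))" using dp by simp
    qed (use w in auto)
    moreover have "0 \<le> d (z 0) (z (length w - 1))" by (rule nonneg) (simp_all add: z_def wv)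
    ultimately have "0 < d (z 0) (z (length w))" using w(3) by simp
    then show "word_value f w \<noteq> \<one>" by (auto simp: z_def dist_self)
  qed
qed

text \<open>Sequences at bounded distance have the same end, so the attracting end of a conjugate is
  the translate by \<open>h\<close> of that of \<open>g\<close>.\<close>

lemma E_conj:
  assumes g: "g \<in> carrier G" and h: "h \<in> carrier G"
  shows "d (E (h \<otimes> g \<otimes> inv h) n) (\<psi> h (E g n)) \<le> d (\<psi> (inv h) x\<^sub>0) x\<^sub>0"
proof -
  have "E (h \<otimes> g \<otimes> inv h) n = \<psi> (h \<otimes> g [^] n) (\<psi> (inv h) x\<^sub>0)"
    using g h by (simp add: E_def pt_def int_pow_int conj_pow act_mult)
  moreover have "\<psi> h (E g n) = \<psi> (h \<otimes> g [^] n) x\<^sub>0"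
    using g h by (simp add: E_def pt_def int_pow_int act_mult)
  ultimately show ?thesis using isom[of "h \<otimes> g [^] n" "\<psi> (inv h) x\<^sub>0" x\<^sub>0] g h by simp
qed

section \<open>Stabilisers of ends\<close>

definition end_stabilizer :: "'g \<Rightarrow> 'g set" where
  "end_stabilizer a = {h \<in> carrier G. rel x\<^sub>0 (\<lambda>n. \<psi> h (E a n)) (E a)}"

lemma translate_E_range: "h \<in> carrier G \<Longrightarrow> a \<in> carrier G \<Longrightarrow> range (\<lambda>n. \<psi> h (E a n)) \<subseteq> M"
  using E_in by auto

lemma inv_mult_end_stabilizer:
  assumes a: "a \<in> carrier G" and u: "u \<in> carrier G" "h \<in> carrier G"
    and r: "rel x\<^sub>0 (\<lambda>n. \<psi> h (E a n)) (\<lambda>n. \<psi> u (E a n))"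
  shows "inv u \<otimes> h \<in> end_stabilizer a"
proof -
  have "rel x\<^sub>0 (\<lambda>n. \<psi> (inv u) (\<psi> h (E a n))) (\<lambda>n. \<psi> (inv u) (\<psi> u (E a n)))"
    by (rule rel_translate[OF _ _ _ r]) (use translate_E_range a u in auto)
  moreover have "\<psi> (inv u) (\<psi> h (E a n)) = \<psi> (inv u \<otimes> h) (E a n)" "\<psi> (inv u) (\<psi> u (E a n)) = E a n" for n
    using a u E_in[OF a] by (simp_all add: act_mult[symmetric])
  ultimately show ?thesis unfolding end_stabilizer_def using u by simp
qed

lemma subgroup_end_stabilizer:
  assumes a: "a \<in> carrier G" "lox a"
  shows "subgroup (end_stabilizer a) G"
proof -
  let ?S = "end_stabilizer a"
  have div: "inv u \<otimes> h \<in> ?S" if "u \<in> ?S" "h \<in> ?S" for u h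
  proof (rule inv_mult_end_stabilizer[OF a(1)])
    have c: "u \<in> carrier G" "h \<in> carrier G" and r: "rel x\<^sub>0 (\<lambda>n. \<psi> u (E a n)) (E a)" "rel x\<^sub>0 (\<lambda>n. \<psi> h (E a n)) (E a)"
      using that by (auto simp: end_stabilizer_def)
    show "rel x\<^sub>0 (\<lambda>n. \<psi> h (E a n)) (\<lambda>n. \<psi> u (E a n))"
      using rel_trans[OF base _ _ _ r(2) rel_sym[OF _ _ r(1)]] translate_E_range[OF _ a(1)] E_range[OF a(1)] c by simp
    show "u \<in> carrier G" "h \<in> carrier G" by fact+
  qed
  have one: "\<one> \<in> ?S" using rel_E_refl[OF a] E_in[OF a(1)] by (simp add: end_stabilizer_def)
  have sub: "?S \<subseteq> carrier G" by (auto simp: end_stabilizer_def)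
  have inv: "inv u \<in> ?S" if "u \<in> ?S" for u using div[OF that one] sub that by (simp add: subsetD)
  show ?thesis
  proof
    show "u \<otimes> h \<in> ?S" if "u \<in> ?S" "h \<in> ?S" for u h using div[OF inv[OF that(1)] that(2)] sub that by (simp add: subsetD)
  qed (use one sub inv in auto)
qed

text \<open>For every \<open>h\<close> the conjugate of \<open>g\<close> by \<open>h\<close> is not
  independent of \<open>g\<close>, so \<open>h\<close> maps one end of \<open>g\<close> to one end
  of \<open>g\<close>. Elements doing this with the same pair of ends lie in one left coset of an
  end stabiliser, so at most four cosets of two subgroups cover the group.\<close>

lemma finite_index_end_stabilizer:
  assumes g: "g \<in> carrier G" "lox g" and ng: "\<not> general_type G M d \<psi>"
  shows "\<exists>a\<in>{g, inv g}. finite_index (end_stabilizer a) G"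
proof -
  let ?g = "inv g"
  have g': "?g \<in> carrier G" "lox ?g" using g lox_inv by auto
  have meet: "\<exists>a\<in>{g, inv g}. \<exists>b\<in>{g, inv g}. rel x\<^sub>0 (E a) (\<lambda>n. \<psi> h (E b n))" if h: "h \<in> carrier G" for h
  proof -
    let ?k = "h \<otimes> g \<otimes> inv h"
    have k: "?k \<in> carrier G" "lox ?k" using g h lox_conj by auto
    have "\<not> indep g ?k" using general_typeI[OF g k] ng by blast
    then obtain a c where a: "a \<in> {g, inv g}" and c: "c \<in> {?k, inv ?k}" and r: "rel x\<^sub>0 (E a) (E c)"
      using not_indep_rel[OF g k] by blast
    have "inv ?k = h \<otimes> inv g \<otimes> inv h" using g h by (simp add: inv_mult_group m_assoc)
    then obtain b where b: "b \<in> {g, inv g}" "c = h \<otimes> b \<otimes> inv h" using c by auto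
    have cc: "a \<in> carrier G" "b \<in> carrier G" "c \<in> carrier G" using a b g h by auto
    have "rel x\<^sub>0 (E a) (\<lambda>n. \<psi> h (E b n))"
      by (rule rel_close[OF base _ _ _ r, of _ "d (\<psi> (inv h) x\<^sub>0) x\<^sub>0"])
        (use E_range translate_E_range[OF h] cc E_conj[OF cc(2) h] b in auto)
    then show ?thesis using a b by blast
  qed
  define Y where "Y a b = {h \<in> carrier G. rel x\<^sub>0 (E a) (\<lambda>n. \<psi> h (E b n))}" for a b
  define u where "u = (SOME h. h \<in> Y g ?g)"
  define v where "v = (SOME h. h \<in> Y ?g g)"
  have Y: "inv u \<otimes> h \<in> end_stabilizer b" if "u \<in> Y a b" "h \<in> Y a b" "a \<in> carrier G" "b \<in> carrier G" for u h a b
  proof (rule inv_mult_end_stabilizer[OF that(4)])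
    have c: "u \<in> carrier G" "h \<in> carrier G" and r: "rel x\<^sub>0 (E a) (\<lambda>n. \<psi> u (E b n))" "rel x\<^sub>0 (E a) (\<lambda>n. \<psi> h (E b n))"
      using that by (auto simp: Y_def)
    show "rel x\<^sub>0 (\<lambda>n. \<psi> h (E b n)) (\<lambda>n. \<psi> u (E b n))"
      using rel_trans[OF base _ _ _ rel_sym[OF _ _ r(2)] r(1)] translate_E_range[OF _ that(4)] E_range[OF that(3)] c by simp
    show "u \<in> carrier G" "h \<in> carrier G" by fact+
  qed
  \<comment> \<open>\<open>u\<close> or \<open>v\<close> is arbitrary if no element maps one end to
    the other in that direction; hence the intersection with the carrier.\<close>
  let ?F = "{\<one>} \<union> ({u, v} \<inter> carrier G)"
  have "finite_index (end_stabilizer g) G \<or> finite_index (end_stabilizer ?g) G"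
  proof (rule finite_index_of_two_covers[of _ _ ?F])
    fix h assume h: "h \<in> carrier G"
    have 1: "\<exists>f\<in>?F. inv f \<otimes> h \<in> end_stabilizer a" if "h \<in> Y a a" "a \<in> carrier G" for a
    proof -
      have "rel x\<^sub>0 (\<lambda>n. \<psi> h (E a n)) (E a)" using that E_range[of a] translate_E_range[OF h, of a] rel_sym
        by (auto simp: Y_def)
      then show ?thesis using h by (intro bexI[of _ \<one>]) (auto simp: end_stabilizer_def)
    qed
    have 2: "\<exists>f\<in>?F. inv f \<otimes> h \<in> end_stabilizer ?g" if hX: "h \<in> Y g ?g"
    proof -
      have "u \<in> Y g ?g" unfolding u_def using hX by (rule someI)
      then show ?thesis using Y[of u g ?g h] hX g g' by (auto simp: Y_def)
    qed
    have 3: "\<exists>f\<in>?F. inv f \<otimes> h \<in> end_stabilizer g" if hX: "h \<in> Y ?g g"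
    proof -
      have "v \<in> Y ?g g" unfolding v_def using hX by (rule someI)
      then show ?thesis using Y[of v ?g g h] hX g g' by (auto simp: Y_def)
    qed
    have "h \<in> Y g g \<or> h \<in> Y ?g ?g \<or> h \<in> Y g ?g \<or> h \<in> Y ?g g" using meet[OF h] h by (auto simp: Y_def)
    then show "\<exists>f\<in>?F. inv f \<otimes> h \<in> end_stabilizer g \<or> inv f \<otimes> h \<in> end_stabilizer ?g"
      using 1[of g] 1[of ?g] 2 3 g g' by blast
  qed (use subgroup_end_stabilizer g g' in auto)
  then show ?thesis by blast
qed

text \<open>By \<open>not_rel_power_translate\<close>, a loxodromic element fixes no end other than
  its own two.\<close>

lemma end_stabilizer_lox:
  assumes a: "a \<in> carrier G" "lox a" and h: "h \<in> end_stabilizer a" "lox h"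
  shows "\<exists>b\<in>{h, inv h}. rel x\<^sub>0 (E b) (E a)"
proof (rule ccontr)
  assume n: "\<not> ?thesis"
  have hc: "h \<in> carrier G" and r: "rel x\<^sub>0 (\<lambda>n. \<psi> h (E a n)) (E a)" using h by (auto simp: end_stabilizer_def)
  obtain D where D: "axis a D" using lox_axis[OF a] by blast
  obtain C where C: "\<And>i n. gp x\<^sub>0 (pt h i) (E a n) \<le> C"
    using bounded_of_not_rel[OF hc h(2) ray_E[OF a(1) D]] n by auto
  have "rel x\<^sub>0 (E a) (\<lambda>n. \<psi> (h [^] (1::nat)) (E a n))"
    using rel_sym[OF translate_E_range[OF hc a(1)] E_range[OF a(1)] r] hc by simp
  then show False using not_rel_power_translate[OF hc h(2) E_range[OF a(1)] C, of 1] by simp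
qed

end

section \<open>Homomorphisms from cuts\<close>

context geodesic_on
begin

text \<open>The endpoints of the coboundary edges of \<open>B\<close>, on either side.\<close>

definition bd :: "'a set \<Rightarrow> 'a set" where
  "bd B = {y \<in> M. \<exists>z\<in>M. d y z \<le> 1 \<and> (y \<in> B) \<noteq> (z \<in> B)}"

lemma bdI: "y \<in> M \<Longrightarrow> z \<in> M \<Longrightarrow> d y z \<le> 1 \<Longrightarrow> (y \<in> B) \<noteq> (z \<in> B) \<Longrightarrow> y \<in> bd B \<and> z \<in> bd B"
  unfolding bd_def using dist_sym[of z y] by fastforce

lemma chain_crosses:
  assumes "C \<subseteq> M" "(x, y) \<in> chain 1 C" "(x \<in> B) \<noteq> (y \<in> B)"
  shows "\<exists>u\<in>C. u \<in> bd B"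
proof (rule ccontr)
  assume n: "\<not> (\<exists>u\<in>C. u \<in> bd B)"
  have "(x \<in> B) = (y \<in> B)" using assms(2) unfolding chain_def
  proof (induction rule: rtrancl_induct)
    case (step y z)
    then have "y \<in> C" "z \<in> C" "d y z \<le> 1" by auto
    then have "(y \<in> B) = (z \<in> B)" using bdI[of y z B] assms(1) n by blast
    then show ?case using step by simp
  qed simp
  then show False using assms(3) by simp
qed

lemma interval_crosses:
  assumes "x \<in> M" "y \<in> M" "(x \<in> B) \<noteq> (y \<in> B)"
  shows "\<exists>u\<in>interval x y. u \<in> bd B"
  by (rule chain_crosses[OF _ interval_chain[OF assms(1,2)] assms(3)]) (auto simp: interval_def)

text \<open>Along a path, membership changes only at coboundary points. A set is therefore
  determined by its trace on any \<open>F\<close> that contains its coboundary and one starting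
  vertex; this makes families of cuts finite.\<close>

lemma eq_of_bd_subset:
  assumes v: "v \<in> M" "v \<in> F" and B: "B \<subseteq> M" "bd B \<subseteq> F" "B' \<subseteq> M" "bd B' \<subseteq> F" and eq: "B \<inter> F = B' \<inter> F"
  shows "B = B'"
proof -
  have "(y \<in> B) = (y \<in> B')" if y: "y \<in> M" for y
  proof -
    have "y \<in> M \<and> ((y \<in> B) = (y \<in> B'))" using interval_chain[OF v(1) y] unfolding chain_def
    proof (induction rule: rtrancl_induct)
      case base then show ?case using v eq by auto
    next
      case (step y z)
      then have yz: "z \<in> M" "d y z \<le> 1" by (auto simp: interval_def)
      show ?case
      proof (cases "(y \<in> B) = (z \<in> B) \<and> (y \<in> B') = (z \<in> B')")
        case False
        then have "z \<in> F" using bdI[of y z B] bdI[of y z B'] step(3) yz B by blast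
        then show ?thesis using eq yz by auto
      qed (use step yz in auto)
    qed
    then show ?thesis by simp
  qed
  then show ?thesis using B by auto
qed

end

locale proper_quasitree_action = bottleneck M d + hyperbolic_action G M d \<psi> x\<^sub>0 \<delta>
  for G :: "('g, 'm) monoid_scheme" (structure) and M :: "'a set" and d \<psi> x\<^sub>0 \<delta> +
  assumes finite_ball: "v \<in> M \<Longrightarrow> finite {y \<in> M. d v y \<le> r}"
begin

lemma chain_translate:
  assumes h: "h \<in> carrier G" and C: "C \<subseteq> M" "\<And>u. u \<in> C \<Longrightarrow> \<psi> h u \<in> C" and c: "(u, v) \<in> chain s C"
  shows "(\<psi> h u, \<psi> h v) \<in> chain s C"
  using c unfolding chain_def
proof (induction rule: rtrancl_induct)
  case (step y z)
  then have "y \<in> C" "z \<in> C" "d y z \<le> s" by auto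
  moreover from this have "d (\<psi> h y) (\<psi> h z) = d y z" using C(1) isom[OF h, of y z] by blast
  ultimately have "(\<psi> h y, \<psi> h z) \<in> {(u, v). u \<in> C \<and> v \<in> C \<and> d u v \<le> s}" using C(2) by simp
  then show ?case using step by (meson rtrancl.rtrancl_into_rtrancl)
qed simp

text \<open>
  If the orbit of a finitely generated group is unbounded, then it comes close to the midpoint of a long
  geodesic between two of its points, by the bottleneck property. Seen from there, two elements
  move the basepoint far in different directions.
\<close>

lemma bounded_orbit:
  assumes S: "finite S" "S \<subseteq> carrier G" and nl: "\<And>g. g \<in> generate G S \<Longrightarrow> \<not> lox g"
  shows "\<exists>R. \<forall>g\<in>generate G S. d x\<^sub>0 (\<psi> g x\<^sub>0) \<le> R"
proof -
  let ?L = "generate G S"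
  have L: "subgroup ?L G" by (rule generate_is_subgroup[OF S(2)])
  have Lc: "g \<in> carrier G" if "g \<in> ?L" for g using subgroup.mem_carrier[OF L that] .
  \<comment> \<open>The largest displacement of a generator; with steps of this size the orbit is
    coarsely connected.\<close>
  define s where "s = Max (insert 0 ((\<lambda>a. d x\<^sub>0 (\<psi> a x\<^sub>0)) ` S))"
  have s: "d x\<^sub>0 (\<psi> a x\<^sub>0) \<le> s" if "a \<in> S" for a unfolding s_def using that S by (intro Max_ge) auto
  define C where "C = (\<lambda>g. \<psi> g x\<^sub>0) ` ?L"
  have CM: "C \<subseteq> M" unfolding C_def using Lc by auto
  have x0C: "x\<^sub>0 \<in> C" unfolding C_def using subgroup.one_closed[OF L] by (auto intro!: image_eqI[of _ _ \<one>])
  have transl: "\<psi> h u \<in> C" if "h \<in> ?L" "u \<in> C" for h u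
  proof -
    from that(2) obtain g where g: "g \<in> ?L" "u = \<psi> g x\<^sub>0" unfolding C_def by blast
    then have "\<psi> h u = \<psi> (h \<otimes> g) x\<^sub>0" using that Lc by (simp add: act_mult)
    then show ?thesis unfolding C_def using subgroup.m_closed[OF L that(1) g(1)] by auto
  qed
  have ch: "(x\<^sub>0, \<psi> g x\<^sub>0) \<in> chain s C" if "g \<in> ?L" for g
    using that
  proof (induction rule: generate.induct)
    case one then show ?case using chain_refl by simp
  next
    case (incl h) then show ?case using x0C transl[OF generate.incl x0C] s by (intro chain_step) auto
  next
    case (inv h)
    have hc: "h \<in> carrier G" using inv S by auto
    have "d x\<^sub>0 (\<psi> (inv h) x\<^sub>0) = d x\<^sub>0 (\<psi> h x\<^sub>0)"
      using d_pt_neg[OF hc, of 1] pt_1[OF hc] pt_m1[OF hc] by simp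
    then show ?case using x0C transl[OF generate.inv x0C] s inv by (intro chain_step) auto
  next
    case (eng h1 h2)
    have c: "h1 \<in> carrier G" "h2 \<in> carrier G" using eng Lc by auto
    have "(\<psi> h1 x\<^sub>0, \<psi> h1 (\<psi> h2 x\<^sub>0)) \<in> chain s C"
      by (rule chain_translate[OF c(1) CM _ eng(4)]) (use transl eng in auto)
    then show ?case using chain_trans[OF eng(3)] c by (simp add: act_mult)
  qed
  obtain \<Delta>' where D': "\<forall>x\<in>M. \<forall>y\<in>M. \<forall>m\<in>interval x y. \<forall>C\<subseteq>M. x \<in> C \<and> (x, y) \<in> chain s C \<longrightarrow> (\<exists>u\<in>C. d u m \<le> \<Delta>')"
    using bottleneck by blast
  define \<Delta> where "\<Delta> = max 0 \<Delta>'"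
  have D: "\<exists>u\<in>C. d u m \<le> \<Delta>" if "y \<in> M" "m \<in> interval x\<^sub>0 y" "(x\<^sub>0, y) \<in> chain s C" for y m
    using D' that CM x0C unfolding \<Delta>_def by (metis base max.coboundedI2)
  \<comment> \<open>\<open>lox_mult\<close> with bound \<open>\<Delta>\<close> asks for
    displacements of \<open>2 * \<Delta> + 5 * \<delta> + 2\<close>. An orbit point within
    \<open>\<Delta>\<close> of the midpoint, itself rounded by less than 1, leaves at least this
    much on both sides.\<close>
  have "d x\<^sub>0 (\<psi> g x\<^sub>0) \<le> 2 * (3 * \<Delta> + 5 * \<delta> + 3)" if g: "g \<in> ?L" for g
  proof (rule ccontr)
    assume big: "\<not> ?thesis"
    have gc: "g \<in> carrier G" using g Lc by auto
    let ?y = "\<psi> g x\<^sub>0"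
    have yM: "?y \<in> M" using gc by simp
    define k where "k = nat \<lfloor>d x\<^sub>0 ?y / 2\<rfloor>"
    have k: "real k \<le> d x\<^sub>0 ?y / 2" "d x\<^sub>0 ?y / 2 < real k + 1"
      using nonneg[OF base yM] unfolding k_def by linarith+
    have "real k \<le> d x\<^sub>0 ?y" using k nonneg[OF base yM] by linarith
    then obtain m where m: "m \<in> interval x\<^sub>0 ?y" "d x\<^sub>0 m = real k"
      using between[OF base yM] by blast
    then have mM: "m \<in> M" and xy: "d x\<^sub>0 m + d m ?y = d x\<^sub>0 ?y" using intervalD[OF m(1)] by auto
    obtain u where u: "u \<in> C" "d u m \<le> \<Delta>" using D[OF yM m(1) ch[OF g]] by auto
    then obtain c where c: "c \<in> ?L" "u = \<psi> c x\<^sub>0" by (auto simp: C_def)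
    have cc: "c \<in> carrier G" using c Lc by auto
    have uM: "u \<in> M" using u CM by auto
    \<comment> \<open>Translating the orbit point \<open>u\<close> near the midpoint to the base
      point turns the two ends of the geodesic into the images of the base point under these
      elements.\<close>
    let ?h = "inv c" and ?k = "inv c \<otimes> g"
    have canc: "\<psi> (inv c) u = x\<^sub>0" using cc c by (simp add: act_mult[symmetric])
    have hk: "?h \<in> ?L" "?k \<in> ?L" "?h \<otimes> ?k \<in> ?L"
      using c g subgroup.m_closed[OF L] subgroup.m_inv_closed[OF L] by auto
    have k_act: "\<psi> ?k x\<^sub>0 = \<psi> (inv c) ?y" using cc gc by (simp add: act_mult)
    have "gp x\<^sub>0 (\<psi> ?h x\<^sub>0) (\<psi> ?k x\<^sub>0) = gp u x\<^sub>0 ?y"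
      unfolding k_act using isom_gp[of "inv c" u x\<^sub>0 ?y] cc uM yM canc by simp
    also have "\<dots> \<le> gp m x\<^sub>0 ?y + d u m" by (rule gp_base[OF uM mM base yM])
    also have "gp m x\<^sub>0 ?y = 0" using xy dist_sym[OF mM yM] by (simp add: gromov_product_def)
    finally have gpb: "gp x\<^sub>0 (\<psi> ?h x\<^sub>0) (\<psi> ?k x\<^sub>0) \<le> \<Delta>" using u by simp
    have d1: "d x\<^sub>0 (\<psi> ?h x\<^sub>0) = d u x\<^sub>0" using isom[of "inv c" u x\<^sub>0] cc uM canc by simp
    have d2: "d x\<^sub>0 (\<psi> ?k x\<^sub>0) = d u ?y" unfolding k_act using isom[of "inv c" u ?y] cc uM yM canc by simp
    have "d x\<^sub>0 m \<le> d u x\<^sub>0 + d u m" "d m ?y \<le> d u m + d u ?y"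
      using tri[OF base uM mM] tri[OF mM uM yM] dist_sym[OF uM base] dist_sym[OF uM mM] by auto
    then have "lox (?h \<otimes> ?k)" using lox_mult[OF Lc[OF hk(1)] Lc[OF hk(2)] nl[OF hk(1)] nl[OF hk(2)] gpb]
      k m xy u big d1 d2 by auto
    then show False using nl hk by blast
  qed
  then show ?thesis by blast
qed

lemma image_act_iff:
  assumes "h \<in> carrier G" "y \<in> M" "A \<subseteq> M"
  shows "y \<in> \<psi> h ` A \<longleftrightarrow> \<psi> (inv h) y \<in> A"
proof
  assume "y \<in> \<psi> h ` A"
  then obtain z where "z \<in> A" "y = \<psi> h z" by auto
  then show "\<psi> (inv h) y \<in> A" using assms by (simp add: act_mult[symmetric] subsetD)
next
  assume "\<psi> (inv h) y \<in> A"
  moreover have "y = \<psi> h (\<psi> (inv h) y)" using assms by (simp add: act_mult[symmetric])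
  ultimately show "y \<in> \<psi> h ` A" by blast
qed

lemma bd_image:
  assumes h: "h \<in> carrier G" and A: "A \<subseteq> M"
  shows "bd (\<psi> h ` A) = \<psi> h ` bd A"
proof -
  have 1: "\<psi> h ` bd B \<subseteq> bd (\<psi> h ` B)" if h: "h \<in> carrier G" and B: "B \<subseteq> M" for h B
  proof
    fix y assume "y \<in> \<psi> h ` bd B"
    then obtain u z where u: "u \<in> M" "z \<in> M" "d u z \<le> 1" "(u \<in> B) \<noteq> (z \<in> B)" "y = \<psi> h u"
      by (auto simp: bd_def)
    have "\<psi> h v \<in> \<psi> h ` B \<longleftrightarrow> v \<in> B" if "v \<in> M" for v
      using image_act_iff[OF h _ B, of "\<psi> h v"] that h by (simp add: act_mult[symmetric])
    then show "y \<in> bd (\<psi> h ` B)" using u bdI[of "\<psi> h u" "\<psi> h z"] h isom[OF h, of u z] by simp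
  qed
  have canc: "\<psi> h ` \<psi> (inv h) ` B = B" "\<psi> (inv h) ` \<psi> h ` B = B" if "B \<subseteq> M" for B
  proof -
    have "\<psi> h (\<psi> (inv h) x) = x" "\<psi> (inv h) (\<psi> h x) = x" if "x \<in> B" for x
      using that \<open>B \<subseteq> M\<close> h by (simp_all add: act_mult[symmetric] subsetD)
    then show "\<psi> h ` \<psi> (inv h) ` B = B" "\<psi> (inv h) ` \<psi> h ` B = B" by (simp_all add: image_image)
  qed
  have "\<psi> (inv h) ` bd (\<psi> h ` A) \<subseteq> bd A"
  proof -
    have "\<psi> h ` A \<subseteq> M" using h A by auto
    from 1[OF inv_closed[OF h] this] show ?thesis by (simp only: canc(2)[OF A])
  qed
  then have "\<psi> h ` \<psi> (inv h) ` bd (\<psi> h ` A) \<subseteq> \<psi> h ` bd A" by (rule image_mono)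
  moreover have "bd (\<psi> h ` A) \<subseteq> M" by (auto simp: bd_def)
  ultimately show ?thesis using 1[OF h A] canc(1) by auto
qed

end

text \<open>
  The translates of a set \<open>A\<close> with finite coboundary form a system of walls, and the signed number of walls
  between \<open>x\<^sub>0\<close> and its image is an integer valued homomorphism.
\<close>

locale cut_system = proper_quasitree_action G M d \<psi> x\<^sub>0 \<delta>
  for G :: "('g, 'm) monoid_scheme" (structure) and M :: "'a set" and d \<psi> x\<^sub>0 \<delta> +
  fixes H :: "'g set" and A :: "'a set" and \<rho> :: real
  assumes H: "subgroup H G" and AM: "A \<subseteq> M" and bdA: "\<And>y. y \<in> bd A \<Longrightarrow> d x\<^sub>0 y \<le> \<rho>"
begin

text \<open>A set of translates and not a family indexed by \<open>H\<close>: a translate with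
  infinite stabiliser counts once.\<close>

definition cuts :: "'a set set" where "cuts = (\<lambda>h. \<psi> h ` A) ` H"

definition cuts_near :: "'a \<Rightarrow> real \<Rightarrow> 'a set set" where
  "cuts_near v r = {B \<in> cuts. \<exists>y\<in>bd B. d v y \<le> r}"

definition pos :: "'a \<Rightarrow> 'a \<Rightarrow> 'a set set" where
  "pos x y = {B \<in> cuts. x \<notin> B \<and> y \<in> B}"

definition cocycle :: "'a \<Rightarrow> 'a \<Rightarrow> int" where
  "cocycle x y = int (card (pos x y)) - int (card (pos y x))"

definition \<tau> :: "'g \<Rightarrow> int" where
  "\<tau> h = cocycle x\<^sub>0 (\<psi> h x\<^sub>0)"

lemma HG: "h \<in> H \<Longrightarrow> h \<in> carrier G"
  using H by (auto dest: subgroup.mem_carrier)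

lemma cuts_M: "B \<in> cuts \<Longrightarrow> B \<subseteq> M"
  unfolding cuts_def using AM HG by auto

lemma bd_diam:
  assumes "B \<in> cuts" "y \<in> bd B" "z \<in> bd B"
  shows "d y z \<le> 2 * \<rho>"
proof -
  obtain h where h: "h \<in> H" "B = \<psi> h ` A" using assms by (auto simp: cuts_def)
  then obtain u v where uv: "u \<in> bd A" "v \<in> bd A" "y = \<psi> h u" "z = \<psi> h v"
    using assms(2,3) bd_image[OF HG[OF h(1)] AM] by auto
  then have M: "u \<in> M" "v \<in> M" by (auto simp: bd_def)
  have "d y z = d u v" using uv isom[OF HG[OF h(1)] M] by simp
  also have "\<dots> \<le> d x\<^sub>0 u + d x\<^sub>0 v" using tri[OF M(1) base M(2)] dist_sym[OF M(1) base] by simp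
  finally show ?thesis using bdA[OF uv(1)] bdA[OF uv(2)] by simp
qed

text \<open>Coboundaries of cuts have diameter at most \<open>2 * \<rho>\<close>, so a cut with one
  coboundary point near \<open>v\<close> has its whole coboundary in a finite ball and is determined
  by its trace there. Inserting \<open>v\<close> gives \<open>eq_of_bd_subset\<close> its starting
  vertex also for negative radii.\<close>

lemma finite_cuts_near:
  assumes v: "v \<in> M"
  shows "finite (cuts_near v r)"
proof -
  define F where "F = insert v {y \<in> M. d v y \<le> r + 2 * \<rho>}"
  have F: "finite F" unfolding F_def using finite_ball[OF v] by simp
  have sub: "bd B \<subseteq> F \<and> B \<subseteq> M" if B: "B \<in> cuts_near v r" for B
  proof
    obtain y where y: "y \<in> bd B" "d v y \<le> r" "B \<in> cuts" using B by (auto simp: cuts_near_def)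
    have bM: "bd B \<subseteq> M" by (auto simp: bd_def)
    show "bd B \<subseteq> F"
    proof
      fix z assume z: "z \<in> bd B"
      then have "d v z \<le> d v y + d y z" using tri[OF v] y bM by auto
      then show "z \<in> F" unfolding F_def using bd_diam[OF y(3,1) z] y z bM by auto
    qed
    show "B \<subseteq> M" using cuts_M y by auto
  qed
  have "inj_on (\<lambda>B. B \<inter> F) (cuts_near v r)"
  proof (rule inj_onI)
    fix B B' assume B: "B \<in> cuts_near v r" "B' \<in> cuts_near v r" "B \<inter> F = B' \<inter> F"
    show "B = B'" by (rule eq_of_bd_subset[OF v, of F]) (use sub B in \<open>auto simp: F_def\<close>)
  qed
  moreover have "(\<lambda>B. B \<inter> F) ` cuts_near v r \<subseteq> Pow F" by auto
  ultimately show ?thesis using F by (meson finite_Pow_iff inj_on_finite)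
qed

lemma separating_near:
  assumes "x \<in> M" "y \<in> M" "B \<in> cuts" "(x \<in> B) \<noteq> (y \<in> B)"
  shows "B \<in> cuts_near x (d x y)"
proof -
  obtain u where u: "u \<in> interval x y" "u \<in> bd B" using interval_crosses[OF assms(1,2,4)] by auto
  have "d x u \<le> d x y" using intervalD[OF u(1)] nonneg[of u y] assms(2) by auto
  then show ?thesis using u assms(3) by (auto simp: cuts_near_def)
qed

lemma finite_pos: "x \<in> M \<Longrightarrow> y \<in> M \<Longrightarrow> finite (pos x y)"
  using finite_subset[OF _ finite_cuts_near[of x "d x y"], of "pos x y"] separating_near[of x y]
  by (auto simp: pos_def)

text \<open>As a sum over a fixed finite set of cuts the cocycle visibly telescopes, which reduces
  additivity to choosing a set large enough for three points.\<close>

lemma cocycle_sum: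
  assumes "finite U" "pos x y \<subseteq> U" "pos y x \<subseteq> U" "U \<subseteq> cuts"
  shows "cocycle x y = (\<Sum>B\<in>U. of_bool (y \<in> B) - of_bool (x \<in> B))"
proof -
  have "int (card (pos x y)) = (\<Sum>B\<in>U. of_bool (x \<notin> B \<and> y \<in> B))" "int (card (pos y x)) = (\<Sum>B\<in>U. of_bool (y \<notin> B \<and> x \<in> B))"
    using assms unfolding pos_def by (simp_all add: sum_of_bool_eq Int_def) (rule arg_cong[where f = card], auto)+
  then show ?thesis unfolding cocycle_def by (auto simp: sum_subtractf[symmetric] intro!: sum.cong)
qed

lemma cocycle_add:
  assumes M: "x \<in> M" "y \<in> M" "z \<in> M"
  shows "cocycle x z = cocycle x y + cocycle y z"
proof -
  define U where "U = pos x y \<union> pos y x \<union> pos y z \<union> pos z y \<union> pos x z \<union> pos z x"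
  have U: "finite U" "U \<subseteq> cuts" unfolding U_def using finite_pos M by (auto simp: pos_def)
  have "pos x y \<subseteq> U" "pos y x \<subseteq> U" "pos y z \<subseteq> U" "pos z y \<subseteq> U" "pos x z \<subseteq> U" "pos z x \<subseteq> U" by (auto simp: U_def)
  then show ?thesis using cocycle_sum[OF U(1) _ _ U(2)] by (simp add: sum.distrib[symmetric])
qed

lemma cuts_image: "h \<in> H \<Longrightarrow> B \<in> cuts \<Longrightarrow> \<psi> h ` B \<in> cuts"
proof -
  assume h: "h \<in> H" "B \<in> cuts"
  then obtain k where k: "k \<in> H" "B = \<psi> k ` A" by (auto simp: cuts_def)
  have "\<psi> h ` B = \<psi> (h \<otimes> k) ` A" unfolding k image_image
    by (rule image_cong) (use h k HG AM in \<open>auto simp: act_mult\<close>)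
  then show ?thesis unfolding cuts_def using subgroup.m_closed[OF H h(1) k(1)] by blast
qed

lemma act_inv_image: "h \<in> H \<Longrightarrow> B \<in> cuts \<Longrightarrow> \<psi> (inv h) ` \<psi> h ` B = B"
proof -
  assume h: "h \<in> H" "B \<in> cuts"
  have "\<psi> (inv h) (\<psi> h x) = x" if "x \<in> B" for x
    using that cuts_M[OF h(2)] HG[OF h(1)] by (simp add: act_mult[symmetric] subsetD)
  then show ?thesis by (simp add: image_image)
qed

lemma inj_on_cuts: "h \<in> H \<Longrightarrow> inj_on ((`) (\<psi> h)) cuts"
  by (rule inj_on_inverseI[of _ "(`) (\<psi> (inv h))"]) (rule act_inv_image)

lemma inv_H: "h \<in> H \<Longrightarrow> inv h \<in> H"
  using H by (rule subgroup.m_inv_closed)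

lemma card_pos_le:
  assumes "h \<in> H" "x \<in> M" "y \<in> M"
  shows "card (pos x y) \<le> card (pos (\<psi> h x) (\<psi> h y))"
proof (rule card_inj_on_le[of "(`) (\<psi> h)"])
  have hc: "h \<in> carrier G" using HG assms by auto
  have iff: "\<psi> h v \<in> \<psi> h ` B \<longleftrightarrow> v \<in> B" if "v \<in> M" "B \<in> cuts" for v B
    using image_act_iff[OF hc _ cuts_M[OF that(2)], of "\<psi> h v"] that hc by (simp add: act_mult[symmetric])
  show "inj_on ((`) (\<psi> h)) (pos x y)" by (rule inj_on_subset[OF inj_on_cuts[OF assms(1)]]) (auto simp: pos_def)
  show "(`) (\<psi> h) ` pos x y \<subseteq> pos (\<psi> h x) (\<psi> h y)"
    using iff assms cuts_image[OF assms(1)] by (auto simp: pos_def)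
  show "finite (pos (\<psi> h x) (\<psi> h y))" using finite_pos assms hc by simp
qed

lemma card_pos_act:
  assumes "h \<in> H" "x \<in> M" "y \<in> M"
  shows "card (pos (\<psi> h x) (\<psi> h y)) = card (pos x y)"
proof (rule antisym[OF _ card_pos_le[OF assms]])
  have hc: "h \<in> carrier G" using HG assms by auto
  have "\<psi> (inv h) (\<psi> h v) = v" if "v \<in> M" for v using that hc by (simp add: act_mult[symmetric])
  then show "card (pos (\<psi> h x) (\<psi> h y)) \<le> card (pos x y)"
    using card_pos_le[OF inv_H[OF assms(1)], of "\<psi> h x" "\<psi> h y"] assms hc by simp
qed

lemma card_cuts_near_le:
  assumes "h \<in> H" "v \<in> M"
  shows "card (cuts_near (\<psi> h v) r) \<le> card (cuts_near v r)"
proof (rule card_inj_on_le[of "(`) (\<psi> (inv h))"])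
  have hc: "h \<in> carrier G" using HG assms by auto
  have ih: "inv h \<in> H" "inv h \<in> carrier G" using inv_H assms hc by auto
  show "inj_on ((`) (\<psi> (inv h))) (cuts_near (\<psi> h v) r)"
    by (rule inj_on_subset[OF inj_on_cuts[OF ih(1)]]) (auto simp: cuts_near_def)
  show "(`) (\<psi> (inv h)) ` cuts_near (\<psi> h v) r \<subseteq> cuts_near v r"
  proof
    fix B' assume "B' \<in> (`) (\<psi> (inv h)) ` cuts_near (\<psi> h v) r"
    then obtain B y where B: "B' = \<psi> (inv h) ` B" "B \<in> cuts" "y \<in> bd B" "d (\<psi> h v) y \<le> r"
      by (auto simp: cuts_near_def)
    then have yM: "y \<in> M" by (auto simp: bd_def)
    have "\<psi> (inv h) y \<in> bd B'" unfolding B(1) bd_image[OF ih(2) cuts_M[OF B(2)]] using B(3) by blast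
    moreover have "d v (\<psi> (inv h) y) = d (\<psi> h v) y"
      using isom[OF ih(2), of "\<psi> h v" y] assms hc yM by (simp add: act_mult[symmetric])
    ultimately have "\<exists>y\<in>bd B'. d v y \<le> r" using B(4) by force
    then show "B' \<in> cuts_near v r" unfolding cuts_near_def using B(1,2) cuts_image[OF ih(1)] by auto
  qed
  show "finite (cuts_near v r)" by (rule finite_cuts_near[OF assms(2)])
qed

lemma cocycle_act: "h \<in> H \<Longrightarrow> x \<in> M \<Longrightarrow> y \<in> M \<Longrightarrow> cocycle (\<psi> h x) (\<psi> h y) = cocycle x y"
  by (simp add: cocycle_def card_pos_act)

lemma tau_mult: "g \<in> H \<Longrightarrow> h \<in> H \<Longrightarrow> \<tau> (g \<otimes> h) = \<tau> g + \<tau> h"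
  unfolding \<tau>_def using cocycle_add[of x\<^sub>0 "\<psi> g x\<^sub>0" "\<psi> g (\<psi> h x\<^sub>0)"] cocycle_act[of g x\<^sub>0 "\<psi> h x\<^sub>0"] HG
  by (simp add: act_mult)

lemma tau_one: "\<tau> \<one> = 0"
  using tau_mult[of \<one> \<one>] subgroup.one_closed[OF H] by simp

lemma tau_inv: "h \<in> H \<Longrightarrow> \<tau> (inv h) = - \<tau> h"
  using tau_mult[of h "inv h"] inv_H HG tau_one by simp

lemma tau_pow: "h \<in> H \<Longrightarrow> \<tau> (h [^] (n::nat)) = int n * \<tau> h"
proof (induction n)
  case (Suc n)
  have "h [^] n \<in> H" using Suc.prems H by (induction n) (auto intro: subgroup.one_closed subgroup.m_closed)
  then show ?case using Suc tau_mult by (simp add: algebra_simps)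
qed (simp add: tau_one)

text \<open>A cut that is left again before the attracting end passes close to the current point of the axis.\<close>

lemma card_neg_bounded:
  assumes g: "g \<in> H" "axis g D" and ev: "\<And>B. B \<in> cuts \<Longrightarrow> \<exists>N. \<forall>n\<ge>N. E g n \<in> B"
  shows "card (pos (E g n) x\<^sub>0) \<le> card (cuts_near x\<^sub>0 (D + 2 * \<delta> + 2 * \<rho>))"
proof -
  have gc: "g \<in> carrier G" using HG g by auto
  let ?y = "E g n"
  have yM: "?y \<in> M" using E_in gc by auto
  have "pos ?y x\<^sub>0 \<subseteq> cuts_near ?y (D + 2 * \<delta> + 2 * \<rho>)"
  proof
    fix B assume "B \<in> pos ?y x\<^sub>0"
    then have B: "B \<in> cuts" "?y \<notin> B" "x\<^sub>0 \<in> B" by (auto simp: pos_def)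
    obtain N where N: "\<And>m. m \<ge> N \<Longrightarrow> E g m \<in> B" using ev[OF B(1)] by blast
    define m where "m = max N n"
    have m: "m \<ge> n" "E g m \<in> B" using N by (auto simp: m_def)
    have mM: "E g m \<in> M" using E_in gc by auto
    \<comment> \<open>\<open>p\<close> and \<open>q\<close> are coboundary points of the same cut
      before and after the current point, so they are close to each other. As the axis hardly
      backtracks at the current point, both must be close to it.\<close>
    obtain p where p: "p \<in> interval x\<^sub>0 ?y" "p \<in> bd B" using interval_crosses[OF base yM] B by blast
    obtain q where q: "q \<in> interval ?y (E g m)" "q \<in> bd B" using interval_crosses[OF yM mM] B m by blast
    have pq: "p \<in> M" "q \<in> M" "d p q \<le> 2 * \<rho>" using p q bd_diam[OF B(1) p(2) q(2)] by (auto simp: bd_def)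
    have "gp ?y x\<^sub>0 (E g m) = gp x\<^sub>0 (pt g (- int n)) (pt g (int (m - n)))"
      using gp_pt[OF gc, of "int n" 0 "int m"] m by (simp add: E_def of_nat_diff)
    then have ax: "gp ?y x\<^sub>0 (E g m) \<le> D" using g(2) unfolding axis_def by simp
    have gpp: "gp ?y x\<^sub>0 p = d ?y p" using intervalD[OF p(1)] dist_sym[OF pq(1) yM] dist_sym[OF yM base]
      dist_sym[OF base pq(1)] by (simp add: gromov_product_def field_simps)
    have gpq: "gp ?y q (E g m) = d ?y q" using intervalD[OF q(1)] dist_sym[OF pq(2) yM] dist_sym[OF mM yM]
      by (simp add: gromov_product_def field_simps)
    have gppq: "d ?y p - 2 * \<rho> \<le> gp ?y p q" "d ?y p \<le> d ?y q + 2 * \<rho>"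
      using pq tri[OF yM pq(2,1)] dist_sym[OF pq(1,2)] dist_sym[OF yM pq(1)] dist_sym[OF yM pq(2)]
      unfolding gromov_product_def by (auto simp: field_simps)
    have r0: "0 \<le> \<rho>" using pq(3) nonneg[OF pq(1,2)] by simp
    have "d ?y p \<le> D + 2 * \<delta> + 2 * \<rho>"
      using four_point[OF yM base pq(1,2)] four_point[OF yM base pq(2) mM] gpp gpq gppq ax delta r0 by linarith
    then show "B \<in> cuts_near ?y (D + 2 * \<delta> + 2 * \<rho>)" unfolding cuts_near_def using B p by auto
  qed
  then have "card (pos ?y x\<^sub>0) \<le> card (cuts_near ?y (D + 2 * \<delta> + 2 * \<rho>))"
    by (rule card_mono[OF finite_cuts_near[OF yM]])
  \<comment> \<open>By invariance no more cuts are near the current point than near the base point;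
    this makes the bound independent of \<open>n\<close>.\<close>
  also have "\<dots> \<le> card (cuts_near x\<^sub>0 (D + 2 * \<delta> + 2 * \<rho>))"
  proof -
    have "g [^] n \<in> H" using g(1) H by (induction n) (auto intro: subgroup.one_closed subgroup.m_closed)
    then show ?thesis using card_cuts_near_le[of "g [^] n" x\<^sub>0] by (simp add: E_def pt_def int_pow_int)
  qed
  finally show ?thesis .
qed

text \<open>Infinitely many cuts omit the base point but contain a tail of the half-orbit, while at
  most \<open>K\<close> are ever crossed in the wrong direction. So the count is positive for some
  \<open>n\<close>, and it equals \<open>int n * \<tau> g\<close>.\<close>

lemma tau_pos:
  assumes g: "g \<in> H" "axis g D" and ev: "\<And>B. B \<in> cuts \<Longrightarrow> \<exists>N. \<forall>n\<ge>N. E g n \<in> B"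
    and B: "inj B" "range B \<subseteq> cuts" "\<And>j::nat. x\<^sub>0 \<notin> B j"
  shows "0 < \<tau> g"
proof -
  have gc: "g \<in> carrier G" using HG g by auto
  define K where "K = card (cuts_near x\<^sub>0 (D + 2 * \<delta> + 2 * \<rho>))"
  have "\<exists>N. \<forall>j\<le>k. \<forall>n\<ge>N. E g n \<in> B j" for k
  proof (induction k)
    case 0 then show ?case using ev[of "B 0"] B by auto
  next
    case (Suc k)
    then obtain N where N: "\<forall>j\<le>k. \<forall>n\<ge>N. E g n \<in> B j" by blast
    obtain N' where N': "\<forall>n\<ge>N'. E g n \<in> B (Suc k)" using ev[of "B (Suc k)"] B by auto
    show ?case using N N' by (intro exI[of _ "max N N'"]) (auto simp: le_Suc_eq)
  qed
  then obtain n where n: "\<forall>j\<le>K. E g n \<in> B j" by blast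
  have "card (B ` {..K}) \<le> card (pos x\<^sub>0 (E g n))"
    by (rule card_mono[OF finite_pos]) (use n B E_in gc in \<open>auto simp: pos_def\<close>)
  moreover have "card (B ` {..K}) = Suc K" using B(1) by (simp add: card_image inj_on_subset[OF B(1)])
  ultimately have "Suc K \<le> card (pos x\<^sub>0 (E g n))" by simp
  moreover have "card (pos (E g n) x\<^sub>0) \<le> K" unfolding K_def by (rule card_neg_bounded[OF g ev])
  ultimately have "0 < cocycle x\<^sub>0 (E g n)" by (simp add: cocycle_def)
  also have "cocycle x\<^sub>0 (E g n) = int n * \<tau> g"
    using tau_pow[OF g(1), of n] by (simp add: \<tau>_def E_def pt_def int_pow_int)
  finally show ?thesis by (simp add: zero_less_mult_iff)
qed

end

section \<open>Cuts separating the two ends of an axis\<close>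

context proper_quasitree_action
begin

text \<open>\<open>A\<close> is the coarse component, outside a large ball, of the forward
  half-orbit. A path outside the ball to the backward half-orbit would pass close to a point of a
  joining geodesic that is near the base point because of \<open>axis\<close>.\<close>

lemma separating_cut:
  assumes a: "a \<in> carrier G" "lox a"
  obtains A \<rho> n\<^sub>0 where "A \<subseteq> M" "\<And>y. y \<in> bd A \<Longrightarrow> d x\<^sub>0 y \<le> \<rho>" "\<And>n. n \<ge> n\<^sub>0 \<Longrightarrow> E a n \<in> A"
    "\<And>n. n \<ge> n\<^sub>0 \<Longrightarrow> pt a (- int n) \<notin> A"
proof -
  obtain D where D: "axis a D" using lox_axis[OF a] by blast
  obtain \<Delta> where \<Delta>: "0 \<le> \<Delta>" "\<And>x z p. x \<in> M \<Longrightarrow> z \<in> M \<Longrightarrow> p \<in> M \<Longrightarrow>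
      \<exists>m\<in>interval x z. d p m \<le> gp p x z + \<Delta>"
    "\<And>x y m C. x \<in> M \<Longrightarrow> y \<in> M \<Longrightarrow> m \<in> interval x y \<Longrightarrow> C \<subseteq> M \<Longrightarrow> x \<in> C \<Longrightarrow> (x, y) \<in> chain 1 C \<Longrightarrow>
      \<exists>u\<in>C. d u m \<le> \<Delta>"
    using near_geodesic by blast
  \<comment> \<open>One \<open>\<Delta>\<close> for the point of the geodesic near the base point,
    one for the path passing near that point.\<close>
  define R where "R = D + 2 * \<Delta>"
  define U where "U = {y \<in> M. R < d x\<^sub>0 y}"
  have UM: "U \<subseteq> M" by (auto simp: U_def)
  obtain n\<^sub>0 where n0: "\<And>n. n \<ge> n\<^sub>0 \<Longrightarrow> R + d x\<^sub>0 (pt a 1) + 1 \<le> d x\<^sub>0 (pt a (int n))"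
    using lox_filterlim[OF a] unfolding filterlim_at_top eventually_sequentially by blast
  define A where "A = {y \<in> U. (E a n\<^sub>0, y) \<in> chain 1 U}"
  have EU: "E a n \<in> U" if "n \<ge> n\<^sub>0" for n
    using n0[OF that] nonneg[of x\<^sub>0 "pt a 1"] a by (auto simp: U_def E_def)
  have EA: "E a n \<in> A" if "n \<ge> n\<^sub>0" for n
    using that
  proof (induction n rule: dec_induct)
    case base then show ?case using EU chain_refl by (simp add: A_def)
  next
    case (step n)
    have M: "E a n \<in> M" "E a (Suc n) \<in> M" using E_in a by auto
    have l: "d (E a n) (E a (Suc n)) = d x\<^sub>0 (pt a 1)" using d_pt[OF a(1)] by (simp add: E_def)
    \<comment> \<open>\<open>n\<^sub>0\<close> was chosen with the length of one orbit step to
      spare, so the geodesic between consecutive orbit points stays outside the ball.\<close>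
    have "interval (E a n) (E a (Suc n)) \<subseteq> U"
    proof
      fix q assume q: "q \<in> interval (E a n) (E a (Suc n))"
      then have qM: "q \<in> M" "d (E a n) q \<le> d x\<^sub>0 (pt a 1)"
        using intervalD[OF q] l nonneg[of q "E a (Suc n)"] M by auto
      then show "q \<in> U" using n0[of n] step tri[of x\<^sub>0 q "E a n"] dist_sym[of q "E a n"] M unfolding U_def E_def by auto
    qed
    then have "(E a n, E a (Suc n)) \<in> chain 1 U" using chain_mono[OF order_refl _ interval_chain[OF M]] by blast
    moreover have "(E a n\<^sub>0, E a n) \<in> chain 1 U" using step by (simp add: A_def)
    ultimately show ?case using EU[of "Suc n"] step(1) chain_trans[of "E a n\<^sub>0" "E a n"] by (simp add: A_def)
  qed
  have nA: "pt a (- int n) \<notin> A" if "n \<ge> n\<^sub>0" for n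
  proof
    assume "pt a (- int n) \<in> A"
    then have c: "(E a n\<^sub>0, pt a (- int n)) \<in> chain 1 U" by (simp add: A_def)
    have M: "E a n\<^sub>0 \<in> M" "pt a (- int n) \<in> M" using E_in a by auto
    obtain m where m: "m \<in> interval (E a n\<^sub>0) (pt a (- int n))" "d x\<^sub>0 m \<le> gp x\<^sub>0 (E a n\<^sub>0) (pt a (- int n)) + \<Delta>"
      using \<Delta>(2)[OF M base] by blast
    have "gp x\<^sub>0 (E a n\<^sub>0) (pt a (- int n)) \<le> D" using D gp_sym[OF M] by (simp add: axis_def E_def)
    moreover obtain u where u: "u \<in> U" "d u m \<le> \<Delta>" using \<Delta>(3)[OF M m(1) UM EU[OF order_refl] c] by blast
    moreover have "d x\<^sub>0 u \<le> d x\<^sub>0 m + d u m"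
      using tri[of x\<^sub>0 m u] dist_sym[of m u] u UM intervalD[OF m(1)] by auto
    ultimately show False using m(2) by (auto simp: U_def R_def)
  qed
  have bdA: "d x\<^sub>0 y \<le> R + 1" if y: "y \<in> bd A" for y
  proof (rule ccontr)
    assume big: "\<not> d x\<^sub>0 y \<le> R + 1"
    obtain z where z: "y \<in> M" "z \<in> M" "d y z \<le> 1" "(y \<in> A) \<noteq> (z \<in> A)" using y by (auto simp: bd_def)
    have "d x\<^sub>0 y \<le> d x\<^sub>0 z + d y z" using tri[OF base z(2,1)] dist_sym[OF z(1,2)] by simp
    then have "y \<in> U" "z \<in> U" using big z by (auto simp: U_def)
    then have "(y, z) \<in> chain 1 U" "(z, y) \<in> chain 1 U"
      using chain_step z(3) dist_sym[OF z(2,1)] by auto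
    then have "(E a n\<^sub>0, y) \<in> chain 1 U \<longleftrightarrow> (E a n\<^sub>0, z) \<in> chain 1 U"
      using chain_trans[of "E a n\<^sub>0" y 1 U z] chain_trans[of "E a n\<^sub>0" z 1 U y] by blast
    then show False using z(4) \<open>y \<in> U\<close> \<open>z \<in> U\<close> by (simp add: A_def)
  qed
  show ?thesis
  proof (rule that[of A "R + 1" n\<^sub>0])
    show "A \<subseteq> M" using UM by (auto simp: A_def)
  qed (use bdA EA nA in auto)
qed

text \<open>Every translate of \<open>A\<close> under the stabiliser contains a tail of each orbit
  sequence converging to the fixed end, and the powers of \<open>a\<close> supply infinitely many
  different cuts that omit the base point. So \<open>tau_pos\<close> applies to whichever of
  \<open>g\<close> and \<open>inv g\<close> has the fixed end as attracting end.\<close>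

lemma stabilizer_homomorphism:
  assumes a: "a \<in> carrier G" "lox a"
  shows "\<exists>\<tau> :: 'g \<Rightarrow> int. (\<forall>g\<in>end_stabilizer a. \<forall>h\<in>end_stabilizer a. \<tau> (g \<otimes> h) = \<tau> g + \<tau> h) \<and>
    (\<forall>g\<in>end_stabilizer a. \<tau> g = 0 \<longrightarrow> \<not> lox g)"
proof -
  let ?H = "end_stabilizer a"
  obtain A \<rho> n\<^sub>0 where A: "A \<subseteq> M" "\<And>y. y \<in> bd A \<Longrightarrow> d x\<^sub>0 y \<le> \<rho>" "\<And>n. n \<ge> n\<^sub>0 \<Longrightarrow> E a n \<in> A"
    "\<And>n. n \<ge> n\<^sub>0 \<Longrightarrow> pt a (- int n) \<notin> A" by (rule separating_cut[OF a]) (rule that)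
  interpret cut_system G M d \<psi> x\<^sub>0 \<delta> ?H A \<rho>
    by (intro cut_system.intro proper_quasitree_action_axioms cut_system_axioms.intro subgroup_end_stabilizer a A(1,2))
  have aE: "\<psi> a (E a n) = E a (Suc n)" for n
    using pt_shift[OF a(1), of 1 "int n"] a by (simp add: E_def int_pow_1)
  have "rel x\<^sub>0 (\<lambda>n. E a (Suc n)) (E a)"
    using rel_E_refl[OF a] unfolding rel_def by (meson le_Suc_eq le_trans)
  then have aH: "a \<in> ?H" using a by (simp add: end_stabilizer_def aE)
  \<comment> \<open>The shift by \<open>n\<^sub>0\<close> keeps the base point outside all these
    cuts.\<close>
  define B where "B j = \<psi> (a [^] (n\<^sub>0 + j)) ` A" for j
  have powH: "a [^] (n::nat) \<in> ?H" for n using aH H by (induction n) (auto intro: subgroup.one_closed subgroup.m_closed)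
  have memB: "pt a i \<in> \<psi> (a [^] n) ` A \<longleftrightarrow> pt a (i - int n) \<in> A" for i and n :: nat
  proof -
    have "\<psi> (inv (a [^] n)) (pt a i) = pt a (i - int n)"
      using pt_shift[OF a(1), of "- int n" i] a by (simp add: int_pow_neg int_pow_int)
    then show ?thesis using image_act_iff[of "a [^] n" "pt a i" A] a A by simp
  qed
  have injB: "inj B"
  proof (rule linorder_injI)
    fix i j :: nat assume "i < j"
    define k where "k = j - i"
    have k: "k \<ge> 1" using \<open>i < j\<close> by (simp add: k_def)
    show "B i \<noteq> B j"
    proof
      assume eq: "B i = B j"
      \<comment> \<open>Equality of two of the cuts would make the set of orbit points in
        \<open>A\<close> closed under a backward shift, which eventually reaches the backward
        half-orbit.\<close>
      have down: "pt a (l - int k) \<in> A" if "pt a l \<in> A" for l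
      proof -
        have "pt a (l + int (n\<^sub>0 + i)) \<in> B j" unfolding eq[symmetric] unfolding B_def memB using that by simp
        then show ?thesis unfolding B_def memB using \<open>i < j\<close> by (simp add: k_def of_nat_diff algebra_simps)
      qed
      have "pt a (int n\<^sub>0 - int (l * k)) \<in> A" for l
      proof (induction l)
        case 0 then show ?case using A(3)[of n\<^sub>0] by (simp add: E_def)
      next
        case (Suc l)
        have "int n\<^sub>0 - int (Suc l * k) = int n\<^sub>0 - int (l * k) - int k" by (simp add: algebra_simps)
        then show ?case using down[OF Suc] by (simp only:)
      qed
      \<comment> \<open>For \<open>l = 2 * n\<^sub>0\<close> the shifted index is at most
        \<open>- n\<^sub>0\<close>, where no orbit point lies in \<open>A\<close>.\<close>
      moreover have le: "2 * n\<^sub>0 \<le> 2 * n\<^sub>0 * k" using mult_le_mono2[OF k, of "2 * n\<^sub>0"] by simp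
      moreover from le have "int n\<^sub>0 - int (2 * n\<^sub>0 * k) = - int (2 * n\<^sub>0 * k - n\<^sub>0)" by (simp add: of_nat_diff)
      ultimately have "pt a (- int (2 * n\<^sub>0 * k - n\<^sub>0)) \<in> A" "n\<^sub>0 \<le> 2 * n\<^sub>0 * k - n\<^sub>0" by (metis, linarith)
      then show False using A(4) by blast
    qed
  qed
  have rangeB: "range B \<subseteq> cuts" unfolding cuts_def B_def using powH by auto
  have x0B: "x\<^sub>0 \<notin> B j" for j using memB[of 0 "n\<^sub>0 + j"] A(4)[of "n\<^sub>0 + j"] by (simp add: B_def)
  have tau_E: "0 < \<tau> b" if b: "b \<in> ?H" "lox b" "rel x\<^sub>0 (E b) (E a)" for b
  proof -
    have bc: "b \<in> carrier G" using b HG by auto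
    obtain D where D: "axis b D" using lox_axis[OF bc b(2)] by blast
    have ev: "\<exists>N. \<forall>n\<ge>N. E b n \<in> C" if C: "C \<in> cuts" for C
    proof -
      obtain h where h: "h \<in> ?H" "C = \<psi> h ` A" using C by (auto simp: cuts_def)
      have hc: "h \<in> carrier G" using h HG by auto
      have "rel x\<^sub>0 (\<lambda>n. \<psi> h (E a n)) (E a)" using h by (simp add: end_stabilizer_def)
      from rel_trans[OF base _ _ _ this rel_sym[OF _ _ b(3)]]
      have r: "rel x\<^sub>0 (\<lambda>n. \<psi> h (E a n)) (E b)" using translate_E_range[OF hc a(1)] E_range a bc by blast
      \<comment> \<open>Exceeds the distance from the base point to every coboundary point of
        \<open>C\<close>. Two points with a product this large have no geodesic crossing that
        coboundary, so they are on the same side.\<close>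
      define \<sigma> where "\<sigma> = d x\<^sub>0 (\<psi> h x\<^sub>0) + \<rho> + 1"
      have bdC: "d x\<^sub>0 y < \<sigma>" if "y \<in> bd C" for y
      proof -
        from that obtain u where u: "u \<in> bd A" "y = \<psi> h u" unfolding h(2) bd_image[OF hc A(1)] by blast
        then have "u \<in> M" by (simp add: bd_def)
        then show ?thesis using tri[of x\<^sub>0 "\<psi> h x\<^sub>0" "\<psi> h u"] isom[of h x\<^sub>0 u] hc u A(2)[OF u(1)] by (simp add: \<sigma>_def)
      qed
      obtain N where N: "\<And>m n. m \<ge> N \<Longrightarrow> n \<ge> N \<Longrightarrow> \<sigma> \<le> gp x\<^sub>0 (\<psi> h (E a m)) (E b n)"
        using r unfolding rel_def by blast
      have "E b n \<in> C" if n: "n \<ge> N" for n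
      proof (rule ccontr)
        assume nC: "E b n \<notin> C"
        define m where "m = max N n\<^sub>0"
        have mC: "\<psi> h (E a m) \<in> C" unfolding h(2) using A(3)[of m] by (auto simp: m_def)
        have M: "\<psi> h (E a m) \<in> M" "E b n \<in> M" using hc a bc E_in by auto
        obtain u where u: "u \<in> interval (\<psi> h (E a m)) (E b n)" "u \<in> bd C"
          using interval_crosses[OF M] mC nC by blast
        have "gp x\<^sub>0 (\<psi> h (E a m)) (E b n) \<le> d x\<^sub>0 u" by (rule gromov_product_le_interval[OF M base u(1)])
        then show False using N[of m n] n bdC[OF u(2)] by (simp add: m_def)
      qed
      then show ?thesis by blast
    qed
    show ?thesis by (rule tau_pos[OF b(1) D ev injB rangeB x0B])
  qed
  show ?thesis
  proof (intro exI[of _ \<tau>] conjI ballI impI)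
    show "\<tau> (g \<otimes> h) = \<tau> g + \<tau> h" if "g \<in> ?H" "h \<in> ?H" for g h using tau_mult that by blast
    fix g assume g: "g \<in> ?H" "\<tau> g = 0"
    show "\<not> lox g"
    proof
      assume l: "lox g"
      obtain b where b: "b \<in> {g, inv g}" "rel x\<^sub>0 (E b) (E a)" using end_stabilizer_lox[OF a g(1) l] by blast
      then have "0 < \<tau> b" using tau_E[of b] inv_H lox_inv HG g l by auto
      then show False using b tau_inv[OF g(1)] g(2) by auto
    qed
  qed
qed

theorem lineal_homomorphism:
  assumes "\<not> general_type G M d \<psi>"
  shows "\<exists>H. \<exists>\<tau> :: 'g \<Rightarrow> int. finite_index H G \<and> (\<forall>g\<in>H. \<forall>h\<in>H. \<tau> (g \<otimes> h) = \<tau> g + \<tau> h) \<and> (\<forall>g\<in>H. \<tau> g = 0 \<longrightarrow> \<not> lox g)"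
proof (cases "\<exists>g\<in>carrier G. lox g")
  case True
  then obtain g where g: "g \<in> carrier G" "lox g" by blast
  obtain a where a: "a \<in> {g, inv g}" "finite_index (end_stabilizer a) G"
    using finite_index_end_stabilizer[OF g assms] by blast
  then have "a \<in> carrier G" "lox a" using g lox_inv by auto
  from stabilizer_homomorphism[OF this] a(2) show ?thesis by blast
next
  case False
  have "finite_index (carrier G) G"
    by (rule finite_indexI[OF subgroup_self, of "\<lambda>_. ()"]) auto
  then show ?thesis using False by (intro exI[of _ "carrier G"] exI[of _ "\<lambda>_. 0"]) auto
qed

end

section \<open>Characters and virtually abelian groups\<close>

context group
begin

lemma finite_indexD:
  assumes "finite_index H G"
  shows "finite ((\<lambda>x. H #> x) ` carrier G)"
    and "x \<in> carrier G \<Longrightarrow> y \<in> carrier G \<Longrightarrow> H #> x = H #> y \<Longrightarrow> x \<otimes> inv y \<in> H"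
proof -
  have H: "subgroup H G" "finite (rcosets H)" using assms by (auto simp: finite_index_def)
  have "(\<lambda>x. H #> x) ` carrier G = rcosets H" by (auto simp: RCOSETS_def)
  then show "finite ((\<lambda>x. H #> x) ` carrier G)" using H by simp
  show "x \<otimes> inv y \<in> H" if "x \<in> carrier G" "y \<in> carrier G" "H #> x = H #> y"
    using subgroup.rcos_module[OF H(1) is_group that(2,1)] rcos_self[OF that(1) H(1)] that(3) by simp
qed

lemma finite_index_superset:
  assumes "finite_index H G" "subgroup N G" "H \<subseteq> N"
  shows "finite_index N G"
  by (rule finite_indexI[OF assms(2) finite_indexD(1)[OF assms(1)]])
    (use finite_indexD(2)[OF assms(1)] assms(3) in blast)

lemma finite_index_trans:
  assumes H: "finite_index H G" and U: "finite_index U (G\<lparr>carrier := H\<rparr>)"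
  shows "finite_index U G"
proof -
  let ?H = "G\<lparr>carrier := H\<rparr>"
  have sH: "subgroup H G" using H by (simp add: finite_index_def)
  interpret H: group ?H using sH by (rule subgroup_imp_group)
  have sU: "subgroup U ?H" using U by (simp add: finite_index_def)
  have sUG: "subgroup U G" by (rule incl_subgroup[OF sH sU])
  define r where "r v = (SOME x. x \<in> carrier G \<and> H #> x = v)" for v
  have r: "r (H #> x) \<in> carrier G \<and> H #> r (H #> x) = H #> x" if "x \<in> carrier G" for x
    unfolding r_def by (rule someI[of _ x]) (use that in auto)
  \<comment> \<open>The position of \<open>x\<close> within its coset of \<open>H\<close>, relative
    to a chosen representative.\<close>
  define q where "q x = x \<otimes> inv (r (H #> x))" for x
  have q: "q x \<in> H" if "x \<in> carrier G" for x
    unfolding q_def using finite_indexD(2)[OF H that, of "r (H #> x)"] r[OF that] by simp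
  let ?f = "\<lambda>x. (H #> x, U #>\<^bsub>?H\<^esub> q x)"
  show ?thesis
  proof (rule finite_indexI[OF sUG, of ?f])
    have "?f ` carrier G \<subseteq> ((\<lambda>x. H #> x) ` carrier G) \<times> ((\<lambda>x. U #>\<^bsub>?H\<^esub> x) ` carrier ?H)"
      using q by auto
    then show "finite (?f ` carrier G)"
      using finite_indexD(1)[OF H] H.finite_indexD(1)[OF U] by (meson finite_SigmaI finite_subset)
    fix x y assume xy: "x \<in> carrier G" "y \<in> carrier G" "?f x = ?f y"
    let ?r = "r (H #> y)"
    have rc: "?r \<in> carrier G" using r xy by blast
    have "q x \<otimes> inv\<^bsub>?H\<^esub> q y \<in> U" using H.finite_indexD(2)[OF U, of "q x" "q y"] q xy by simp
    moreover have "inv\<^bsub>?H\<^esub> q y = inv (q y)" using m_inv_consistent[OF sH] q xy by simp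
    moreover have "q x \<otimes> inv (q y) = x \<otimes> inv y"
    proof -
      have "inv ?r \<otimes> (?r \<otimes> inv y) = inv y" using rc xy by (simp add: m_assoc[symmetric])
      then show ?thesis unfolding q_def using xy rc by (simp add: inv_mult_group m_assoc)
    qed
    ultimately show "x \<otimes> inv y \<in> U" by simp
  qed
qed

lemma finite_index_INT:
  assumes "\<And>i. i < (k::nat) \<Longrightarrow> finite_index (H i) G"
  shows "finite_index {x \<in> carrier G. \<forall>i<k. x \<in> H i} G"
proof (rule finite_indexI[of _ "\<lambda>x. \<lambda>i\<in>{..<k}. H i #> x"])
  have s: "subgroup (H i) G" if "i < k" for i using assms[OF that] by (simp add: finite_index_def)
  show "subgroup {x \<in> carrier G. \<forall>i<k. x \<in> H i} G"
    by unfold_locales (use s in \<open>auto intro: subgroup.m_closed subgroup.one_closed subgroup.m_inv_closed\<close>)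
  have "(\<lambda>x. \<lambda>i\<in>{..<k}. H i #> x) ` carrier G \<subseteq> (\<Pi>\<^sub>E i\<in>{..<k}. (\<lambda>x. H i #> x) ` carrier G)" by auto
  moreover have "finite (\<Pi>\<^sub>E i\<in>{..<k}. (\<lambda>x. H i #> x) ` carrier G)"
    using finite_indexD(1)[OF assms] by (intro finite_PiE) auto
  ultimately show "finite ((\<lambda>x. \<lambda>i\<in>{..<k}. H i #> x) ` carrier G)" by (rule finite_subset)
  fix x y assume xy: "x \<in> carrier G" "y \<in> carrier G" "(\<lambda>i\<in>{..<k}. H i #> x) = (\<lambda>i\<in>{..<k}. H i #> y)"
  have "H i #> x = H i #> y" if "i < k" for i using fun_cong[OF xy(3), of i] that by simp
  then show "x \<otimes> inv y \<in> {x \<in> carrier G. \<forall>i<k. x \<in> H i}" using finite_indexD(2)[OF assms] xy by simp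
qed

section \<open>Integer-valued characters\<close>

definition additive :: "('a \<Rightarrow> int) \<Rightarrow> bool" where
  "additive \<tau> \<longleftrightarrow> (\<forall>g\<in>carrier G. \<forall>h\<in>carrier G. \<tau> (g \<otimes> h) = \<tau> g + \<tau> h)"

context
  fixes \<tau> assumes t: "additive \<tau>"
begin

lemma additive_mult: "g \<in> carrier G \<Longrightarrow> h \<in> carrier G \<Longrightarrow> \<tau> (g \<otimes> h) = \<tau> g + \<tau> h"
  using t by (simp add: additive_def)

lemma additive_one: "\<tau> \<one> = 0"
  using additive_mult[of \<one> \<one>] by simp

lemma additive_inv: "g \<in> carrier G \<Longrightarrow> \<tau> (inv g) = - \<tau> g"
  using additive_mult[of g "inv g"] additive_one by simp

lemma additive_pow: "g \<in> carrier G \<Longrightarrow> \<tau> (g [^] (n::nat)) = int n * \<tau> g"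
  by (induction n) (simp_all add: additive_one additive_mult algebra_simps)

lemma additive_int_pow: "g \<in> carrier G \<Longrightarrow> \<tau> (g [^] (n::int)) = n * \<tau> g"
  by (cases n rule: int_cases2) (simp_all add: int_pow_int int_pow_neg additive_pow additive_inv)

end

text \<open>A product of powers of the \<open>l i\<close> works for all additive functions at once,
  since these do not see the order of the factors.\<close>

lemma additive_combination:
  assumes l: "\<And>i. i < n \<Longrightarrow> l i \<in> carrier G"
  shows "\<exists>g\<in>carrier G. \<forall>\<tau>. additive \<tau> \<longrightarrow> \<tau> g = (\<Sum>i<(n::nat). c i * \<tau> (l i))"
  using l
proof (induction n)
  case 0 then show ?case using additive_one by (intro bexI[of _ \<one>]) auto
next
  case (Suc n)
  then obtain g where g: "g \<in> carrier G" "\<And>\<tau>. additive \<tau> \<Longrightarrow> \<tau> g = (\<Sum>i<n. c i * \<tau> (l i))" by auto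
  have ln: "l n \<in> carrier G" using Suc by simp
  show ?case using g ln
    by (intro bexI[of _ "g \<otimes> l n [^] c n"]) (auto simp: additive_mult additive_int_pow)
qed

text \<open>
  Subgroups of \<open>\<int>\<^sup>k\<close> are free of rank at most \<open>k\<close>, stated for the image of a homomorphism \<open>\<tau>\<close>.
\<close>

definition character_basis :: "nat \<Rightarrow> (nat \<Rightarrow> 'a \<Rightarrow> int) \<Rightarrow> nat \<Rightarrow> (nat \<Rightarrow> 'a \<Rightarrow> int) \<Rightarrow> bool" where
  "character_basis k \<tau> n \<sigma> \<longleftrightarrow> (\<forall>i<n. additive (\<sigma> i)) \<and> (\<forall>v. \<exists>h\<in>carrier G. \<forall>i<n. \<sigma> i h = v i) \<and>
    (\<forall>h\<in>carrier G. (\<forall>i<n. \<sigma> i h = 0) \<longleftrightarrow> (\<forall>i<k. \<tau> i h = 0))"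

lemma character_basisD:
  assumes "character_basis k \<tau> n \<sigma>"
  shows "i < n \<Longrightarrow> additive (\<sigma> i)" "\<exists>h\<in>carrier G. \<forall>i<n. \<sigma> i h = v i"
    "h \<in> carrier G \<Longrightarrow> (\<forall>i<n. \<sigma> i h = 0) \<longleftrightarrow> (\<forall>i<k. \<tau> i h = 0)"
proof -
  note b = assms[unfolded character_basis_def]
  show "i < n \<Longrightarrow> additive (\<sigma> i)" using conjunct1[OF b] by blast
  show "\<exists>h\<in>carrier G. \<forall>i<n. \<sigma> i h = v i" using conjunct1[OF conjunct2[OF b]] by blast
  show "h \<in> carrier G \<Longrightarrow> (\<forall>i<n. \<sigma> i h = 0) \<longleftrightarrow> (\<forall>i<k. \<tau> i h = 0)"
    using conjunct2[OF conjunct2[OF b]] by (rule bspec)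
qed

text \<open>Let \<open>K\<close> be the common kernel of the characters found so far. If
  \<open>\<tau> k\<close> vanishes on \<open>K\<close>, nothing is added. Otherwise its values on
  \<open>K\<close> are the multiples of some \<open>d > 0\<close>; subtracting a combination of the
  earlier characters makes it divisible by \<open>d\<close> everywhere, and the quotient is the new
  character. It takes the value 1 on an element \<open>c\<close> of \<open>K\<close>, so
  surjectivity is kept.\<close>

lemma independent_characters:
  assumes "\<And>i. i < k \<Longrightarrow> additive (\<tau> i)"
  shows "\<exists>n\<le>k. \<exists>\<sigma>. character_basis k \<tau> n \<sigma>"
  using assms
proof (induction k)
  case 0
  show ?case by (rule exI[of _ 0]) (auto simp: character_basis_def)
next
  case (Suc k)
  then obtain n \<sigma> where n: "n \<le> k" and b: "character_basis k \<tau> n \<sigma>" by (meson less_SucI)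
  note \<sigma> = character_basisD[OF b]
  have tk: "additive (\<tau> k)" using Suc by simp
  define K where "K = {h \<in> carrier G. \<forall>i<n. \<sigma> i h = 0}"
  show ?case
  proof (cases "\<forall>h\<in>K. \<tau> k h = 0")
    case True
    then have "(\<forall>i<n. \<sigma> i h = 0) \<longleftrightarrow> (\<forall>i<Suc k. \<tau> i h = 0)" if "h \<in> carrier G" for h
      using \<sigma>(3)[OF that] that unfolding K_def All_less_Suc by blast
    then have "character_basis (Suc k) \<tau> n \<sigma>" using \<sigma>(1,2) unfolding character_basis_def by blast
    then show ?thesis using n le_SucI by blast
  next
    case False
    then obtain h0 where h0: "h0 \<in> K" "\<tau> k h0 \<noteq> 0" by blast
    have Kinv: "inv h \<in> K" if "h \<in> K" for h using that \<sigma>(1) by (simp add: K_def additive_inv)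
    have h0c: "h0 \<in> carrier G" using h0 by (simp add: K_def)
    \<comment> \<open>\<open>d\<close> will be the least positive value of \<open>\<tau> k\<close>
      on \<open>K\<close>; division with remainder shows that it divides all others.\<close>
    define P where "P m \<longleftrightarrow> m > 0 \<and> (\<exists>h\<in>K. \<tau> k h = int m)" for m
    have "P (nat \<bar>\<tau> k h0\<bar>)"
    proof (cases "\<tau> k h0 > 0")
      case True then show ?thesis using h0 unfolding P_def by auto
    next
      case False then show ?thesis using h0 Kinv[OF h0(1)] additive_inv[OF tk h0c] unfolding P_def
        by (intro conjI bexI[of _ "inv h0"]) auto
    qed
    then have Pm: "P (LEAST m. P m)" by (rule LeastI)
    define m where "m = (LEAST m. P m)"
    define d where "d = int m"
    obtain c where c: "c \<in> K" "\<tau> k c = d" and d: "d > 0" using Pm unfolding d_def m_def P_def by auto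
    have cc: "c \<in> carrier G" using c by (simp add: K_def)
    have dvd: "d dvd \<tau> k h" if h: "h \<in> K" for h
    proof -
      define q where "q = \<tau> k h div d"
      let ?g = "h \<otimes> c [^] (- q)"
      have hc: "h \<in> carrier G" using h by (simp add: K_def)
      have "?g \<in> K" using h c \<sigma>(1) hc cc by (simp add: K_def additive_mult additive_int_pow)
      moreover have "\<tau> k ?g = \<tau> k h mod d" using hc cc c(2)
        by (simp add: additive_mult[OF tk] additive_int_pow[OF tk] q_def minus_div_mult_eq_mod)
      ultimately have "\<tau> k h mod d > 0 \<Longrightarrow> P (nat (\<tau> k h mod d))" unfolding P_def by auto
      moreover have "nat (\<tau> k h mod d) < m" using d unfolding d_def by (simp add: nat_less_iff)
      ultimately have "\<not> \<tau> k h mod d > 0" unfolding m_def by (meson not_less_Least)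
      then have "\<tau> k h mod d = 0" using d pos_mod_sign[of d "\<tau> k h"] by linarith
      then show ?thesis by (rule dvd_eq_mod_eq_0[THEN iffD2])
    qed
    have "\<forall>j. \<exists>h\<in>carrier G. \<forall>i<n. \<sigma> i h = (if i = j then 1 else 0)" by (intro allI \<sigma>(2))
    then obtain l where l: "\<And>j. l j \<in> carrier G" "\<And>i j. i < n \<Longrightarrow> \<sigma> i (l j) = (if i = j then 1 else 0)" by metis
    \<comment> \<open>The value of \<open>\<tau> k\<close> on a product of the dual elements
      \<open>l i\<close> with exponents \<open>\<sigma> i h\<close>; that product differs from
      \<open>h\<close> by an element of \<open>K\<close>.\<close>
    define \<mu> where "\<mu> h = (\<Sum>i<n. \<sigma> i h * \<tau> k (l i))" for h
    have dvd2: "d dvd \<tau> k h - \<mu> h" if h: "h \<in> carrier G" for h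
    proof -
      obtain g where g: "g \<in> carrier G" "\<And>\<tau>'. additive \<tau>' \<Longrightarrow> \<tau>' g = (\<Sum>i<n. \<sigma> i h * \<tau>' (l i))"
        using additive_combination[of n l "\<lambda>i. \<sigma> i h"] l by blast
      have "\<sigma> j g = \<sigma> j h" if "j < n" for j
      proof -
        have "\<sigma> j g = (\<Sum>i<n. \<sigma> i h * (if j = i then 1 else 0))" unfolding g(2)[OF \<sigma>(1)[OF that]]
          by (rule sum.cong) (use l(2)[OF that] in auto)
        also have "\<dots> = (\<Sum>i<n. if j = i then \<sigma> i h else 0)" by (rule sum.cong) auto
        also have "\<dots> = \<sigma> j h" using that by (simp add: sum.delta)
        finally show ?thesis .
      qed
      then have "h \<otimes> inv g \<in> K" using \<sigma>(1) h g by (simp add: K_def additive_mult additive_inv)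
      moreover have "\<tau> k (h \<otimes> inv g) = \<tau> k h - \<mu> h"
        using h g(1) g(2)[OF tk] by (simp add: additive_mult[OF tk] additive_inv[OF tk] \<mu>_def)
      ultimately show ?thesis using dvd by metis
    qed
    have mu_add: "\<mu> (g \<otimes> h) = \<mu> g + \<mu> h" if "g \<in> carrier G" "h \<in> carrier G" for g h
      unfolding \<mu>_def sum.distrib[symmetric] by (rule sum.cong) (use \<sigma>(1) that in \<open>auto simp: additive_mult algebra_simps\<close>)
    define s where "s h = (\<tau> k h - \<mu> h) div d" for h
    have s: "\<tau> k h - \<mu> h = d * s h" if "h \<in> carrier G" for h using dvd2[OF that] by (simp add: s_def)
    have s_add: "additive s" unfolding additive_def
    proof (intro ballI)
      fix g h assume gh: "g \<in> carrier G" "h \<in> carrier G"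
      have "d * s (g \<otimes> h) = d * (s g + s h)"
        using s[OF gh(1)] s[OF gh(2)] s[of "g \<otimes> h"] gh mu_add[OF gh] additive_mult[OF tk gh] by (simp add: algebra_simps)
      then show "s (g \<otimes> h) = s g + s h" using d by simp
    qed
    have mu0: "\<mu> h = 0" if "h \<in> K" for h using that by (auto simp: \<mu>_def K_def)
    have sc: "s c = 1" using mu0[OF c(1)] c(2) d by (simp add: s_def)
    define \<sigma>' where "\<sigma>' = \<sigma>(n := s)"
    have "\<exists>h\<in>carrier G. \<forall>i<Suc n. \<sigma>' i h = v i" for v
    proof -
      obtain h where h: "h \<in> carrier G" "\<forall>i<n. \<sigma> i h = v i" using \<sigma>(2) by blast
      \<comment> \<open>The old characters vanish on \<open>c\<close>, so this correction affects
        only the new coordinate.\<close>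
      let ?g = "h \<otimes> c [^] (v n - s h)"
      have "\<sigma> i ?g = v i" if "i < n" for i
        using h c cc \<sigma>(1)[OF that] that by (simp add: additive_mult additive_int_pow K_def)
      moreover have "s ?g = v n" using h cc sc by (simp add: additive_mult[OF s_add] additive_int_pow[OF s_add])
      ultimately show ?thesis using h cc by (intro bexI[of _ ?g]) (auto simp: \<sigma>'_def less_Suc_eq)
    qed
    moreover have "additive (\<sigma>' i)" if "i < Suc n" for i using that \<sigma>(1) s_add by (auto simp: \<sigma>'_def less_Suc_eq)
    moreover have "(\<forall>i<Suc n. \<sigma>' i h = 0) \<longleftrightarrow> (\<forall>i<Suc k. \<tau> i h = 0)" if h: "h \<in> carrier G" for h
    proof -
      have "(\<forall>i<Suc n. \<sigma>' i h = 0) \<longleftrightarrow> s h = 0 \<and> (\<forall>i<n. \<sigma> i h = 0)" by (simp add: \<sigma>'_def All_less_Suc)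
      also have "\<dots> \<longleftrightarrow> \<tau> k h = 0 \<and> (\<forall>i<n. \<sigma> i h = 0)"
        using mu0[of h] s[OF h] d h by (auto simp: K_def)
      finally show ?thesis using \<sigma>(3)[OF h] by (simp add: All_less_Suc)
    qed
    ultimately have "character_basis (Suc k) \<tau> (Suc n) \<sigma>'" unfolding character_basis_def by blast
    then show ?thesis using n Suc_le_mono by blast
  qed
qed

lemma characters_quotient:
  assumes "\<And>i. i < k \<Longrightarrow> additive (\<tau> i)"
  shows "\<exists>n\<le>k. G Mod {h \<in> carrier G. \<forall>i<(k::nat). \<tau> i h = 0} \<cong> Zn n"
    and "{h \<in> carrier G. \<forall>i<k. \<tau> i h = 0} \<lhd> G"
    and "{h \<in> carrier G. \<forall>i<k. \<tau> i h = 0} = {\<one>} \<Longrightarrow> \<exists>n. G \<cong> Zn n"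
proof -
  obtain n \<sigma> where n: "n \<le> k" and b: "character_basis k \<tau> n \<sigma>"
    using independent_characters[of k \<tau>, OF assms] by blast
  note \<sigma> = character_basisD[OF b]
  define \<Phi> where "\<Phi> h = (\<lambda>i\<in>{..<n}. \<sigma> i h)" for h
  have Zn: "group (Zn n)" by simp
  interpret group_hom G "Zn n" \<Phi>
  proof (intro group_hom.intro group_hom_axioms.intro is_group Zn homI)
    fix x y assume xy: "x \<in> carrier G" "y \<in> carrier G"
    show "\<Phi> (x \<otimes> y) = \<Phi> x \<otimes>\<^bsub>Zn n\<^esub> \<Phi> y"
      using xy \<sigma>(1) by (auto simp: \<Phi>_def additive_mult)
  qed (auto simp: \<Phi>_def)
  have ker: "kernel G (Zn n) \<Phi> = {h \<in> carrier G. \<forall>i<k. \<tau> i h = 0}"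
  proof -
    have "\<Phi> h = \<one>\<^bsub>Zn n\<^esub> \<longleftrightarrow> (\<forall>i<n. \<sigma> i h = 0)" for h
      unfolding \<Phi>_def by (auto simp: fun_eq_iff restrict_def split: if_splits)
    then show ?thesis unfolding kernel_def using \<sigma>(3) by auto
  qed
  have "\<Phi> ` carrier G = carrier (Zn n)"
  proof
    show "\<Phi> ` carrier G \<subseteq> carrier (Zn n)" by (auto simp: \<Phi>_def)
    show "carrier (Zn n) \<subseteq> \<Phi> ` carrier G"
    proof
      fix v assume v: "v \<in> carrier (Zn n)"
      obtain h where h: "h \<in> carrier G" "\<forall>i<n. \<sigma> i h = v i" using \<sigma>(2) by blast
      have "v = \<Phi> h" using v h unfolding \<Phi>_def by (auto simp: PiE_def extensional_def restrict_def fun_eq_iff)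
      then show "v \<in> \<Phi> ` carrier G" using h by blast
    qed
  qed
  note surj = this
  show "\<exists>n\<le>k. G Mod {h \<in> carrier G. \<forall>i<k. \<tau> i h = 0} \<cong> Zn n"
    using FactGroup_iso[OF surj] n ker by auto
  show "{h \<in> carrier G. \<forall>i<k. \<tau> i h = 0} \<lhd> G" using normal_kernel ker by simp
  show "\<exists>n. G \<cong> Zn n" if "{h \<in> carrier G. \<forall>i<k. \<tau> i h = 0} = {\<one>}"
  proof -
    have "\<Phi> \<in> iso G (Zn n)"
      using that ker surj trivial_ker_imp_inj homh by (auto simp: iso_def bij_betw_def)
    then show ?thesis by (auto simp: is_iso_def)
  qed
qed

end

section \<open>Central powers and finite kernels\<close>

lemma (in group) commute_pow:
  assumes xy: "x \<in> carrier G" "y \<in> carrier G" and c: "x \<otimes> y = y \<otimes> x"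
  shows "x [^] (n::nat) \<otimes> y = y \<otimes> x [^] n"
proof (induction n)
  case (Suc n)
  have "x [^] n \<otimes> x \<otimes> y = x [^] n \<otimes> y \<otimes> x" using xy c by (simp add: m_assoc)
  also have "\<dots> = y \<otimes> (x [^] n \<otimes> x)" using Suc xy by (simp add: m_assoc)
  finally show ?case by simp
qed (use xy in simp)

text \<open>Conjugation by \<open>x\<close> permutes the finitely many elements of the coset \<open>K y\<close>.\<close>

lemma (in group) fact_power_central:
  assumes K: "finite K" and comm: "\<And>x y. x \<in> carrier G \<Longrightarrow> y \<in> carrier G \<Longrightarrow> x \<otimes> y \<otimes> inv x \<otimes> inv y \<in> K"
    and xy: "x \<in> carrier G" "y \<in> carrier G"
  shows "x [^] (fact (card K) :: nat) \<otimes> y = y \<otimes> x [^] (fact (card K) :: nat)"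
proof -
  \<comment> \<open>Pigeonhole on \<open>card K + 1\<close> exponents with commutators in
    \<open>K\<close>.\<close>
  let ?f = "\<lambda>j::nat. x [^] j \<otimes> y \<otimes> inv (x [^] j) \<otimes> inv y"
  have "?f ` {..card K} \<subseteq> K" using comm xy by auto
  then have "card (?f ` {..card K}) \<le> card K" using K card_mono by blast
  then have "\<not> inj_on ?f {..card K}" using card_image[of ?f "{..card K}"] by fastforce
  then obtain a' b' where "a' \<in> {..card K}" "b' \<in> {..card K}" "?f a' = ?f b'" "a' \<noteq> b'"
    unfolding inj_on_def by blast
  then have ab': "min a' b' \<le> card K" "max a' b' \<le> card K" "min a' b' < max a' b'" "?f (min a' b') = ?f (max a' b')"
    by (auto simp: min_def max_def)
  define a b where "a = min a' b'" and "b = max a' b'"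
  note ab = ab'[folded a_def b_def]
  let ?u = "x [^] a" and ?p = "x [^] (b - a)"
  have c: "?u \<in> carrier G" "?p \<in> carrier G" "x [^] b = ?u \<otimes> ?p" using ab(3) xy by (auto simp: nat_pow_mult)
  \<comment> \<open>Conjugating \<open>y\<close> by the two powers gives the same result, so their
    quotient \<open>?p\<close> commutes with \<open>y\<close>. Its exponent \<open>b - a\<close>
    divides the factorial because it is at most \<open>card K\<close>.\<close>
  have "?u \<otimes> y \<otimes> inv ?u = ?u \<otimes> ?p \<otimes> y \<otimes> inv (?u \<otimes> ?p)" using ab(4) c xy by simp
  then have "?u \<otimes> (y \<otimes> inv ?u) = ?u \<otimes> (?p \<otimes> y \<otimes> inv ?p \<otimes> inv ?u)" using c xy by (simp add: inv_mult_group m_assoc)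
  then have "y \<otimes> inv ?u = ?p \<otimes> y \<otimes> inv ?p \<otimes> inv ?u" using c xy by simp
  then have "y = ?p \<otimes> y \<otimes> inv ?p" using c xy by simp
  then have "y \<otimes> ?p = ?p \<otimes> y \<otimes> inv ?p \<otimes> ?p" by simp
  then have "?p \<otimes> y = y \<otimes> ?p" using c xy by (simp add: m_assoc)
  moreover have "b - a dvd fact (card K)" using ab by (intro dvd_fact) auto
  then obtain q where "fact (card K) = (b - a) * q" by blast
  ultimately show ?thesis using commute_pow[OF c(2) xy(2), of q] xy by (simp add: nat_pow_pow)
qed

text \<open>\<open>U\<close> consists of the \<open>card K\<close>-th powers of central elements. If
  such a power of \<open>x\<close> lies in \<open>K\<close>, then so does \<open>x\<close>, because
  its character values vanish, and the power is trivial; so the characters embed \<open>U\<close>.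
  The index is finite because high powers are central and \<open>K\<close> is finite.\<close>

lemma (in group) virtually_Zn_of_finite_kernel:
  assumes \<tau>: "\<And>i. i < (k::nat) \<Longrightarrow> additive (\<tau> i)" and K: "finite {h \<in> carrier G. \<forall>i<k. \<tau> i h = 0}"
  shows "\<exists>n. virtually_Zn G n"
proof -
  define K where "K = {h \<in> carrier G. \<forall>i<k. \<tau> i h = 0}"
  obtain n \<sigma> where b: "character_basis k \<tau> n \<sigma>"
    using independent_characters[of k \<tau>, OF \<tau>] by blast
  note \<sigma> = character_basisD[OF b]
  have finK: "finite K" using assms(2) by (simp add: K_def)
  have Kiff: "x \<in> K \<longleftrightarrow> x \<in> carrier G \<and> (\<forall>i<n. \<sigma> i x = 0)" for x using \<sigma>(3) by (auto simp: K_def)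
  have subK: "subgroup K G"
    by unfold_locales (use \<sigma>(1) in \<open>auto simp: Kiff additive_mult additive_one additive_inv\<close>)
  have K0: "0 < card K" using subgroup.one_closed[OF subK] finK by (auto simp: card_gt_0_iff)
  have powK: "x [^] card K = \<one>" if "x \<in> K" for x
  proof -
    interpret KG: group "G\<lparr>carrier := K\<rparr>" using subgroup_imp_group[OF subK] .
    have "x [^]\<^bsub>G\<lparr>carrier := K\<rparr>\<^esub> card K = \<one>"
      using KG.pow_order_eq_1[of x] that by (simp add: order_def)
    then show ?thesis by (simp add: nat_pow_consistent[symmetric])
  qed
  define N :: nat where "N = fact (card K)"
  have cent: "x [^] N \<otimes> y = y \<otimes> x [^] N" if "x \<in> carrier G" "y \<in> carrier G" for x y
    unfolding N_def by (rule fact_power_central[OF finK _ that])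
      (use \<sigma>(1) in \<open>auto simp: Kiff additive_mult additive_inv\<close>)
  define Z where "Z = {x \<in> carrier G. \<forall>y\<in>carrier G. x \<otimes> y = y \<otimes> x}"
  define M where "M = card K"
  define U where "U = (\<lambda>x. x [^] M) ` Z"
  have Zc: "x \<in> carrier G" if "x \<in> Z" for x using that by (simp add: Z_def)
  have Zcomm: "x \<otimes> y = y \<otimes> x" if "x \<in> Z" "y \<in> carrier G" for x y using that by (simp add: Z_def)
  have Zm: "x \<otimes> y \<in> Z" if xy: "x \<in> Z" "y \<in> Z" for x y
  proof -
    note c = Zc[OF xy(1)] Zc[OF xy(2)]
    have "x \<otimes> y \<otimes> z = z \<otimes> (x \<otimes> y)" if z: "z \<in> carrier G" for z
    proof -
      have "x \<otimes> y \<otimes> z = x \<otimes> (z \<otimes> y)" using Zcomm[OF xy(2) z] c z by (simp only: m_assoc)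
      also have "\<dots> = z \<otimes> x \<otimes> y" using Zcomm[OF xy(1) z] c z by (simp only: m_assoc[symmetric])
      also have "\<dots> = z \<otimes> (x \<otimes> y)" using c z by (simp only: m_assoc)
      finally show ?thesis .
    qed
    then show ?thesis using c by (simp add: Z_def)
  qed
  have Zi: "inv x \<in> Z" if x: "x \<in> Z" for x
  proof -
    note c = Zc[OF x]
    have "inv x \<otimes> z = z \<otimes> inv x" if z: "z \<in> carrier G" for z
    proof -
      have "inv x \<otimes> z = inv x \<otimes> (z \<otimes> x) \<otimes> inv x" using c z by (simp add: m_assoc)
      also have "\<dots> = inv x \<otimes> (x \<otimes> z) \<otimes> inv x" by (simp only: Zcomm[OF x z])
      also have "\<dots> = z \<otimes> inv x" using c z by (simp add: m_assoc[symmetric])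
      finally show ?thesis .
    qed
    then show ?thesis using c by (simp add: Z_def)
  qed
  have powM: "(x \<otimes> y) [^] (m::nat) = x [^] m \<otimes> y [^] m" if "x \<in> Z" "y \<in> Z" for x y m
    using Zcomm[OF that(1) Zc[OF that(2)]] Zc[OF that(1)] Zc[OF that(2)] by (rule pow_mult_distrib)
  have UZ: "u \<in> Z" if u: "u \<in> U" for u
  proof -
    obtain x where x: "x \<in> Z" "u = x [^] M" using u by (auto simp: U_def)
    have "u \<otimes> y = y \<otimes> u" if "y \<in> carrier G" for y
      unfolding x(2) by (rule commute_pow[OF Zc[OF x(1)] that Zcomm[OF x(1) that]])
    moreover have "u \<in> carrier G" using x Zc by simp
    ultimately show ?thesis unfolding Z_def by blast
  qed
  have one: "\<one> \<in> Z" by (auto simp: Z_def)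
  have subU: "subgroup U G"
  proof
    show "U \<subseteq> carrier G" using UZ Zc by auto
    show "\<one> \<in> U" unfolding U_def using one by (auto intro!: image_eqI[of _ _ \<one>])
    show "u \<otimes> v \<in> U" if uv: "u \<in> U" "v \<in> U" for u v
    proof -
      obtain x y where xy: "x \<in> Z" "u = x [^] M" "y \<in> Z" "v = y [^] M" using uv by (auto simp: U_def)
      then have "u \<otimes> v = (x \<otimes> y) [^] M" using powM by simp
      then show ?thesis unfolding U_def using Zm xy by blast
    qed
    show "inv u \<in> U" if u: "u \<in> U" for u
    proof -
      obtain x where x: "x \<in> Z" "u = x [^] M" using u by (auto simp: U_def)
      then have "inv u = inv x [^] M" using Zc by (simp add: nat_pow_inv)
      then show ?thesis unfolding U_def using Zi x by blast
    qed
  qed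
  \<comment> \<open>\<open>N\<close>-th powers are central, and \<open>M\<close>-th powers of
    central elements lie in \<open>U\<close>; so every vector of multiples of \<open>L\<close> is
    attained by the characters on \<open>U\<close>.\<close>
  define L where "L = int (N * M)"
  have L: "L > 0" unfolding L_def N_def M_def using K0 by simp
  define r where "r x = (\<lambda>i\<in>{..<n}. \<sigma> i x mod L)" for x
  define rep where "rep v = (SOME x. x \<in> carrier G \<and> r x = v)" for v
  have rep: "rep (r x) \<in> carrier G \<and> r (rep (r x)) = r x" if "x \<in> carrier G" for x
    unfolding rep_def by (rule someI[of _ x]) (use that in auto)
  \<comment> \<open>Elements with equal residues modulo \<open>L\<close> differ by an element of
    \<open>U\<close> up to the finite group \<open>K\<close>.\<close>
  have KU: "\<exists>\<kappa>\<in>K. inv \<kappa> \<otimes> (x \<otimes> inv y) \<in> U" if xy: "x \<in> carrier G" "y \<in> carrier G" "r x = r y" for x y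
  proof -
    have "L dvd \<sigma> i (x \<otimes> inv y)" if "i < n" for i
    proof -
      have "\<sigma> i x mod L = \<sigma> i y mod L" using fun_cong[OF xy(3), of i] that by (simp add: r_def)
      then show ?thesis using that xy \<sigma>(1)[OF that] by (simp add: additive_mult additive_inv mod_eq_dvd_iff)
    qed
    then have w: "\<sigma> i (x \<otimes> inv y) = L * (\<sigma> i (x \<otimes> inv y) div L)" if "i < n" for i using that by simp
    obtain g where g: "g \<in> carrier G" "\<forall>i<n. \<sigma> i g = \<sigma> i (x \<otimes> inv y) div L"
      using \<sigma>(2)[of "\<lambda>i. \<sigma> i (x \<otimes> inv y) div L"] by blast
    let ?u = "(g [^] N) [^] M"
    have "g [^] N \<in> Z" unfolding Z_def using g(1) cent by blast
    then have uU: "?u \<in> U" unfolding U_def by blast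
    have uc: "?u \<in> carrier G" using g by simp
    let ?k = "(x \<otimes> inv y) \<otimes> inv ?u"
    have "\<sigma> i ?k = 0" if "i < n" for i
      using w[OF that] g(2) that \<sigma>(1)[OF that] uc g(1) xy by (simp add: additive_mult additive_inv additive_pow L_def algebra_simps)
    then have "?k \<in> K" using xy uc by (simp add: Kiff)
    moreover have "inv ?k \<otimes> (x \<otimes> inv y) = ?u"
    proof -
      have "inv (t \<otimes> inv ?u) \<otimes> t = ?u" if "t \<in> carrier G" for t
        using that uc by (simp add: inv_mult_group m_assoc)
      then show ?thesis using xy by simp
    qed
    ultimately show ?thesis using uU by (metis (no_types, lifting))
  qed
  define \<kappa> where "\<kappa> x = (SOME k. k \<in> K \<and> inv k \<otimes> (x \<otimes> inv (rep (r x))) \<in> U)" for x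
  have \<kappa>: "\<kappa> x \<in> K \<and> inv (\<kappa> x) \<otimes> (x \<otimes> inv (rep (r x))) \<in> U" if "x \<in> carrier G" for x
    unfolding \<kappa>_def by (rule someI_ex) (use KU[of x "rep (r x)"] rep[OF that] that in auto)
  have fiU: "finite_index U G"
  proof (rule finite_indexI[OF subU, of "\<lambda>x. (r x, \<kappa> x)"])
    have "(\<lambda>x. (r x, \<kappa> x)) ` carrier G \<subseteq> (\<Pi>\<^sub>E i\<in>{..<n}. {0..<L}) \<times> K"
    proof (rule image_subsetI)
      fix x assume "x \<in> carrier G"
      then have "\<kappa> x \<in> K" using \<kappa> by blast
      moreover have "r x \<in> (\<Pi>\<^sub>E i\<in>{..<n}. {0..<L})" using L by (simp add: r_def)
      ultimately show "(r x, \<kappa> x) \<in> (\<Pi>\<^sub>E i\<in>{..<n}. {0..<L}) \<times> K" by blast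
    qed
    moreover have "finite ((\<Pi>\<^sub>E i\<in>{..<n}. {0..<L}) \<times> K)" using finK by (intro finite_cartesian_product finite_PiE) auto
    ultimately show "finite ((\<lambda>x. (r x, \<kappa> x)) ` carrier G)" by (rule finite_subset)
    fix x y assume xy: "x \<in> carrier G" "y \<in> carrier G" "(r x, \<kappa> x) = (r y, \<kappa> y)"
    let ?k = "\<kappa> y" and ?r = "rep (r y)"
    have c: "?k \<in> carrier G" "?r \<in> carrier G" using \<kappa>[OF xy(2)] rep[OF xy(2)] by (auto simp: Kiff)
    define u where "u = inv ?k \<otimes> (x \<otimes> inv ?r)"
    define v where "v = inv ?k \<otimes> (y \<otimes> inv ?r)"
    have uv: "u \<in> U" "v \<in> U" using \<kappa>[OF xy(1)] \<kappa>[OF xy(2)] xy(3) by (auto simp: u_def v_def)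
    have uvc: "u \<in> carrier G" "v \<in> carrier G" using uv UZ Zc by auto
    have canc: "?k \<otimes> (inv ?k \<otimes> z) = z" if "z \<in> carrier G" for z using that c by (simp add: m_assoc[symmetric])
    have "x = ?k \<otimes> u \<otimes> ?r" "y = ?k \<otimes> v \<otimes> ?r" unfolding u_def v_def using xy c canc by (simp_all add: m_assoc)
    moreover have "?k \<otimes> u = u \<otimes> ?k" "?k \<otimes> v = v \<otimes> ?k" using Zcomm[OF UZ[OF uv(1)] c(1)] Zcomm[OF UZ[OF uv(2)] c(1)] by simp_all
    ultimately have "x = u \<otimes> (?k \<otimes> ?r)" "y = v \<otimes> (?k \<otimes> ?r)" using c uvc m_assoc by metis+
    moreover have "u \<otimes> t \<otimes> inv (v \<otimes> t) = u \<otimes> inv v" if t: "t \<in> carrier G" for t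
    proof -
      have "t \<otimes> (inv t \<otimes> inv v) = inv v" using t uvc by (simp add: m_assoc[symmetric])
      then show ?thesis using t uvc by (simp add: inv_mult_group m_assoc)
    qed
    ultimately have "x \<otimes> inv y = u \<otimes> inv v" using c by (metis m_closed)
    then show "x \<otimes> inv y \<in> U" using uv subU by (auto intro: subgroup.m_closed subgroup.m_inv_closed)
  qed
  interpret UG: group "G\<lparr>carrier := U\<rparr>" using subgroup_imp_group[OF subU] .
  have addU: "UG.additive (\<sigma> i)" if "i < n" for i
    using additive_mult[OF \<sigma>(1)[OF that]] UZ Zc by (auto simp: UG.additive_def)
  have "{h \<in> carrier (G\<lparr>carrier := U\<rparr>). \<forall>i<n. \<sigma> i h = 0} = {\<one>\<^bsub>G\<lparr>carrier := U\<rparr>\<^esub>}"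
  proof -
    have "u = \<one>" if u: "u \<in> U" "\<forall>i<n. \<sigma> i u = 0" for u
    proof -
      obtain x where x: "x \<in> Z" "u = x [^] M" using u by (auto simp: U_def)
      have "\<sigma> i x = 0" if "i < n" for i
        using u(2) x Zc[OF x(1)] additive_pow[OF \<sigma>(1)[OF that]] that K0 by (auto simp: M_def)
      then show ?thesis using x Zc powK by (simp add: Kiff M_def)
    qed
    moreover have "\<sigma> i \<one> = 0" if "i < n" for i using additive_one[OF \<sigma>(1)[OF that]] .
    ultimately have "u \<in> U \<and> (\<forall>i<n. \<sigma> i u = 0) \<longleftrightarrow> u = \<one>" for u using subgroup.one_closed[OF subU] by metis
    then show ?thesis by simp
  qed
  from UG.characters_quotient(3)[OF addU this] obtain m where "G\<lparr>carrier := U\<rparr> \<cong> Zn m" by blast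
  then show ?thesis unfolding virtually_Zn_def using fiU by blast
qed

lemma (in group) contains_F2_subgroup:
  assumes "subgroup H G" "contains_F2 (G\<lparr>carrier := H\<rparr>)"
  shows "contains_F2 G"
  using assms incl_subgroup unfolding contains_F2_def by fastforce

lemma (in group) virtually_Zn_finite_index:
  assumes "finite_index H G" "virtually_Zn (G\<lparr>carrier := H\<rparr>) n"
  shows "virtually_Zn G n"
  using assms finite_index_trans unfolding virtually_Zn_def by fastforce

lemma (in group) finite_index_normalizer:
  assumes H: "finite_index H G" and K: "K \<lhd> G\<lparr>carrier := H\<rparr>"
  shows "finite_index (normalizer G K) G"
proof (rule finite_index_superset[OF H])
  have sH: "subgroup H G" using H by (simp add: finite_index_def)
  interpret K: normal K "G\<lparr>carrier := H\<rparr>" by fact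
  have KG: "subgroup K G" by (rule incl_subgroup[OF sH K.subgroup_axioms])
  then have KGs: "K \<subseteq> carrier G" by (rule subgroup.subset)
  show "subgroup (normalizer G K) G" by (rule normalizer_imp_subgroup[OF KGs])
  show "H \<subseteq> normalizer G K"
  proof
    fix h assume h: "h \<in> H"
    have hc: "h \<in> carrier G" using subgroup.mem_carrier[OF sH h] .
    have "h <# K = K #> h" using K.coset_eq h by simp
    then have "h <# K #> inv h = K #> h #> inv h" by simp
    also have "\<dots> = K" using KGs hc by (simp add: coset_mult_assoc)
    finally show "h \<in> normalizer G K" using hc KGs by (simp add: normalizer_def stabilizer_def)
  qed
qed

section \<open>Automorphisms of products of graphs\<close>

lemma (in group) group_actionI:
  assumes maps: "\<And>g x. g \<in> carrier G \<Longrightarrow> x \<in> S \<Longrightarrow> \<psi> g x \<in> S"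
    and ext: "\<And>g. g \<in> carrier G \<Longrightarrow> \<psi> g \<in> extensional S"
    and one: "\<And>x. x \<in> S \<Longrightarrow> \<psi> \<one> x = x"
    and mult: "\<And>g h x. g \<in> carrier G \<Longrightarrow> h \<in> carrier G \<Longrightarrow> x \<in> S \<Longrightarrow> \<psi> (g \<otimes> h) x = \<psi> g (\<psi> h x)"
  shows "group_action G S \<psi>"
proof -
  have inv: "\<psi> (inv g) (\<psi> g x) = x" "\<psi> g (\<psi> (inv g) x) = x" if "g \<in> carrier G" "x \<in> S" for g x
    using that by (simp_all add: mult[symmetric] one)
  have bij: "\<psi> g \<in> Bij S" if g: "g \<in> carrier G" for g
    unfolding Bij_def using ext[OF g] g maps inv[OF g]
    by (auto intro!: bij_betw_byWitness[of _ "\<psi> (inv g)"])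
  have "\<psi> \<in> hom G (BijGroup S)"
  proof (rule homI)
    show "\<psi> g \<in> carrier (BijGroup S)" if "g \<in> carrier G" for g using bij[OF that] by (simp add: BijGroup_def)
    show "\<psi> (g \<otimes> h) = \<psi> g \<otimes>\<^bsub>BijGroup S\<^esub> \<psi> h" if gh: "g \<in> carrier G" "h \<in> carrier G" for g h
    proof -
      have "\<psi> (g \<otimes> h) = compose S (\<psi> g) (\<psi> h)"
        by (rule extensionalityI[of _ S]) (use ext gh mult in \<open>auto simp: compose_def\<close>)
      then show ?thesis using bij gh by (simp add: BijGroup_def)
    qed
  qed
  then show ?thesis
    by (intro group_action.intro group_hom.intro group_hom_axioms.intro is_group group_BijGroup)
qed

locale graph_product =
  fixes k :: nat and Q :: "nat \<Rightarrow> 'a graph"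
  assumes wf: "\<And>i. i < k \<Longrightarrow> wf_graph (Q i)" and conn: "\<And>i. i < k \<Longrightarrow> connected_graph (Q i)"
begin

abbreviation "C \<equiv> prod_cells k Q"
abbreviation "F \<equiv> prod_face k Q"

text \<open>Its cardinality is the dimension of the cell.\<close>

definition type :: "(nat \<Rightarrow> 'a) \<Rightarrow> nat set" where
  "type c = {i. i < k \<and> c i \<in> edges (Q i)}"

lemma cell_cases: "c \<in> C \<Longrightarrow> i < k \<Longrightarrow> i \<notin> type c \<Longrightarrow> c i \<in> verts (Q i)"
  by (auto simp: prod_cells_def cells_def type_def PiE_def)

lemma verts_edges_disjoint: "i < k \<Longrightarrow> v \<in> verts (Q i) \<Longrightarrow> v \<notin> edges (Q i)"
  using wf[of i] by (auto simp: wf_graph_def)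

lemma ends_verts: "i < k \<Longrightarrow> e \<in> edges (Q i) \<Longrightarrow> v \<in> ends (Q i) e \<Longrightarrow> v \<in> verts (Q i)"
  using wf[of i] by (auto simp: wf_graph_def)

lemma ends_nonempty: "i < k \<Longrightarrow> e \<in> edges (Q i) \<Longrightarrow> \<exists>v. v \<in> ends (Q i) e"
  using wf[of i] unfolding wf_graph_def by (metis all_not_in_conv card.empty insert_iff singletonD zero_neq_numeral zero_neq_one)

lemma cell_upd: "c \<in> C \<Longrightarrow> i < k \<Longrightarrow> v \<in> cells (Q i) \<Longrightarrow> c(i := v) \<in> C"
  by (auto simp: prod_cells_def PiE_def extensional_def)

lemma cell_eqI: "c \<in> C \<Longrightarrow> c' \<in> C \<Longrightarrow> (\<And>i. i < k \<Longrightarrow> c i = c' i) \<Longrightarrow> c = c'"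
  unfolding prod_cells_def by (rule PiE_ext) auto

lemma F_upd: "i < k \<Longrightarrow> face (Q i) (c i) v \<Longrightarrow> F c (c(i := v))"
  by (simp add: prod_face_def face_def)

lemma F_type: "F a b \<Longrightarrow> a \<in> C \<Longrightarrow> type a \<subseteq> type b"
  unfolding prod_face_def type_def face_def by force

lemma F_eq: "F a b \<Longrightarrow> a \<in> C \<Longrightarrow> i < k \<Longrightarrow> i \<in> type a \<or> i \<notin> type b \<Longrightarrow> a i = b i"
  using ends_verts verts_edges_disjoint unfolding prod_face_def type_def face_def by blast

text \<open>The edges in the coordinates of \<open>J\<close> are shrunk to endpoints:
  \<open>J = type c\<close> gives a vertex, \<open>J = type c - {i}\<close> an edge in direction
  \<open>i\<close>.\<close>

lemma vertex_below:
  assumes c: "c \<in> C" and J: "J \<subseteq> type c"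
  shows "\<exists>a\<in>C. F a c \<and> type a = type c - J \<and> (\<forall>i<k. i \<notin> J \<longrightarrow> a i = c i)"
proof -
  define a where "a i = (if i \<in> J then SOME v. v \<in> ends (Q i) (c i) else c i)" for i
  have Jk: "i < k \<and> c i \<in> edges (Q i)" if "i \<in> J" for i using J that by (auto simp: type_def)
  have e: "a i \<in> ends (Q i) (c i)" if "i \<in> J" for i
    unfolding a_def using that ends_nonempty[of i "c i"] Jk[OF that] by (auto intro: someI)
  then have v: "a i \<in> verts (Q i)" if "i \<in> J" for i using ends_verts Jk that by blast
  have "a \<in> C" using c v Jk unfolding prod_cells_def by (auto simp: PiE_def extensional_def cells_def a_def Pi_def)
  moreover have "F a c" unfolding prod_face_def face_def using e Jk by (auto simp: a_def)
  moreover have "type a = type c - J" using v verts_edges_disjoint Jk unfolding type_def by (auto simp: a_def)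
  ultimately show ?thesis by (intro bexI[of _ a]) (auto simp: a_def)
qed

text \<open>Vertices, and likewise one-cells below, are recognised from the face relation alone;
  hence every automorphism preserves them.\<close>

lemma type_empty_iff: "c \<in> C \<Longrightarrow> type c = {} \<longleftrightarrow> (\<forall>a\<in>C. F a c \<longrightarrow> a = c)"
proof
  assume c: "c \<in> C" "type c = {}"
  show "\<forall>a\<in>C. F a c \<longrightarrow> a = c" using F_eq[of _ c] c by (auto intro!: cell_eqI)
next
  assume c: "c \<in> C" "\<forall>a\<in>C. F a c \<longrightarrow> a = c"
  obtain a where "a \<in> C" "F a c" "type a = {}" using vertex_below[OF c(1) order_refl] by auto
  then show "type c = {}" using c by auto
qed

definition one_cell :: "(nat \<Rightarrow> 'a) \<Rightarrow> bool" where
  "one_cell c \<longleftrightarrow> c \<in> C \<and> (\<exists>i. type c = {i})"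

definition dir :: "(nat \<Rightarrow> 'a) \<Rightarrow> nat" where
  "dir c = the_elem (type c)"

lemma one_cell_type: "one_cell c \<Longrightarrow> type c = {dir c}"
  unfolding one_cell_def dir_def by (metis the_elem_eq)

lemma dirI: "type c = {i} \<Longrightarrow> dir c = i"
  by (simp add: dir_def)

lemma dir_less: "one_cell c \<Longrightarrow> dir c < k"
  using one_cell_type by (fastforce simp: type_def)

lemma one_cell_C: "one_cell c \<Longrightarrow> c \<in> C"
  by (simp add: one_cell_def)

lemma one_cell_iff: "c \<in> C \<Longrightarrow> one_cell c \<longleftrightarrow> type c \<noteq> {} \<and> (\<forall>a\<in>C. F a c \<longrightarrow> a = c \<or> type a = {})"
proof
  assume c: "c \<in> C" and o: "one_cell c"
  then obtain i where i: "type c = {i}" by (auto simp: one_cell_def)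
  have "a = c \<or> type a = {}" if a: "a \<in> C" "F a c" for a
  proof (cases "type a = {}")
    case False
    then have "type a = type c" using F_type[OF a(2,1)] i by auto
    then have "a = c" using F_eq[OF a(2,1)] a(1) c by (intro cell_eqI) auto
    then show ?thesis by simp
  qed simp
  then show "type c \<noteq> {} \<and> (\<forall>a\<in>C. F a c \<longrightarrow> a = c \<or> type a = {})" using i by auto
next
  assume c: "c \<in> C" and h: "type c \<noteq> {} \<and> (\<forall>a\<in>C. F a c \<longrightarrow> a = c \<or> type a = {})"
  then obtain i where i: "i \<in> type c" by auto
  obtain a where a: "a \<in> C" "F a c" "type a = type c - (type c - {i})" using vertex_below[OF c, of "type c - {i}"] by auto
  then have "type a = {i}" using i by auto
  then show "one_cell c" using h a c unfolding one_cell_def by force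
qed

lemma span:
  assumes x: "x \<in> C" "type x = {}" and e: "one_cell e" "F x e" and f: "one_cell f" "F x f"
    and ne: "dir e \<noteq> dir f"
  defines "D \<equiv> x(dir e := e (dir e), dir f := f (dir f))"
  shows "D \<in> C" "F e D" "F f D" "type D = {dir e, dir f}"
proof -
  let ?i = "dir e" and ?j = "dir f"
  have ij: "?i < k" "?j < k" using dir_less e f by auto
  have t: "type e = {?i}" "type f = {?j}" using one_cell_type e f by auto
  then have ed: "e ?i \<in> edges (Q ?i)" "f ?j \<in> edges (Q ?j)" unfolding type_def by blast+
  show D: "D \<in> C" unfolding D_def by (intro cell_upd x ij) (use ed in \<open>auto simp: cells_def\<close>)
  have ex: "e l = x l" if "l < k" "l \<noteq> ?i" for l using F_eq[OF e(2) x(1) that(1)] t that by auto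
  have fx: "f l = x l" if "l < k" "l \<noteq> ?j" for l using F_eq[OF f(2) x(1) that(1)] t that by auto
  have fi: "face (Q l) (x l) (e l)" "face (Q l) (x l) (f l)" if "l < k" for l
    using e(2) f(2) that by (auto simp: prod_face_def)
  show "F e D" unfolding prod_face_def
  proof (intro allI impI)
    fix l assume l: "l < k"
    show "face (Q l) (e l) (D l)" using ex[OF l] fi[OF l] ne unfolding D_def by (cases "l = ?i"; cases "l = ?j") (auto simp: face_def)
  qed
  show "F f D" unfolding prod_face_def
  proof (intro allI impI)
    fix l assume l: "l < k"
    show "face (Q l) (f l) (D l)" using fx[OF l] fi[OF l] ne unfolding D_def by (cases "l = ?i"; cases "l = ?j") (auto simp: face_def)
  qed
  show "type D = {?i, ?j}" using x(2) ed ij ne unfolding type_def D_def by auto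
qed

text \<open>An edge at \<open>x\<close> below \<open>D\<close> agrees with \<open>D\<close> in its
  own direction and with \<open>x\<close> in all others, so its direction determines it.
  \<open>D\<close> may have any dimension.\<close>

lemma no_span:
  assumes x: "x \<in> C" "type x = {}" and e: "one_cell e" "F x e" and f: "one_cell f" "F x f"
    and D: "D \<in> C" "F e D" "F f D" and eq: "dir e = dir f"
  shows "e = f"
proof (rule cell_eqI)
  show "e \<in> C" "f \<in> C" using e f one_cell_C by auto
  fix l assume l: "l < k"
  have t: "type e = {dir e}" "type f = {dir e}" using one_cell_type e f eq by auto
  show "e l = f l"
  proof (cases "l = dir e")
    case True
    then show ?thesis using F_eq[OF D(2) one_cell_C[OF e(1)] l] F_eq[OF D(3) one_cell_C[OF f(1)] l] t by auto
  next
    case False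
    then show ?thesis using F_eq[OF e(2) x(1) l] F_eq[OF f(2) x(1) l] t by auto
  qed
qed

lemma edge_at:
  assumes i: "i < k" "e \<in> edges (Q i)" and v: "v \<in> verts (Q i)"
  shows "\<exists>f\<in>edges (Q i). v \<in> ends (Q i) f"
proof -
  obtain w where w: "w \<in> ends (Q i) e" "w \<in> verts (Q i)" using ends_nonempty[OF i] ends_verts[OF i] by auto
  have "(v, w) \<in> (adj (Q i))\<^sup>*" using conn[OF i(1)] v w by (simp add: connected_graph_def)
  then show ?thesis
  proof (cases rule: converse_rtranclE)
    case base then show ?thesis using w i by auto
  next
    case (step z) then show ?thesis by (auto simp: adj_def)
  qed
qed

text \<open>Induction along paths that change the coordinates one after another, each along a path
  of its factor. Coordinates that are edges are allowed where \<open>x\<close> and \<open>y\<close>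
  agree.\<close>

lemma cell_connected:
  assumes x: "x \<in> C" and y: "y \<in> C" and xy: "\<And>j. j < k \<Longrightarrow> x j \<noteq> y j \<Longrightarrow> x j \<in> verts (Q j) \<and> y j \<in> verts (Q j)"
    and P: "P x" and step: "\<And>z j v. z \<in> C \<Longrightarrow> j < k \<Longrightarrow> x j \<noteq> y j \<Longrightarrow> (z j, v) \<in> adj (Q j) \<Longrightarrow>
      type z = type x \<Longrightarrow> P z \<Longrightarrow> P (z(j := v))"
  shows "P y"
proof -
  define w where "w m j = (if j < m then y j else x j)" for m j :: nat
  have wC: "w m \<in> C" for m using x y unfolding prod_cells_def w_def by (auto simp: PiE_def extensional_def Pi_def)
  have adjV: "v \<in> verts (Q j)" if "(u, v) \<in> adj (Q j)" "j < k" for u v j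
    using that wf[of j] by (auto simp: adj_def wf_graph_def)
  have wt: "type (w m) = type x" for m
    using xy verts_edges_disjoint unfolding type_def w_def by (auto simp: set_eq_iff) metis+
  have "P (w m)" if "m \<le> k" for m
    using that
  proof (induction m)
    case 0 then show ?case using P by (simp add: w_def[abs_def])
  next
    case (Suc m)
    then have m: "m < k" "P (w m)" by auto
    have upd: "w (Suc m) = (w m)(m := y m)" by (auto simp: w_def fun_eq_iff less_Suc_eq)
    show ?case
    proof (cases "x m = y m")
      case True
      then have "w (Suc m) = w m" unfolding upd by (auto simp: w_def fun_eq_iff)
      then show ?thesis using m by simp
    next
      case False
      have V: "x m \<in> verts (Q m)" "y m \<in> verts (Q m)" using xy[OF m(1) False] by auto
      then have "(x m, y m) \<in> (adj (Q m))\<^sup>*" using conn[OF m(1)] by (simp add: connected_graph_def)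
      then have "y m \<in> verts (Q m) \<and> P ((w m)(m := y m))"
      proof (induction rule: rtrancl_induct)
        case base
        have "(w m)(m := x m) = w m" by (auto simp: w_def fun_eq_iff)
        then show ?case using m V by simp
      next
        case (step u v)
        have t: "type ((w m)(m := u)) = type x"
        proof -
          have "type ((w m)(m := u)) = type (w m)"
            using step(3) V verts_edges_disjoint[OF m(1)] unfolding type_def w_def by auto
          then show ?thesis using wt by simp
        qed
        have uC: "(w m)(m := u) \<in> C" by (rule cell_upd[OF wC m(1)]) (use step(3) in \<open>auto simp: cells_def\<close>)
        have uv: "(((w m)(m := u)) m, v) \<in> adj (Q m)" using step(2) by simp
        have "P (((w m)(m := u))(m := v))"
          by (rule assms(5)[OF uC m(1) False uv t]) (use step(3) in blast)
        then have "P ((w m)(m := v))" by (simp only: fun_upd_upd)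
        then show ?case using adjV[OF step(2) m(1)] by blast
      qed
      then have "P ((w m)(m := y m))" by blast
      then show ?thesis by (simp only: upd)
    qed
  qed
  from this[of k] have "P (w k)" by simp
  moreover have "w k = y" by (rule cell_eqI[OF wC y]) (simp add: w_def)
  ultimately show ?thesis by simp
qed

lemma adj_span:
  assumes z: "z \<in> C" "j < k" and a: "(z j, v) \<in> adj (Q j)"
  obtains D where "D \<in> C" "D j \<in> edges (Q j)" "D = z(j := D j)" "F z D" "F (z(j := v)) D" "z(j := v) \<in> C" "v \<in> verts (Q j)"
proof -
  obtain e where e: "e \<in> edges (Q j)" "ends (Q j) e = {z j, v}" using a by (auto simp: adj_def)
  have v: "v \<in> verts (Q j)" using ends_verts[OF z(2) e(1)] e by simp
  show ?thesis
  proof (rule that[of "z(j := e)"])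
    show "z(j := e) \<in> C" "z(j := v) \<in> C" using z e v by (auto intro!: cell_upd simp: cells_def)
    show "F z (z(j := e))" using z e by (intro F_upd) (auto simp: face_def)
    show "F (z(j := v)) (z(j := e))" using e by (auto simp: prod_face_def face_def)
  qed (use e v in auto)
qed

section \<open>Automorphisms and directions\<close>

definition aut_pair :: "((nat \<Rightarrow> 'a) \<Rightarrow> (nat \<Rightarrow> 'a)) \<Rightarrow> ((nat \<Rightarrow> 'a) \<Rightarrow> (nat \<Rightarrow> 'a)) \<Rightarrow> bool" where
  "aut_pair \<alpha> \<beta> \<longleftrightarrow> (\<forall>c\<in>C. \<alpha> c \<in> C \<and> \<beta> c \<in> C \<and> \<alpha> (\<beta> c) = c \<and> \<beta> (\<alpha> c) = c) \<and>
    (\<forall>a\<in>C. \<forall>b\<in>C. F (\<alpha> a) (\<alpha> b) = F a b)"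

lemma aut_pair_sym: "aut_pair \<alpha> \<beta> \<Longrightarrow> aut_pair \<beta> \<alpha>"
  unfolding aut_pair_def by metis

context
  fixes \<alpha> \<beta> assumes a: "aut_pair \<alpha> \<beta>"
begin

lemma aut_C: "c \<in> C \<Longrightarrow> \<alpha> c \<in> C" "c \<in> C \<Longrightarrow> \<beta> c \<in> C" "c \<in> C \<Longrightarrow> \<alpha> (\<beta> c) = c" "c \<in> C \<Longrightarrow> \<beta> (\<alpha> c) = c"
  using a by (auto simp: aut_pair_def)

lemma aut_F: "b \<in> C \<Longrightarrow> c \<in> C \<Longrightarrow> F (\<alpha> b) (\<alpha> c) = F b c"
  using a by (auto simp: aut_pair_def)

lemma aut_F2: "b \<in> C \<Longrightarrow> c \<in> C \<Longrightarrow> F b (\<alpha> c) = F (\<beta> b) c"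
  using aut_F[of "\<beta> b" c] aut_C by simp

lemma aut_inj: "b \<in> C \<Longrightarrow> c \<in> C \<Longrightarrow> \<alpha> b = \<alpha> c \<Longrightarrow> b = c"
  using aut_C(4) by metis

lemma aut_vertex: "c \<in> C \<Longrightarrow> type (\<alpha> c) = {} \<longleftrightarrow> type c = {}"
proof -
  assume c: "c \<in> C"
  have "(\<forall>b\<in>C. F b (\<alpha> c) \<longrightarrow> b = \<alpha> c) \<longleftrightarrow> (\<forall>b\<in>C. F b c \<longrightarrow> b = c)"
  proof
    assume h: "\<forall>b\<in>C. F b (\<alpha> c) \<longrightarrow> b = \<alpha> c"
    show "\<forall>b\<in>C. F b c \<longrightarrow> b = c" using h aut_C(1) aut_F c aut_inj by blast
  next
    assume h: "\<forall>b\<in>C. F b c \<longrightarrow> b = c"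
    show "\<forall>b\<in>C. F b (\<alpha> c) \<longrightarrow> b = \<alpha> c" using h aut_C aut_F2 c by metis
  qed
  then show ?thesis using type_empty_iff aut_C(1) c by simp
qed

lemma aut_one_cell: "c \<in> C \<Longrightarrow> one_cell (\<alpha> c) \<longleftrightarrow> one_cell c"
proof -
  assume c: "c \<in> C"
  have "(\<forall>b\<in>C. F b (\<alpha> c) \<longrightarrow> b = \<alpha> c \<or> type b = {}) \<longleftrightarrow> (\<forall>b\<in>C. F b c \<longrightarrow> b = c \<or> type b = {})"
  proof
    assume h: "\<forall>b\<in>C. F b (\<alpha> c) \<longrightarrow> b = \<alpha> c \<or> type b = {}"
    show "\<forall>b\<in>C. F b c \<longrightarrow> b = c \<or> type b = {}"
    proof (intro ballI impI)
      fix b assume b: "b \<in> C" "F b c"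
      then have "\<alpha> b = \<alpha> c \<or> type (\<alpha> b) = {}" using h aut_F[OF b(1) c] aut_C(1)[OF b(1)] by blast
      then show "b = c \<or> type b = {}" using aut_inj[OF b(1) c] aut_vertex[OF b(1)] by blast
    qed
  next
    assume h: "\<forall>b\<in>C. F b c \<longrightarrow> b = c \<or> type b = {}"
    show "\<forall>b\<in>C. F b (\<alpha> c) \<longrightarrow> b = \<alpha> c \<or> type b = {}"
    proof (intro ballI impI)
      fix b assume b: "b \<in> C" "F b (\<alpha> c)"
      then have "\<beta> b = c \<or> type (\<beta> b) = {}" using h aut_F2 aut_C(2) c by blast
      then show "b = \<alpha> c \<or> type b = {}" using aut_vertex[of "\<beta> b"] aut_C b by auto
    qed
  qed
  then show ?thesis using one_cell_iff aut_C(1) aut_vertex c by simp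
qed

lemma aut_dir_at_vertex:
  assumes x: "x \<in> C" "type x = {}" and e: "one_cell e" "F x e" and f: "one_cell f" "F x f"
  shows "dir (\<alpha> e) = dir (\<alpha> f) \<longleftrightarrow> dir e = dir f"
proof -
  have Cs: "e \<in> C" "f \<in> C" using e f one_cell_C by auto
  have x': "\<alpha> x \<in> C" "type (\<alpha> x) = {}" using x aut_C aut_vertex by auto
  have e': "one_cell (\<alpha> e)" "F (\<alpha> x) (\<alpha> e)" and f': "one_cell (\<alpha> f)" "F (\<alpha> x) (\<alpha> f)"
    using e f x Cs aut_one_cell aut_F by auto
  show ?thesis
  proof
    assume eq: "dir (\<alpha> e) = dir (\<alpha> f)"
    show "dir e = dir f"
    proof (rule ccontr)
      assume ne: "dir e \<noteq> dir f"
      obtain D where D: "D \<in> C" "F e D" "F f D" using span[OF x e f ne] by blast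
      then have "\<alpha> e = \<alpha> f" using no_span[OF x' e' f' _ _ _ eq, of "\<alpha> D"] aut_C(1) aut_F Cs by simp
      then show False using aut_inj Cs ne by blast
    qed
  next
    assume eq: "dir e = dir f"
    show "dir (\<alpha> e) = dir (\<alpha> f)"
    proof (rule ccontr)
      assume ne: "dir (\<alpha> e) \<noteq> dir (\<alpha> f)"
      obtain D where D: "D \<in> C" "F (\<alpha> e) D" "F (\<alpha> f) D" using span[OF x' e' f' ne] by blast
      have "D = \<alpha> (\<beta> D)" using D aut_C by simp
      then have "F e (\<beta> D)" "F f (\<beta> D)" using D aut_F[of e "\<beta> D"] aut_F[of f "\<beta> D"] aut_C Cs by auto
      then have "e = f" using no_span[OF x e f _ _ _ eq, of "\<beta> D"] aut_C(2) D by simp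
      then show False using ne by simp
    qed
  qed
qed

text \<open>The automorphism permutes directions at \<open>x\<close> and at \<open>y\<close> in the
  same way. A direction without edges at one of the two imposes no condition, so transitivity relies
  on \<open>edge_at\<close>.\<close>

definition same_dirs :: "(nat \<Rightarrow> 'a) \<Rightarrow> (nat \<Rightarrow> 'a) \<Rightarrow> bool" where
  "same_dirs x y \<longleftrightarrow> (\<forall>e f. one_cell e \<longrightarrow> one_cell f \<longrightarrow> F x e \<longrightarrow> F y f \<longrightarrow> dir e = dir f \<longrightarrow> dir (\<alpha> e) = dir (\<alpha> f))"

lemma one_cell_upd:
  assumes "z \<in> C" "type z = {}" "i < k" "e \<in> edges (Q i)" "z i \<in> ends (Q i) e"
  shows "one_cell (z(i := e))" "dir (z(i := e)) = i" "F z (z(i := e))"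
proof -
  have t: "type (z(i := e)) = {i}" using assms by (auto simp: type_def)
  then show "dir (z(i := e)) = i" by (rule dirI)
  show "one_cell (z(i := e))" using t assms by (auto simp: one_cell_def cells_def intro!: cell_upd)
  show "F z (z(i := e))" using assms by (intro F_upd) (auto simp: face_def)
qed

text \<open>In the direction of the connecting edge \<open>b\<close>, both vertices see
  \<open>b\<close> itself. In another direction, \<open>e\<close> and the parallel edge
  \<open>f'\<close> lie in a square \<open>D\<close>. If their images had different directions, the
  image of \<open>D\<close> would contain at \<open>\<alpha> z\<close> an edge \<open>h\<close> in
  the direction of \<open>\<alpha> f'\<close>. Its preimage is an edge at \<open>z\<close> below
  \<open>D\<close>, so it is \<open>e\<close> or \<open>b\<close>, but neither has an image in that
  direction.\<close>

lemma same_dirs_adjacent: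
  assumes z: "z \<in> C" "type z = {}" and j: "j < k" and adj: "(z j, v) \<in> adj (Q j)"
  shows "same_dirs z (z(j := v))"
  unfolding same_dirs_def
proof (intro allI impI)
  fix e f assume e: "one_cell e" "F z e" and f: "one_cell f" "F (z(j := v)) f" and ef: "dir e = dir f"
  let ?y = "z(j := v)" and ?i = "dir e"
  obtain b where b: "b \<in> C" "b j \<in> edges (Q j)" "b = z(j := b j)" "F z b" "F ?y b" "?y \<in> C" "v \<in> verts (Q j)"
    by (rule adj_span[OF z(1) j adj])
  have tb: "type b = {j}" using b(2) z(2) j by (subst b(3)) (auto simp: type_def)
  then have b1: "one_cell b" "dir b = j" using b(1) by (auto simp: one_cell_def dirI)
  have y: "?y \<in> C" "type ?y = {}" using b z verts_edges_disjoint[OF j] by (auto simp: type_def)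
  show "dir (\<alpha> e) = dir (\<alpha> f)"
  proof (cases "?i = j")
    case True
    then have "dir (\<alpha> e) = dir (\<alpha> b)" "dir (\<alpha> b) = dir (\<alpha> f)"
      using aut_dir_at_vertex[OF z e b1(1) b(4)] aut_dir_at_vertex[OF y b1(1) b(5) f] b1 ef by auto
    then show ?thesis by simp
  next
    case False
    have ij: "?i < k" using dir_less e by simp
    have "type e = {?i}" by (rule one_cell_type[OF e(1)])
    then have ee: "e ?i \<in> edges (Q ?i)" by (auto simp: type_def)
    have "face (Q ?i) (z ?i) (e ?i)" using e(2) ij by (simp add: prod_face_def)
    moreover have "z ?i \<noteq> e ?i" using ee z ij by (auto simp: type_def)
    ultimately have ze: "z ?i \<in> ends (Q ?i) (e ?i)" by (simp add: face_def)
    \<comment> \<open>The edge opposite to \<open>e\<close> in the square.\<close>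
    define f' where "f' = ?y(?i := e ?i)"
    have f': "one_cell f'" "dir f' = ?i" "F ?y f'"
      unfolding f'_def by (rule one_cell_upd[OF y ij ee]; use ze False in simp)+
    have ne: "dir e \<noteq> dir b" using False b1 by simp
    define D where "D = z(?i := e ?i, dir b := b (dir b))"
    note D = span[OF z e b1(1) b(4) ne, folded D_def]
    have De: "D = f'(j := b j)" unfolding D_def f'_def b1(2) using False by (auto simp: fun_eq_iff)
    have "face (Q j) (?y j) (b j)" using b(5) j by (auto simp: prod_face_def)
    then have fD: "F f' D" unfolding De using False by (intro F_upd[OF j]) (simp add: f'_def)
    have Cs: "e \<in> C" "b \<in> C" "f' \<in> C" using e b1 f' one_cell_C by auto
    have aD: "\<alpha> D \<in> C" "F (\<alpha> e) (\<alpha> D)" "F (\<alpha> b) (\<alpha> D)" "F (\<alpha> f') (\<alpha> D)"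
      using D fD Cs aut_C aut_F by auto
    have eq: "dir (\<alpha> e) = dir (\<alpha> f')"
    proof (rule ccontr)
      assume n: "dir (\<alpha> e) \<noteq> dir (\<alpha> f')"
      let ?l = "dir (\<alpha> f')"
      have o: "one_cell (\<alpha> f')" using aut_one_cell f' Cs by simp
      \<comment> \<open>\<open>f'\<close> and \<open>b\<close> meet at the other vertex in different
        directions, which \<open>\<alpha>\<close> keeps apart there.\<close>
      have nb: "?l \<noteq> dir (\<alpha> b)"
        using aut_dir_at_vertex[OF y f'(1,3) b1(1) b(5)] f'(2) b1(2) False by simp
      have l: "?l < k" "?l \<in> type (\<alpha> D)"
        using dir_less[OF o] F_type[OF aD(4) one_cell_C[OF o]] one_cell_type[OF o] by auto
      have az: "\<alpha> z \<in> C" "type (\<alpha> z) = {}" using z aut_C aut_vertex by auto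
      have zD: "F (\<alpha> z) (\<alpha> D)"
      proof -
        have "F z D" unfolding D_def prod_face_def using e(2) b(4) by (auto simp: prod_face_def face_def)
        then show ?thesis using aut_F D z by simp
      qed
      define h where "h = (\<alpha> z)(?l := \<alpha> D ?l)"
      have led: "\<alpha> D ?l \<in> edges (Q ?l)" using l by (simp add: type_def)
      have "face (Q ?l) (\<alpha> z ?l) (\<alpha> D ?l)" using zD l by (simp add: prod_face_def)
      then have "\<alpha> z ?l \<in> ends (Q ?l) (\<alpha> D ?l)" using led az l by (auto simp: face_def type_def)
      then have h: "one_cell h" "dir h = ?l" "F (\<alpha> z) h" unfolding h_def using one_cell_upd[OF az l(1) led] by blast+
      have hD: "F h (\<alpha> D)" unfolding h_def prod_face_def using zD by (auto simp: prod_face_def face_def)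
      let ?g = "\<beta> h"
      have hC: "h \<in> C" using one_cell_C[OF h(1)] .
      have g: "one_cell ?g" "F z ?g" "F ?g D" "?g \<in> C" "\<alpha> ?g = h"
        using h hD hC z D aut_C aut_one_cell[of ?g] aut_F[of z ?g] aut_F[of ?g D] by auto
      have "dir ?g \<in> type D" using F_type[OF g(3,4)] one_cell_type[OF g(1)] by auto
      then have "dir ?g = dir e \<or> dir ?g = dir b" using D(4) by auto
      then have "?g = e \<or> ?g = b"
        using no_span[OF z g(1,2) e D(1) g(3) D(2)] no_span[OF z g(1,2) b1(1) b(4) D(1) g(3) D(3)] by auto
      then show False using g(5) h(2) n nb by auto
    qed
    have "dir (\<alpha> f') = dir (\<alpha> f)" using aut_dir_at_vertex[OF y f'(1,3) f] f'(2) ef by simp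
    then show ?thesis using eq by simp
  qed
qed

lemma same_dirs_trans:
  assumes y: "y \<in> C" "type y = {}" and xy: "same_dirs x y" "same_dirs y z"
  shows "same_dirs x z"
  unfolding same_dirs_def
proof (intro allI impI)
  fix e f assume e: "one_cell e" "F x e" and f: "one_cell f" "F z f" and ef: "dir e = dir f"
  have i: "dir e < k" using dir_less e by simp
  have "type e = {dir e}" by (rule one_cell_type[OF e(1)])
  then have ee: "e (dir e) \<in> edges (Q (dir e))" by (auto simp: type_def)
  obtain g where g: "g \<in> edges (Q (dir e))" "y (dir e) \<in> ends (Q (dir e)) g"
    using edge_at[OF i ee, of "y (dir e)"] cell_cases[OF y(1) i] y(2) by auto
  note h = one_cell_upd[OF y i g]
  have "dir (\<alpha> e) = dir (\<alpha> (y(dir e := g)))" using xy(1) e h unfolding same_dirs_def by metis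
  moreover have "dir (\<alpha> (y(dir e := g))) = dir (\<alpha> f)" using xy(2) f h ef unfolding same_dirs_def by metis
  ultimately show "dir (\<alpha> e) = dir (\<alpha> f)" by simp
qed

lemma aut_dir:
  assumes e: "one_cell e" and f: "one_cell f" and ef: "dir e = dir f"
  shows "dir (\<alpha> e) = dir (\<alpha> f)"
proof -
  obtain x where x: "x \<in> C" "F x e" "type x = {}" using vertex_below[OF one_cell_C[OF e] order_refl] by auto
  obtain y where y: "y \<in> C" "F y f" "type y = {}" using vertex_below[OF one_cell_C[OF f] order_refl] by auto
  have "same_dirs x y"
  proof (rule cell_connected[of x y "same_dirs x"])
    show "same_dirs x x" unfolding same_dirs_def using aut_dir_at_vertex[OF x(1,3)] by blast
    show "x j \<in> verts (Q j) \<and> y j \<in> verts (Q j)" if "j < k" for j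
      using cell_cases[OF x(1) that] cell_cases[OF y(1) that] x y by simp
    fix z j v assume z: "z \<in> C" "j < k" "(z j, v) \<in> adj (Q j)" "type z = type x" "same_dirs x z"
    then show "same_dirs x (z(j := v))" using same_dirs_trans[OF z(1) _ z(5)] same_dirs_adjacent[OF z(1) _ z(2,3)] x by simp
  qed fact+
  then show ?thesis using e f ef x y unfolding same_dirs_def by blast
qed

end

section \<open>Coordinates under direction preserving automorphisms\<close>

definition dir_preserving :: "((nat \<Rightarrow> 'a) \<Rightarrow> (nat \<Rightarrow> 'a)) \<Rightarrow> bool" where
  "dir_preserving \<alpha> \<longleftrightarrow> (\<forall>e. one_cell e \<longrightarrow> dir (\<alpha> e) = dir e)"

lemma type_mono_aut:
  assumes a: "aut_pair \<alpha> \<beta>" and d: "dir_preserving \<alpha>" and c: "c \<in> C"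
  shows "type c \<subseteq> type (\<alpha> c)"
proof
  fix i assume i: "i \<in> type c"
  obtain e where e: "e \<in> C" "F e c" "type e = type c - (type c - {i})" using vertex_below[OF c, of "type c - {i}"] by auto
  then have t: "type e = {i}" using i by auto
  then have o: "one_cell e" "dir e = i" using e by (auto simp: one_cell_def dirI)
  then have "one_cell (\<alpha> e)" "dir (\<alpha> e) = i" using aut_one_cell[OF a e(1)] d by (auto simp: dir_preserving_def)
  then have "type (\<alpha> e) = {i}" using one_cell_type by blast
  moreover have "F (\<alpha> e) (\<alpha> c)" using aut_F[OF a e(1) c] e by simp
  ultimately show "i \<in> type (\<alpha> c)" using F_type[of "\<alpha> e" "\<alpha> c"] aut_C(1)[OF a e(1)] by auto
qed

lemma dir_preserving_inverse:
  assumes a: "aut_pair \<alpha> \<beta>" and d: "dir_preserving \<alpha>"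
  shows "dir_preserving \<beta>"
  unfolding dir_preserving_def
proof (intro allI impI)
  fix e assume e: "one_cell e"
  then have eC: "e \<in> C" by (rule one_cell_C)
  have "one_cell (\<beta> e)" using aut_one_cell[OF aut_pair_sym[OF a] eC] e by simp
  then have "dir (\<alpha> (\<beta> e)) = dir (\<beta> e)" using d by (simp add: dir_preserving_def)
  then show "dir (\<beta> e) = dir e" using aut_C(3)[OF a eC] by simp
qed

lemma type_aut:
  assumes a: "aut_pair \<alpha> \<beta>" and d: "dir_preserving \<alpha>" and c: "c \<in> C"
  shows "type (\<alpha> c) = type c"
  using type_mono_aut[OF a d c] type_mono_aut[OF aut_pair_sym[OF a] dir_preserving_inverse[OF a d] aut_C(1)[OF a c]]
    aut_C(4)[OF a c] by auto

text \<open>Types are preserved, so coordinate \<open>i\<close> is an edge in both images or in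
  neither; \<open>F_eq\<close> then identifies the two.\<close>

lemma coordinate_step:
  assumes a: "aut_pair \<alpha> \<beta>" and d: "dir_preserving \<alpha>" and c: "c \<in> C" "D \<in> C" "F c D" and i: "i < k" "c i = D i"
  shows "\<alpha> c i = \<alpha> D i"
proof (rule F_eq)
  show "F (\<alpha> c) (\<alpha> D)" using aut_F[OF a c(1,2)] c(3) by simp
  show "\<alpha> c \<in> C" using aut_C(1)[OF a] c by simp
  show "i \<in> type (\<alpha> c) \<or> i \<notin> type (\<alpha> D)" unfolding type_aut[OF a d c(1)] type_aut[OF a d c(2)] using i by (auto simp: type_def)
qed fact

text \<open>Passing to a face or moving along an edge in another coordinate leaves coordinate
  \<open>i\<close> of the image unchanged. Such moves connect \<open>c\<close> with
  \<open>c'\<close>: shrink all other coordinates to vertices and then move these one at a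
  time.\<close>

lemma coordinate_aut:
  assumes a: "aut_pair \<alpha> \<beta>" and d: "dir_preserving \<alpha>" and c: "c \<in> C" "c' \<in> C" and i: "i < k" "c i = c' i"
  shows "\<alpha> c i = \<alpha> c' i"
proof -
  have red: "\<exists>x\<in>C. F x c \<and> type x \<subseteq> {i} \<and> x i = c i" if "c \<in> C" for c
    using vertex_below[OF that, of "type c - {i}"] i by auto
  obtain x where x: "x \<in> C" "F x c" "type x \<subseteq> {i}" "x i = c i" using red[OF c(1)] by blast
  obtain y where y: "y \<in> C" "F y c'" "type y \<subseteq> {i}" "y i = c' i" using red[OF c(2)] by blast
  have "\<alpha> x i = \<alpha> y i"
  proof (rule cell_connected[of x y "\<lambda>z. \<alpha> x i = \<alpha> z i"])
    show "x j \<in> verts (Q j) \<and> y j \<in> verts (Q j)" if "j < k" "x j \<noteq> y j" for j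
    proof -
      have "j \<noteq> i" using that x y i by auto
      then show ?thesis using cell_cases[OF x(1) that(1)] cell_cases[OF y(1) that(1)] x y by auto
    qed
    fix z j v assume z: "z \<in> C" "j < k" "x j \<noteq> y j" "(z j, v) \<in> adj (Q j)" "\<alpha> x i = \<alpha> z i"
    have ji: "j \<noteq> i" using z x y i by auto
    obtain D where D: "D \<in> C" "D j \<in> edges (Q j)" "D = z(j := D j)" "F z D" "F (z(j := v)) D" "z(j := v) \<in> C" "v \<in> verts (Q j)"
      by (rule adj_span[OF z(1,2,4)])
    have Di: "D i = z i" using fun_cong[OF D(3), of i] ji by simp
    show "\<alpha> x i = \<alpha> (z(j := v)) i"
      using coordinate_step[OF a d z(1) D(1,4) i(1)] coordinate_step[OF a d D(6,1,5) i(1)] Di ji z(5) by simp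
  qed (use x y in auto)
  then show ?thesis
    using coordinate_step[OF a d x(1) c(1) x(2) i(1) x(4)] coordinate_step[OF a d y(1) c(2) y(2) i(1) y(4)] by simp
qed

lemma exists_vertex: "\<exists>x\<in>C. type x = {}"
proof -
  define x where "x = (\<lambda>i\<in>{..<k}. SOME v. v \<in> verts (Q i))"
  have v: "x i \<in> verts (Q i)" if "i < k" for i
    unfolding x_def using conn[OF that] that by (auto simp: connected_graph_def some_in_eq)
  then have "x \<in> C" unfolding prod_cells_def cells_def by (auto simp: x_def)
  moreover have "type x = {}" using v verts_edges_disjoint by (auto simp: type_def)
  ultimately show ?thesis by blast
qed

end

section \<open>Actions on a product and on its factors\<close>

locale graph_product_action = graph_product k Q + group G
  for k :: nat and Q :: "nat \<Rightarrow> 'a graph" and G :: "('g, 'm) monoid_scheme" (structure) +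
  fixes \<phi> :: "'g \<Rightarrow> (nat \<Rightarrow> 'a) \<Rightarrow> nat \<Rightarrow> 'a"
  assumes action: "acts_by_automorphisms G C F \<phi>"
begin

sublocale act: group_action G C \<phi>
  using action by (simp add: acts_by_automorphisms_def)

lemma act_C: "g \<in> carrier G \<Longrightarrow> c \<in> C \<Longrightarrow> \<phi> g c \<in> C"
  using act.element_image by blast

lemma act_mult: "g \<in> carrier G \<Longrightarrow> h \<in> carrier G \<Longrightarrow> c \<in> C \<Longrightarrow> \<phi> (g \<otimes> h) c = \<phi> g (\<phi> h c)"
  using act.composition_rule by blast

lemma act_one: "c \<in> C \<Longrightarrow> \<phi> \<one> c = c"
  using act.id_eq_one by (metis restrict_apply')

lemma act_aut: "g \<in> carrier G \<Longrightarrow> aut_pair (\<phi> g) (\<phi> (inv g))"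
  unfolding aut_pair_def using action act_C act_mult[symmetric] act_one by (auto simp: acts_by_automorphisms_def)

definition factor_group :: "'g set" where
  "factor_group = {g \<in> carrier G. dir_preserving (\<phi> g)}"

lemma factor_group_carrier: "g \<in> factor_group \<Longrightarrow> g \<in> carrier G"
  by (simp add: factor_group_def)

lemma subgroup_factor_group: "subgroup factor_group G"
proof
  show "factor_group \<subseteq> carrier G" by (auto simp: factor_group_def)
  show "\<one> \<in> factor_group" using act_one one_cell_C by (auto simp: factor_group_def dir_preserving_def)
  show "inv g \<in> factor_group" if "g \<in> factor_group" for g
    using that dir_preserving_inverse[OF act_aut] by (auto simp: factor_group_def)
  show "g \<otimes> h \<in> factor_group" if gh: "g \<in> factor_group" "h \<in> factor_group" for g h
  proof -
    have c: "g \<in> carrier G" "h \<in> carrier G" using gh factor_group_carrier by auto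
    have "dir (\<phi> (g \<otimes> h) e) = dir e" if e: "one_cell e" for e
    proof -
      have "one_cell (\<phi> h e)" using aut_one_cell[OF act_aut[OF c(2)] one_cell_C[OF e]] e by simp
      then show ?thesis using gh e act_mult[OF c one_cell_C[OF e]] by (simp add: factor_group_def dir_preserving_def)
    qed
    then show ?thesis using c by (simp add: factor_group_def dir_preserving_def)
  qed
qed

text \<open>The action on the directions of edges, of which there are at most \<open>k\<close>, has kernel \<open>factor_group\<close>.\<close>

lemma finite_index_factor_group: "finite_index factor_group G"
proof -
  define e where "e i = (SOME c. one_cell c \<and> dir c = i)" for i
  \<comment> \<open>The directions that occur; a factor without edges contributes none.\<close>
  define I where "I = {i. \<exists>c. one_cell c \<and> dir c = i}"
  have e: "one_cell (e i) \<and> dir (e i) = i" if "i \<in> I" for i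
  proof -
    have "\<exists>c. one_cell c \<and> dir c = i" using that unfolding I_def by blast
    then show ?thesis unfolding e_def by (rule someI_ex)
  qed
  have I: "finite I" by (rule finite_subset[of _ "{..<k}"]) (auto simp: I_def dir_less)
  have perm: "dir (\<phi> g c) = dir (\<phi> g (e (dir c)))" if "g \<in> carrier G" "one_cell c" for g c
  proof -
    have "dir c \<in> I" using that(2) unfolding I_def by blast
    from e[OF this] show ?thesis using aut_dir[OF act_aut[OF that(1)] that(2), of "e (dir c)"] by simp
  qed
  show ?thesis
  proof (rule finite_indexI[OF subgroup_factor_group, of "\<lambda>g. \<lambda>i\<in>I. dir (\<phi> g (e i))"])
    have "(\<lambda>g. \<lambda>i\<in>I. dir (\<phi> g (e i))) ` carrier G \<subseteq> (\<Pi>\<^sub>E i\<in>I. {..<k})"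
    proof (rule image_subsetI)
      fix g assume g: "g \<in> carrier G"
      have "dir (\<phi> g (e i)) < k" if "i \<in> I" for i
        using dir_less aut_one_cell[OF act_aut[OF g]] e[OF that] one_cell_C by blast
      then show "(\<lambda>i\<in>I. dir (\<phi> g (e i))) \<in> (\<Pi>\<^sub>E i\<in>I. {..<k})" by auto
    qed
    then show "finite ((\<lambda>g. \<lambda>i\<in>I. dir (\<phi> g (e i))) ` carrier G)"
      by (rule finite_subset) (use I in \<open>auto intro: finite_PiE\<close>)
    fix g h assume gh: "g \<in> carrier G" "h \<in> carrier G" "(\<lambda>i\<in>I. dir (\<phi> g (e i))) = (\<lambda>i\<in>I. dir (\<phi> h (e i)))"
    have eq: "dir (\<phi> g (e i)) = dir (\<phi> h (e i))" if "i \<in> I" for i using fun_cong[OF gh(3), of i] that by simp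
    have "dir (\<phi> (g \<otimes> inv h) c) = dir c" if c: "one_cell c" for c
    proof -
      have cC: "c \<in> C" by (rule one_cell_C[OF c])
      let ?c = "\<phi> (inv h) c"
      have ih: "inv h \<in> carrier G" using gh by simp
      have o: "one_cell ?c" using aut_one_cell[OF act_aut[OF ih] cC] c by simp
      have "dir (\<phi> (g \<otimes> inv h) c) = dir (\<phi> g ?c)" using act_mult[OF gh(1) ih cC] by simp
      also have "\<dots> = dir (\<phi> g (e (dir ?c)))" by (rule perm[OF gh(1) o])
      also have "\<dots> = dir (\<phi> h (e (dir ?c)))" by (rule eq) (use o in \<open>auto simp: I_def\<close>)
      also have "\<dots> = dir (\<phi> h ?c)" by (rule perm[OF gh(2) o, symmetric])
      also have "\<phi> h ?c = c" using act_mult[OF gh(2) ih cC] gh(2) act_one[OF cC] by simp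
      finally show ?thesis .
    qed
    then show "g \<otimes> inv h \<in> factor_group" using gh by (simp add: factor_group_def dir_preserving_def)
  qed
qed

text \<open>A cell \<open>z\<close> of a factor is placed into coordinate \<open>i\<close> of a
  fixed vertex \<open>x\<close>. By \<open>coordinate_aut\<close> the result does not depend on the
  other coordinates, which makes it multiplicative. Restricting to the cells supplies the
  extensionality built into group actions.\<close>

lemma exists_factor_actions: "\<exists>\<psi>. factor_actions (G\<lparr>carrier := factor_group\<rparr>) k Q \<phi> \<psi>"
proof -
  let ?H = "G\<lparr>carrier := factor_group\<rparr>"
  interpret H: group ?H using subgroup_imp_group[OF subgroup_factor_group] .
  obtain x where x: "x \<in> C" "type x = {}" using exists_vertex by blast
  define \<psi> where "\<psi> i g = (\<lambda>z\<in>cells (Q i). \<phi> g (x(i := z)) i)" for i g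
  have xu: "x(i := z) \<in> C" if "i < k" "z \<in> cells (Q i)" for i z using cell_upd[OF x(1) that] .
  have aut: "aut_pair (\<phi> g) (\<phi> (inv g))" "dir_preserving (\<phi> g)" if "g \<in> factor_group" for g
    using that act_aut by (auto simp: factor_group_def)
  have \<psi>: "\<phi> g c i = \<psi> i g (c i)" if g: "g \<in> factor_group" and c: "c \<in> C" and i: "i < k" for g c i
  proof -
    have ci: "c i \<in> cells (Q i)" using c i by (auto simp: prod_cells_def)
    show ?thesis using coordinate_aut[OF aut[OF g] c xu[OF i ci] i] ci by (simp add: \<psi>_def)
  qed
  have in_cells: "\<psi> i g z \<in> cells (Q i)" if "g \<in> factor_group" "i < k" "z \<in> cells (Q i)" for i g z
    using act_C[OF factor_group_carrier[OF that(1)] xu[OF that(2,3)]] that by (auto simp: \<psi>_def prod_cells_def)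
  have one: "\<psi> i \<one> z = z" if "i < k" "z \<in> cells (Q i)" for i z
    using that act_one[OF xu[OF that]] by (simp add: \<psi>_def)
  have mult: "\<psi> i (g \<otimes> h) z = \<psi> i g (\<psi> i h z)" if "g \<in> factor_group" "h \<in> factor_group" "i < k" "z \<in> cells (Q i)" for i g h z
  proof -
    note c = factor_group_carrier[OF that(1)] factor_group_carrier[OF that(2)]
    have "\<psi> i (g \<otimes> h) z = \<phi> g (\<phi> h (x(i := z))) i" using act_mult[OF c xu[OF that(3,4)]] that by (simp add: \<psi>_def)
    also have "\<dots> = \<psi> i g (\<phi> h (x(i := z)) i)" by (rule \<psi>[OF that(1) act_C[OF c(2) xu[OF that(3,4)]] that(3)])
    finally show ?thesis using that by (simp add: \<psi>_def)
  qed
  have face: "face (Q i) (\<psi> i g a) (\<psi> i g b)" if f: "face (Q i) a b" and g: "g \<in> factor_group" and i: "i < k"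
    and ab: "a \<in> cells (Q i)" "b \<in> cells (Q i)" for i g a b
  proof -
    have "F (x(i := a)) (x(i := b))" using f i by (auto simp: prod_face_def face_def)
    then have "F (\<phi> g (x(i := a))) (\<phi> g (x(i := b)))"
      using aut_F[OF aut(1)[OF g] xu[OF i ab(1)] xu[OF i ab(2)]] by simp
    then show ?thesis using i ab by (auto simp: prod_face_def \<psi>_def)
  qed
  have "acts_by_automorphisms ?H (cells (Q i)) (face (Q i)) (\<psi> i)" if i: "i < k" for i
    unfolding acts_by_automorphisms_def
  proof (intro conjI ballI)
    show "group_action ?H (cells (Q i)) (\<psi> i)"
      by (rule H.group_actionI) (use in_cells[OF _ i] one[OF i] mult[OF _ _ i] in \<open>auto simp: \<psi>_def[abs_def]\<close>)
    fix g a b assume g: "g \<in> carrier ?H" and ab: "a \<in> cells (Q i)" "b \<in> cells (Q i)"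
    then have g': "g \<in> factor_group" "inv g \<in> factor_group" "g \<in> carrier G"
      using subgroup.m_inv_closed[OF subgroup_factor_group] factor_group_carrier by auto
    have canc: "\<psi> i (inv g) (\<psi> i g z) = z" if "z \<in> cells (Q i)" for z
      using mult[OF g'(2,1) i that] one[OF i that] g'(3) by simp
    show "face (Q i) (\<psi> i g a) (\<psi> i g b) \<longleftrightarrow> face (Q i) a b"
      using face[OF _ g'(1) i ab] face[OF _ g'(2) i in_cells[OF g'(1) i ab(1)] in_cells[OF g'(1) i ab(2)]] canc ab by auto
  qed
  moreover have "\<forall>g\<in>carrier ?H. \<forall>c\<in>C. \<forall>i<k. \<phi> g c i = \<psi> i g (c i)" using \<psi> by simp
  ultimately show ?thesis unfolding factor_actions_def by blast
qed

end

section \<open>Proper actions on products of quasitrees\<close>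

text \<open>Each element is a chosen representative for its orbit point times an element of the
  stabiliser.\<close>

lemma (in group) stabilizer_orbit_finite:
  assumes act: "group_action G S \<phi>" and x: "x \<in> S" and L: "L \<subseteq> carrier G"
    and stab: "finite {g \<in> carrier G. \<phi> g x = x}" and orb: "finite ((\<lambda>g. \<phi> g x) ` L)"
  shows "finite L"
proof (rule finite_subset)
  interpret group_action G S \<phi> by fact
  have one: "\<phi> \<one> x = x" using id_eq_one x by (metis restrict_apply')
  let ?r = "\<lambda>y. SOME g. g \<in> L \<and> \<phi> g x = y"
  have r: "?r (\<phi> g x) \<in> L \<and> \<phi> (?r (\<phi> g x)) x = \<phi> g x" if "g \<in> L" for g
    by (rule someI[of _ g]) (use that in auto)
  show "L \<subseteq> (\<lambda>(y, s). ?r y \<otimes> s) ` ((\<lambda>g. \<phi> g x) ` L \<times> {g \<in> carrier G. \<phi> g x = x})"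
  proof
    fix g assume g: "g \<in> L"
    let ?h = "?r (\<phi> g x)"
    have c: "g \<in> carrier G" "?h \<in> carrier G" using g r[OF g] L by auto
    have "\<phi> (inv ?h \<otimes> g) x = \<phi> (inv ?h) (\<phi> ?h x)" using composition_rule[OF x, of "inv ?h" g] c r[OF g] by simp
    also have "\<dots> = x" using composition_rule[OF x, of "inv ?h" ?h] c one by simp
    finally have "inv ?h \<otimes> g \<in> {g \<in> carrier G. \<phi> g x = x}" using c by simp
    moreover have "g = ?h \<otimes> (inv ?h \<otimes> g)" using c by (simp add: m_assoc[symmetric])
    ultimately show "g \<in> (\<lambda>(y, s). ?r y \<otimes> s) ` ((\<lambda>g. \<phi> g x) ` L \<times> {g \<in> carrier G. \<phi> g x = x})"
      using g by (intro image_eqI[of _ _ "(\<phi> g x, inv ?h \<otimes> g)"]) auto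
  qed
  show "finite ((\<lambda>(y, s). ?r y \<otimes> s) ` ((\<lambda>g. \<phi> g x) ` L \<times> {g \<in> carrier G. \<phi> g x = x}))"
    by (rule finite_imageI[OF finite_cartesian_product[OF orb stab]])
qed

section \<open>Graph automorphisms as isometries of the vertex set\<close>

locale graph_action = cgraph Q + group G + group_action G "cells Q" \<psi>
  for Q :: "'a graph" and G :: "('g, 'm) monoid_scheme" (structure) and \<psi> +
  assumes act_face: "g \<in> carrier G \<Longrightarrow> a \<in> cells Q \<Longrightarrow> b \<in> cells Q \<Longrightarrow> face Q (\<psi> g a) (\<psi> g b) \<longleftrightarrow> face Q a b"
begin

lemma act_cells: "g \<in> carrier G \<Longrightarrow> a \<in> cells Q \<Longrightarrow> \<psi> g a \<in> cells Q"
  using element_image by blast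

lemma act_unit: "a \<in> cells Q \<Longrightarrow> \<psi> \<one> a = a"
  using id_eq_one by (metis restrict_apply')

lemma act_inverse: "g \<in> carrier G \<Longrightarrow> a \<in> cells Q \<Longrightarrow> \<psi> (inv g) (\<psi> g a) = a"
  "g \<in> carrier G \<Longrightarrow> a \<in> cells Q \<Longrightarrow> \<psi> g (\<psi> (inv g) a) = a"
  using composition_rule[of a "inv g" g] composition_rule[of a g "inv g"] act_unit by simp_all

lemma verts_iff: "a \<in> cells Q \<Longrightarrow> a \<in> V \<longleftrightarrow> (\<forall>b\<in>cells Q. face Q b a \<longrightarrow> b = a)"
proof
  assume "a \<in> V" then show "\<forall>b\<in>cells Q. face Q b a \<longrightarrow> b = a" using wf by (auto simp: face_def wf_graph_def)
next
  assume a: "a \<in> cells Q" and m: "\<forall>b\<in>cells Q. face Q b a \<longrightarrow> b = a"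
  show "a \<in> V"
  proof (rule ccontr)
    assume "a \<notin> V"
    then have e: "a \<in> edges Q" using a by (auto simp: cells_def)
    then have "card (ends Q a) \<in> {1, 2}" "ends Q a \<subseteq> V" using wf by (auto simp: wf_graph_def)
    then obtain v where "v \<in> ends Q a" "v \<in> V" by (metis all_not_in_conv card.empty insert_iff singletonD subsetD zero_neq_numeral zero_neq_one)
    then show False using m e \<open>a \<notin> V\<close> by (auto simp: face_def cells_def)
  qed
qed

lemma act_verts:
  assumes g: "g \<in> carrier G" and v: "v \<in> V"
  shows "\<psi> g v \<in> V"
proof -
  have vc: "v \<in> cells Q" using v by (simp add: cells_def)
  have "b = \<psi> g v" if b: "b \<in> cells Q" "face Q b (\<psi> g v)" for b
  proof -
    have "face Q (\<psi> (inv g) b) v" using act_face[of "inv g" b "\<psi> g v"] b act_inverse(1)[OF g vc] act_cells[OF g vc] g by simp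
    then have "\<psi> (inv g) b = v" using verts_iff[OF vc] v act_cells[of "inv g" b] b g by auto
    then show ?thesis using act_inverse(2)[OF g b(1)] by simp
  qed
  then show ?thesis using verts_iff[OF act_cells[OF g vc]] by blast
qed

lemma ends_iff: "e \<in> edges Q \<Longrightarrow> v \<in> ends Q e \<longleftrightarrow> v \<in> V \<and> face Q v e"
  using wf by (auto simp: face_def wf_graph_def)

lemma act_adj:
  assumes g: "g \<in> carrier G" and a: "(v, w) \<in> adj Q"
  shows "(\<psi> g v, \<psi> g w) \<in> adj Q"
proof -
  obtain e where e: "e \<in> edges Q" "ends Q e = {v, w}" using a by (auto simp: adj_def)
  have ec: "e \<in> cells Q" using e by (simp add: cells_def)
  have enV: "e \<notin> V" using wf e by (auto simp: wf_graph_def)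
  have "\<psi> g e \<notin> V" using act_verts[of "inv g" "\<psi> g e"] act_inverse(1)[OF g ec] g enV by auto
  then have ge: "\<psi> g e \<in> edges Q" using act_cells[OF g ec] by (auto simp: cells_def)
  have "ends Q (\<psi> g e) = \<psi> g ` ends Q e"
  proof (intro equalityI subsetI)
    fix u assume u: "u \<in> ends Q (\<psi> g e)"
    then have uV: "u \<in> V" "face Q u (\<psi> g e)" using ends_iff[OF ge] by auto
    have uc: "u \<in> cells Q" using uV by (simp add: cells_def)
    have "\<psi> (inv g) u \<in> V" using act_verts uV g by simp
    moreover have "face Q (\<psi> (inv g) u) e"
      using act_face[of "inv g" u "\<psi> g e"] uV(2) uc act_cells[OF g ec] act_inverse(1)[OF g ec] g by simp
    ultimately have "\<psi> (inv g) u \<in> ends Q e" using ends_iff[OF e(1)] by simp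
    then show "u \<in> \<psi> g ` ends Q e" using act_inverse(2)[OF g uc] by (metis image_eqI)
  next
    fix u assume "u \<in> \<psi> g ` ends Q e"
    then obtain t where t: "t \<in> ends Q e" "u = \<psi> g t" by auto
    then have "t \<in> V" "face Q t e" using ends_iff[OF e(1)] by auto
    then show "u \<in> ends Q (\<psi> g e)" using ends_iff[OF ge] t act_verts[OF g] act_face[OF g _ ec, of t] by (simp add: cells_def)
  qed
  then show ?thesis unfolding adj_def using ge e by auto
qed

lemma act_nd_le:
  assumes g: "g \<in> carrier G" and v: "v \<in> V" "w \<in> V"
  shows "nd (\<psi> g v) (\<psi> g w) \<le> nd v w"
proof -
  have "(\<psi> g v, \<psi> g w) \<in> adj Q ^^ n" if "(v, w) \<in> adj Q ^^ n" for n
    using that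
  proof (induction n arbitrary: w)
    case (Suc n) then show ?case using act_adj[OF g] by (auto intro: relcompI)
  qed simp
  then show ?thesis using nd_le nd_relpow[OF v] by blast
qed

lemma act_nd:
  assumes g: "g \<in> carrier G" and v: "v \<in> V" "w \<in> V"
  shows "nd (\<psi> g v) (\<psi> g w) = nd v w"
  using act_nd_le[OF g v] act_nd_le[of "inv g" "\<psi> g v" "\<psi> g w"] act_verts[OF g] act_inverse(1)[OF g] v g
  by (simp add: cells_def)

lemma isometric_action:
  assumes "v \<in> V"
  shows "isometric_action G V (gdist Q) \<psi> v"
proof -
  interpret g: geodesic_on V "gdist Q" by (rule geodesic_on)
  show ?thesis
    by unfold_locales (use assms act_verts act_unit composition_rule act_nd in \<open>auto simp: cells_def gdist_ndist\<close>)
qed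

end

lemma quasitree_action:
  assumes Q: "quasitree Q" "locally_finite_graph Q" and G: "group G"
    and act: "acts_by_automorphisms G (cells Q) (face Q) \<psi>" and x: "x \<in> verts Q"
  shows "\<exists>\<delta>. proper_quasitree_action G (verts Q) (gdist Q) \<psi> x \<delta>"
proof -
  interpret c: cgraph Q using Q by unfold_locales (auto simp: quasitree_def)
  interpret G: group G by fact
  interpret a: group_action G "cells Q" \<psi> using act by (simp add: acts_by_automorphisms_def)
  interpret graph_action Q G \<psi>
    by unfold_locales (use act in \<open>auto simp: acts_by_automorphisms_def\<close>)
  interpret i: isometric_action G "verts Q" "gdist Q" \<psi> x by (rule isometric_action[OF x])
  interpret b: bottleneck "verts Q" "gdist Q" by (rule quasitree_bottleneck[OF Q(1)])
  obtain \<delta> where "hyperbolic (verts Q) (gdist Q) \<delta>" using b.hyperbolic by blast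
  then interpret h: hyperbolic "verts Q" "gdist Q" \<delta> .
  have "finite {y \<in> verts Q. gdist Q v y \<le> r}" if v: "v \<in> verts Q" for v r
  proof (rule finite_subset[OF _ c.finite_nd_ball[OF Q(2) v, of "nat \<lfloor>r\<rfloor>"]])
    show "{y \<in> verts Q. gdist Q v y \<le> r} \<subseteq> {w \<in> verts Q. c.nd v w \<le> nat \<lfloor>r\<rfloor>}"
      unfolding gdist_ndist by (auto simp: le_nat_iff le_floor_iff)
  qed
  then have "proper_quasitree_action G (verts Q) (gdist Q) \<psi> x \<delta>" by unfold_locales
  then show ?thesis by blast
qed

lemma contains_F2_of_general_type:
  assumes G: "group G" and Q: "\<And>i. i < k \<Longrightarrow> quasitree (Q i) \<and> locally_finite_graph (Q i)"
    and gt: "general_type_on_factor G k Q \<phi>"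
  shows "contains_F2 G"
proof -
  interpret group G by fact
  obtain H \<psi> i where H: "finite_index H G" and fa: "factor_actions (G\<lparr>carrier := H\<rparr>) k Q \<phi> \<psi>" and i: "i < k"
    and g: "general_type (G\<lparr>carrier := H\<rparr>) (verts (Q i)) (gdist (Q i)) (\<psi> i)"
    using gt unfolding general_type_on_factor_def by blast
  have sH: "subgroup H G" using H by (simp add: finite_index_def)
  obtain x where x: "x \<in> verts (Q i)" using Q[OF i] by (auto simp: quasitree_def connected_graph_def)
  have act: "acts_by_automorphisms (G\<lparr>carrier := H\<rparr>) (cells (Q i)) (face (Q i)) (\<psi> i)"
    using fa i by (simp add: factor_actions_def)
  obtain \<delta> where "proper_quasitree_action (G\<lparr>carrier := H\<rparr>) (verts (Q i)) (gdist (Q i)) (\<psi> i) x \<delta>"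
    using quasitree_action[OF conjunct1[OF Q[OF i]] conjunct2[OF Q[OF i]] subgroup_imp_group[OF sH] act x] by blast
  then interpret p: proper_quasitree_action "G\<lparr>carrier := H\<rparr>" "verts (Q i)" "gdist (Q i)" "\<psi> i" x \<delta> .
  obtain a b where "a \<in> H" "p.lox a" "b \<in> H" "p.lox b" "p.indep a b" using p.general_typeD[OF g] by auto
  then have "contains_F2 (G\<lparr>carrier := H\<rparr>)" using p.contains_F2_of_indep[of a b] by simp
  then show ?thesis by (rule contains_F2_subgroup[OF sH])
qed

lemma characters_of_product_action:
  fixes G :: "'g monoid" and Q :: "nat \<Rightarrow> 'a graph"
  assumes G: "group G" and Q: "\<And>i. i < k \<Longrightarrow> quasitree (Q i) \<and> locally_finite_graph (Q i)"
    and act: "acts_by_automorphisms G (prod_cells k Q) (prod_face k Q) \<phi>"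
    and proper: "proper_action G (prod_cells k Q) (prod_face k Q) \<phi>"
    and ngt: "\<not> general_type_on_factor G k Q \<phi>"
  shows "\<exists>H \<tau>. finite_index H G \<and> (\<forall>i<k. group.additive (G\<lparr>carrier := H\<rparr>) (\<tau> i)) \<and>
    locally_finite_group (G\<lparr>carrier := {h \<in> H. \<forall>i<k. \<tau> i h = 0}\<rparr>)"
proof -
  interpret graph_product_action k Q G \<phi>
    by (intro graph_product_action.intro graph_product.intro graph_product_action_axioms.intro G act)
      (use Q in \<open>auto simp: quasitree_def\<close>)
  let ?G = "G\<lparr>carrier := factor_group\<rparr>"
  note sub0 = subgroup_factor_group
  interpret G0: group ?G using subgroup_imp_group[OF sub0] .
  obtain \<psi> where \<psi>: "factor_actions ?G k Q \<phi> \<psi>" using exists_factor_actions by blast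
  obtain x where x: "x \<in> C" "type x = {}" using exists_vertex by blast
  have xV: "x i \<in> verts (Q i)" if "i < k" for i using cell_cases[OF x(1) that] x(2) by simp
  have "\<exists>\<delta>. proper_quasitree_action ?G (verts (Q i)) (gdist (Q i)) (\<psi> i) (x i) \<delta>" if "i < k" for i
    by (rule quasitree_action) (use Q[OF that] \<psi> that xV[OF that] G0.is_group in \<open>auto simp: factor_actions_def\<close>)
  then obtain \<delta> where pq: "\<And>i. i < k \<Longrightarrow> proper_quasitree_action ?G (verts (Q i)) (gdist (Q i)) (\<psi> i) (x i) (\<delta> i)"
    by metis
  have "\<exists>H. \<exists>\<tau> :: 'g \<Rightarrow> int. finite_index H ?G \<and> (\<forall>g\<in>H. \<forall>h\<in>H. \<tau> (g \<otimes>\<^bsub>G\<^esub> h) = \<tau> g + \<tau> h) \<and>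
      (\<forall>g\<in>H. \<tau> g = 0 \<longrightarrow> \<not> loxodromic ?G (verts (Q i)) (gdist (Q i)) (\<psi> i) g)" if i: "i < k" for i
  proof -
    have "\<not> general_type ?G (verts (Q i)) (gdist (Q i)) (\<psi> i)"
      using ngt finite_index_factor_group \<psi> i unfolding general_type_on_factor_def by blast
    from proper_quasitree_action.lineal_homomorphism[OF pq[OF i] this] show ?thesis by simp
  qed
  then obtain Hi \<tau> where Hi: "\<And>i. i < k \<Longrightarrow> finite_index (Hi i) ?G"
    and \<tau>: "\<And>i g h. i < k \<Longrightarrow> g \<in> Hi i \<Longrightarrow> h \<in> Hi i \<Longrightarrow> \<tau> i (g \<otimes>\<^bsub>G\<^esub> h) = (\<tau> i g + \<tau> i h :: int)"
    and nl: "\<And>i g. i < k \<Longrightarrow> g \<in> Hi i \<Longrightarrow> \<tau> i g = 0 \<Longrightarrow> \<not> loxodromic ?G (verts (Q i)) (gdist (Q i)) (\<psi> i) g"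
    by metis
  \<comment> \<open>A common finite index subgroup on which all \<open>k\<close> characters are
    defined.\<close>
  define H where "H = {g \<in> carrier ?G. \<forall>i<k. g \<in> Hi i}"
  have fiH0: "finite_index H ?G" unfolding H_def by (rule G0.finite_index_INT[OF Hi])
  have fiH: "finite_index H G" by (rule finite_index_trans[OF finite_index_factor_group fiH0])
  have sH: "subgroup H G" using fiH by (simp add: finite_index_def)
  interpret GH: group "G\<lparr>carrier := H\<rparr>" using subgroup_imp_group[OF sH] .
  have add: "GH.additive (\<tau> i)" if "i < k" for i unfolding GH.additive_def using \<tau>[OF that] that by (simp add: H_def)
  define K where "K = {h \<in> H. \<forall>i<k. \<tau> i h = 0}"
  have Keq: "K = {h \<in> carrier (G\<lparr>carrier := H\<rparr>). \<forall>i<k. \<tau> i h = 0}" by (simp add: K_def)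
  have "K \<lhd> G\<lparr>carrier := H\<rparr>" unfolding Keq by (rule GH.characters_quotient(2)[OF add])
  then have sK: "subgroup K G" using incl_subgroup[OF sH normal_imp_subgroup] by blast
  have K0: "K \<subseteq> factor_group" by (auto simp: K_def H_def)
  have Kc: "K \<subseteq> carrier G" using sK by (rule subgroup.subset)
  have "locally_finite_group (G\<lparr>carrier := K\<rparr>)"
    unfolding locally_finite_group_def
  proof (intro allI impI)
    fix S assume S: "S \<subseteq> carrier (G\<lparr>carrier := K\<rparr>)" "finite S"
    then have SK: "S \<subseteq> K" by simp
    let ?L = "generate G S"
    have LK: "?L \<subseteq> K" by (rule generate_subgroup_incl[OF SK sK])
    have L0: "generate ?G S = ?L" using generate_consistent[OF _ sub0, of S] SK K0 by auto
    have "\<exists>R. \<forall>g\<in>?L. gdist (Q i) (x i) (\<psi> i g (x i)) \<le> R" if i: "i < k" for i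
    proof -
      interpret p: proper_quasitree_action ?G "verts (Q i)" "gdist (Q i)" "\<psi> i" "x i" "\<delta> i" by (rule pq[OF i])
      show ?thesis unfolding L0[symmetric]
        by (rule p.bounded_orbit[OF S(2)]) (use SK K0 L0 LK nl[OF i] i in \<open>auto simp: K_def H_def\<close>)
    qed
    then obtain R where R: "\<And>i g. i < k \<Longrightarrow> g \<in> ?L \<Longrightarrow> gdist (Q i) (x i) (\<psi> i g (x i)) \<le> R i" by metis
    \<comment> \<open>Bounded orbits in all factors confine the orbit of \<open>x\<close> to a
      product of finite balls.\<close>
    have "(\<lambda>g. \<phi> g x) ` ?L \<subseteq> (\<Pi>\<^sub>E i\<in>{..<k}. {y \<in> verts (Q i). gdist (Q i) (x i) y \<le> R i})"
    proof (rule image_subsetI)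
      fix g assume g: "g \<in> ?L"
      have g0: "g \<in> factor_group" using g LK K0 by auto
      have coord: "\<phi> g x i = \<psi> i g (x i)" if "i < k" for i using \<psi> g0 x that by (simp add: factor_actions_def)
      have "\<psi> i g (x i) \<in> verts (Q i)" if i: "i < k" for i
      proof -
        interpret p: proper_quasitree_action ?G "verts (Q i)" "gdist (Q i)" "\<psi> i" "x i" "\<delta> i" by (rule pq[OF i])
        show ?thesis using p.act_closed[of g "x i"] g0 p.base by simp
      qed
      moreover have "\<phi> g x \<in> extensional {..<k}"
        using act_C[OF factor_group_carrier[OF g0] x(1)] by (simp add: prod_cells_def PiE_def)
      ultimately show "\<phi> g x \<in> (\<Pi>\<^sub>E i\<in>{..<k}. {y \<in> verts (Q i). gdist (Q i) (x i) y \<le> R i})"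
        using coord R[OF _ g] by (auto simp: PiE_def)
    qed
    moreover have "finite (\<Pi>\<^sub>E i\<in>{..<k}. {y \<in> verts (Q i). gdist (Q i) (x i) y \<le> R i})"
    proof (rule finite_PiE)
      fix i assume i: "i \<in> {..<k}"
      then interpret p: proper_quasitree_action ?G "verts (Q i)" "gdist (Q i)" "\<psi> i" "x i" "\<delta> i" using pq by simp
      show "finite {y \<in> verts (Q i). gdist (Q i) (x i) y \<le> R i}" by (rule p.finite_ball[OF p.base])
    qed simp
    ultimately have orb: "finite ((\<lambda>g. \<phi> g x) ` ?L)" by (rule finite_subset)
    \<comment> \<open>A single vertex is a finite subcomplex, so properness makes its stabiliser
      finite.\<close>
    have "\<forall>b\<in>{x}. \<forall>a\<in>C. F a b \<longrightarrow> a \<in> {x}" using type_empty_iff[OF x(1)] x(2) by auto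
    then have "finite {g \<in> carrier G. \<phi> g ` {x} \<inter> {x} \<noteq> {}}"
      by (intro proper[unfolded proper_action_def, rule_format, of "{x}"]) (use x(1) in auto)
    moreover have "{g \<in> carrier G. \<phi> g ` {x} \<inter> {x} \<noteq> {}} = {g \<in> carrier G. \<phi> g x = x}" by auto
    ultimately have "finite {g \<in> carrier G. \<phi> g x = x}" by simp
    then have "finite ?L" by (rule stabilizer_orbit_finite[OF act.group_action_axioms x(1) _ _ orb, rotated]) (use LK Kc in auto)
    moreover have "generate (G\<lparr>carrier := K\<rparr>) S = ?L" by (rule generate_consistent[OF SK sK])
    ultimately show "finite (generate (G\<lparr>carrier := K\<rparr>) S)" by simp
  qed
  then show ?thesis using fiH add unfolding K_def by blast
qed

theorem corollary10p2:
  fixes G :: "'g monoid"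
    and Q :: "nat \<Rightarrow> 'a graph"
    and k :: nat
    and \<phi> :: "'g \<Rightarrow> (nat \<Rightarrow> 'a) \<Rightarrow> (nat \<Rightarrow> 'a)"
  assumes "group G"
    and "\<And>i. i < k \<Longrightarrow> quasitree (Q i) \<and> locally_finite_graph (Q i)"
    and "acts_by_automorphisms G (prod_cells k Q) (prod_face k Q) \<phi>"
    and "proper_action G (prod_cells k Q) (prod_face k Q) \<phi>"
  shows "(general_type_on_factor G k Q \<phi> \<or>
          (\<exists>H K n. finite_index H G \<and> K \<lhd> G\<lparr>carrier := H\<rparr> \<and>
             locally_finite_group (G\<lparr>carrier := K\<rparr>) \<and>
             n \<le> k \<and> G\<lparr>carrier := H\<rparr> Mod K \<cong> Zn n))
       \<and> (general_type_on_factor G k Q \<phi> \<longrightarrow> contains_F2 G)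
       \<and> ((\<nexists>L. subgroup L G \<and> infinite L \<and> locally_finite_group (G\<lparr>carrier := L\<rparr>)) \<or>
          (\<nexists>L. subgroup L G \<and> infinite L \<and> locally_finite_group (G\<lparr>carrier := L\<rparr>) \<and>
               finite_index (normalizer G L) G)
          \<longrightarrow> contains_F2 G \<or> (\<exists>n. virtually_Zn G n))"
proof (cases "general_type_on_factor G k Q \<phi>")
  case True
  have "contains_F2 G" by (rule contains_F2_of_general_type[of G k Q \<phi>, OF assms(1,2) True])
  then show ?thesis using True by blast
next
  case False
  interpret group G by fact
  obtain H \<tau> where H: "finite_index H G" and t: "\<And>i. i < k \<Longrightarrow> group.additive (G\<lparr>carrier := H\<rparr>) (\<tau> i)"
    and lf: "locally_finite_group (G\<lparr>carrier := {h \<in> H. \<forall>i<k. \<tau> i h = 0}\<rparr>)"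
    using characters_of_product_action[of G k Q \<phi>, OF assms False] by blast
  define K where "K = {h \<in> H. \<forall>i<k. \<tau> i h = 0}"
  have K: "K = {h \<in> carrier (G\<lparr>carrier := H\<rparr>). \<forall>i<k. \<tau> i h = 0}" by (simp add: K_def)
  have sH: "subgroup H G" using H by (simp add: finite_index_def)
  interpret GH: group "G\<lparr>carrier := H\<rparr>" using subgroup_imp_group[OF sH] .
  have nK: "K \<lhd> G\<lparr>carrier := H\<rparr>" unfolding K by (rule GH.characters_quotient(2)[OF t])
  have lfK: "locally_finite_group (G\<lparr>carrier := K\<rparr>)" using lf by (simp add: K_def)
  obtain n where n: "n \<le> k" "G\<lparr>carrier := H\<rparr> Mod K \<cong> Zn n"
    using GH.characters_quotient(1)[of k \<tau>, OF t] unfolding K by blast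
  have 1: "\<exists>H K n. finite_index H G \<and> K \<lhd> G\<lparr>carrier := H\<rparr> \<and> locally_finite_group (G\<lparr>carrier := K\<rparr>) \<and>
      n \<le> k \<and> G\<lparr>carrier := H\<rparr> Mod K \<cong> Zn n"
    using H nK lfK n by blast
  have 2: "\<exists>n. virtually_Zn G n"
    if h: "(\<nexists>L. subgroup L G \<and> infinite L \<and> locally_finite_group (G\<lparr>carrier := L\<rparr>)) \<or>
          (\<nexists>L. subgroup L G \<and> infinite L \<and> locally_finite_group (G\<lparr>carrier := L\<rparr>) \<and> finite_index (normalizer G L) G)"
  proof -
    have "subgroup K G" by (rule incl_subgroup[OF sH normal_imp_subgroup[OF nK]])
    \<comment> \<open>Otherwise \<open>K\<close> itself would be an infinite locally finite subgroup
      whose normaliser has finite index because it contains \<open>H\<close>.\<close>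
    then have "finite K" using h lfK finite_index_normalizer[OF H nK] by blast
    then obtain m where "virtually_Zn (G\<lparr>carrier := H\<rparr>) m"
      using GH.virtually_Zn_of_finite_kernel[of k \<tau>, OF t] unfolding K by blast
    then show ?thesis using virtually_Zn_finite_index[OF H] by blast
  qed
  show ?thesis using 1 2 False by blast
qed

end
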